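(* Let $\mathbb F$ be an algebraically closed field of characteristic zero and $n,m,d,k\ge1$. For every linear map $\phi:\mathrm{Ten}(n,d)\to\mathrm{Ten}(m,k)$ such that $a:=\max\{\mathrm{brk}(\phi(s)):s\in S\}\ge1$, where $S$ is the set of rank-one tensors in $\mathrm{Ten}(n,d)$, its border potency satisfies $$\mathrm{Bpot}(\phi)\le k^d\cdot n^{\lfloor (k-1)d/k\rfloor}.$$
   Context: $\mathrm{Ten}(m,k)=(\mathbb F^m)^{\otimes k}$. The border rank $\mathrm{brk}(T)$ of $T\in\mathrm{Ten}(m,k)$ is the least $r$ such that $T$ lies in the Zariski closure of the set of tensors of tensor rank $\le r$. The border potency is $\mathrm{Bpot}(\phi)=\max\{\mathrm{brk}(\phi(T)):T\in\mathrm{Ten}(n,d)\}/a$. *)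

theory Defs
  imports "HOL-Computational_Algebra.Polynomial"
begin

text \<open>Tensors in Ten(m,k) = (F^m)^{tensor k} are represented as functions from
 multi-indices (lists of length k with entries < m) to F, vanishing outside
 the index set.\<close>

definition tidx :: "nat \<Rightarrow> nat \<Rightarrow> nat list set" where
  "tidx m k = {xs. length xs = k \<and> (\<forall>i\<in>set xs. i < m)}"

definition Ten :: "nat \<Rightarrow> nat \<Rightarrow> (nat list \<Rightarrow> 'a::zero) set" where
  "Ten m k = {T. \<forall>xs. xs \<notin> tidx m k \<longrightarrow> T xs = 0}"

definition simple_tensors :: "nat \<Rightarrow> nat \<Rightarrow> (nat list \<Rightarrow> 'a::comm_ring_1) set" where
  "simple_tensors m k = {T. \<exists>v :: nat \<Rightarrow> nat \<Rightarrow> 'a.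
      (\<forall>j i. i \<ge> m \<longrightarrow> v j i = 0) \<and>
      T = (\<lambda>xs. if xs \<in> tidx m k then (\<Prod>j<k. v j (xs ! j)) else 0)}"

definition rank_one_tensors :: "nat \<Rightarrow> nat \<Rightarrow> (nat list \<Rightarrow> 'a::comm_ring_1) set" where
  "rank_one_tensors m k = {T \<in> simple_tensors m k. T \<noteq> (\<lambda>_. 0)}"

definition rank_le :: "nat \<Rightarrow> nat \<Rightarrow> nat \<Rightarrow> (nat list \<Rightarrow> 'a::comm_ring_1) set" where
  "rank_le m k r = {T. \<exists>S :: nat \<Rightarrow> nat list \<Rightarrow> 'a.
      (\<forall>l<r. S l \<in> simple_tensors m k) \<and> T = (\<lambda>xs. \<Sum>l<r. S l xs)}"

inductive poly_fun :: "nat list set \<Rightarrow> ((nat list \<Rightarrow> 'a::comm_ring_1) \<Rightarrow> 'a) \<Rightarrow> bool"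
  for I where
  const: "poly_fun I (\<lambda>_. c)"
| coord: "xs \<in> I \<Longrightarrow> poly_fun I (\<lambda>T. T xs)"
| add: "poly_fun I p \<Longrightarrow> poly_fun I q \<Longrightarrow> poly_fun I (\<lambda>T. p T + q T)"
| mult: "poly_fun I p \<Longrightarrow> poly_fun I q \<Longrightarrow> poly_fun I (\<lambda>T. p T * q T)"

definition zariski_closure :: "nat \<Rightarrow> nat \<Rightarrow> (nat list \<Rightarrow> 'a::comm_ring_1) set \<Rightarrow> (nat list \<Rightarrow> 'a) set" where
  "zariski_closure m k A = {T \<in> Ten m k. \<forall>p. poly_fun (tidx m k) p \<longrightarrow>
      (\<forall>s\<in>A. p s = 0) \<longrightarrow> p T = 0}"

definition brk :: "nat \<Rightarrow> nat \<Rightarrow> (nat list \<Rightarrow> 'a::comm_ring_1) \<Rightarrow> nat" where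
  "brk m k T = (LEAST r. T \<in> zariski_closure m k (rank_le m k r))"

definition linear_ten_map :: "nat \<Rightarrow> nat \<Rightarrow> nat \<Rightarrow> nat \<Rightarrow>
    ((nat list \<Rightarrow> 'a::comm_ring_1) \<Rightarrow> (nat list \<Rightarrow> 'a)) \<Rightarrow> bool" where
  "linear_ten_map n d m k \<phi> \<longleftrightarrow>
     (\<forall>x\<in>Ten n d. \<phi> x \<in> Ten m k) \<and>
     (\<forall>x\<in>Ten n d. \<forall>y\<in>Ten n d. \<phi> (\<lambda>i. x i + y i) = (\<lambda>i. \<phi> x i + \<phi> y i)) \<and>
     (\<forall>c. \<forall>x\<in>Ten n d. \<phi> (\<lambda>i. c * x i) = (\<lambda>i. c * \<phi> x i))"

definition Bpot :: "nat \<Rightarrow> nat \<Rightarrow> nat \<Rightarrow> nat \<Rightarrow> nat \<Rightarrow>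
    ((nat list \<Rightarrow> 'a::comm_ring_1) \<Rightarrow> (nat list \<Rightarrow> 'a)) \<Rightarrow> real" where
  "Bpot n d m k a \<phi> = real (Max ((\<lambda>T. brk m k (\<phi> T)) ` Ten n d)) / real a"

end

(*
Evaluate phi at a generic rank-one tensor v_1 x ... x v_d over the field K generated by the entries of
the v_i.  By curve selection its border rank bound a is witnessed by vectors with entries in K((eps)):
phi(v_1 x ... x v_d) is the constant term of a sum of a products of k vectors.  Applying d/dv_{1,c_1} ...
d/dv_{d,c_d} coefficientwise turns the left-hand side into phi(e_{c_1} x ... x e_{c_d}), while the Leibniz
rule turns the right-hand side into a sum over the k^d assignments of the d derivations to the k factors.
In each of these terms some factor receives at least d/k derivations, so summing the term against the
entries T_c and grouping by the remaining indices leaves at most n^((k-1)d/k) products.  Curve selection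
itself: Noether normalization, then a generic power series deformation of the coordinates, lifted along an
element separating the fibre by Puiseux's theorem; normality of the polynomial ring ensures the lift
passes through the prescribed point.
*)
theory Submission
  imports "HOL-Algebra.Algebraic_Closure_Type" "Jordan_Normal_Form.Char_Poly"
    "HOL-Computational_Algebra.Computational_Algebra" Defs
begin

subsection \<open>Subrings, adjunction and homomorphisms on subrings\<close>

text \<open>A border rank decomposition of the image of a rank-one tensor depends on the vectors in
  an uncontrolled way, so it cannot be differentiated pointwise. At the generic point a single
  decomposition over K((eps)), with K algebraically closed, serves all vectors at once. Partial
  derivatives extend to K because K is algebraic over the polynomial ring and the characteristic is
  zero; they act on series coefficientwise and treat eps as a constant. The new decomposition again
  lives over K((eps)). It descends to F because a polynomial over F that vanishes on all tensors of
  rank at most r also vanishes on such tensors over K((eps)); here the entries are power series, and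
  taking constant terms yields the equation at phi(T). Curve selection is phrased without varieties:
  a point is a homomorphism \<open>q\<close> on a finitely generated ring, a curve through it is a
  homomorphism into Laurent series that has no poles on this ring and has residue \<open>q\<close>.
  Normality is used to make minimal polynomials of integral elements monic, so that they reduce well
  at the point.\<close>

definition is_subring :: "'a::comm_ring_1 set \<Rightarrow> bool" where
  "is_subring R \<longleftrightarrow> 1 \<in> R \<and> (\<forall>a\<in>R. \<forall>b\<in>R. a + b \<in> R \<and> a * b \<in> R) \<and> (\<forall>a\<in>R. - a \<in> R)"

definition poly_over :: "'a::zero set \<Rightarrow> 'a poly \<Rightarrow> bool" where
  "poly_over R p \<longleftrightarrow> (\<forall>i. coeff p i \<in> R)"

text \<open>All rings are subsets of one ambient ring and homomorphisms are total functions looked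
  at on a subset, so an extension along a tower is again a function of the same type.
  \<open>h 0 = 0\<close> is imposed outright because \<open>map_poly h\<close> depends on
  it.\<close>

definition hom_on :: "'a::comm_ring_1 set \<Rightarrow> ('a \<Rightarrow> 'b::comm_ring_1) \<Rightarrow> bool" where
  "hom_on R h \<longleftrightarrow> h 0 = 0 \<and> h 1 = 1 \<and> (\<forall>a\<in>R. \<forall>b\<in>R. h (a + b) = h a + h b \<and> h (a * b) = h a * h b)"

definition adjoin :: "'a::comm_ring_1 set \<Rightarrow> 'a \<Rightarrow> 'a set" where
  "adjoin R z = {poly p z | p. poly_over R p}"

lemma is_subringD:
  assumes "is_subring R"
  shows "1 \<in> R" "0 \<in> R" "a \<in> R \<Longrightarrow> b \<in> R \<Longrightarrow> a + b \<in> R" "a \<in> R \<Longrightarrow> b \<in> R \<Longrightarrow> a * b \<in> R"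
    "a \<in> R \<Longrightarrow> - a \<in> R" "a \<in> R \<Longrightarrow> b \<in> R \<Longrightarrow> a - b \<in> R" "a \<in> R \<Longrightarrow> a ^ n \<in> R"
proof -
  show *: "1 \<in> R" "a \<in> R \<Longrightarrow> b \<in> R \<Longrightarrow> a + b \<in> R" "a \<in> R \<Longrightarrow> b \<in> R \<Longrightarrow> a * b \<in> R"
    "a \<in> R \<Longrightarrow> - a \<in> R" for a b using assms by (auto simp: is_subring_def)
  show "0 \<in> R" using *(2)[OF *(1) *(4)[OF *(1)]] by simp
  show "a \<in> R \<Longrightarrow> b \<in> R \<Longrightarrow> a - b \<in> R" using *(2)[of a "-b"] *(4)[of b] by simp
  show "a \<in> R \<Longrightarrow> a ^ n \<in> R" by (induction n) (auto intro: *)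
qed

lemma subring_sum: "is_subring R \<Longrightarrow> (\<And>i. i \<in> I \<Longrightarrow> f i \<in> R) \<Longrightarrow> sum f I \<in> R"
  by (induction I rule: infinite_finite_induct) (auto intro: is_subringD)

lemma subring_prod: "is_subring R \<Longrightarrow> (\<And>i. i \<in> I \<Longrightarrow> f i \<in> R) \<Longrightarrow> prod f I \<in> R"
  by (induction I rule: infinite_finite_induct) (auto intro: is_subringD)

lemma is_subring_UNIV [simp]: "is_subring UNIV"
  by (auto simp: is_subring_def)

lemma poly_over_UNIV [simp]: "poly_over UNIV p"
  by (auto simp: poly_over_def)

lemma poly_over_0 [simp]: "is_subring R \<Longrightarrow> poly_over R 0"
  by (auto simp: poly_over_def intro: is_subringD)

lemma poly_over_pCons: "a \<in> R \<Longrightarrow> poly_over R p \<Longrightarrow> poly_over R (pCons a p)"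
  by (auto simp: poly_over_def coeff_pCons split: nat.splits)

lemma poly_over_pCons_iff: "poly_over R (pCons a p) \<longleftrightarrow> a \<in> R \<and> poly_over R p"
proof
  assume *: "poly_over R (pCons a p)"
  have "coeff (pCons a p) 0 \<in> R" "\<And>i. coeff (pCons a p) (Suc i) \<in> R"
    using * unfolding poly_over_def by blast+
  thus "a \<in> R \<and> poly_over R p" by (auto simp: poly_over_def)
qed (auto intro: poly_over_pCons)

lemma poly_over_arith:
  assumes R: "is_subring R"
  shows "poly_over R 1" "poly_over R p \<Longrightarrow> poly_over R q \<Longrightarrow> poly_over R (p + q)"
    "poly_over R p \<Longrightarrow> poly_over R q \<Longrightarrow> poly_over R (p * q)"
    "poly_over R p \<Longrightarrow> poly_over R q \<Longrightarrow> poly_over R (p - q)"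
    "poly_over R p \<Longrightarrow> poly_over R (- p)"
    "c \<in> R \<Longrightarrow> poly_over R p \<Longrightarrow> poly_over R (smult c p)"
    "c \<in> R \<Longrightarrow> poly_over R (monom c n)"
    "poly_over R p \<Longrightarrow> poly_over R (p ^ n)"
proof -
  note R' = is_subringD[OF R]
  show 1: "poly_over R 1" by (simp add: poly_over_def coeff_1 R')
  show 2: "poly_over R (p * q)" if "poly_over R p" "poly_over R q" for p q
    using that by (simp add: poly_over_def coeff_mult subring_sum[OF R] R')
  show "poly_over R p \<Longrightarrow> poly_over R (p ^ n)" by (induction n) (simp_all add: 1 2)
qed (simp_all add: poly_over_def is_subringD[OF R])

lemma poly_over_mono: "poly_over R p \<Longrightarrow> R \<subseteq> S \<Longrightarrow> poly_over S p"
  by (auto simp: poly_over_def)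

lemma poly_in_subring: "is_subring R \<Longrightarrow> poly_over R p \<Longrightarrow> z \<in> R \<Longrightarrow> poly p z \<in> R"
  by (induction p) (auto simp: poly_over_pCons_iff intro!: is_subringD)

lemma poly_over_sum: "is_subring R \<Longrightarrow> (\<And>i. i \<in> I \<Longrightarrow> poly_over R (f i)) \<Longrightarrow> poly_over R (sum f I)"
  by (induction I rule: infinite_finite_induct) (auto intro: poly_over_arith)

lemma poly_over_prod: "is_subring R \<Longrightarrow> (\<And>i. i \<in> I \<Longrightarrow> poly_over R (f i)) \<Longrightarrow> poly_over R (prod f I)"
  by (induction I rule: infinite_finite_induct) (auto intro: poly_over_arith)

lemma hom_onD:
  assumes "hom_on R h"
  shows "h 0 = 0" "h 1 = 1" "a \<in> R \<Longrightarrow> b \<in> R \<Longrightarrow> h (a + b) = h a + h b"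
    "a \<in> R \<Longrightarrow> b \<in> R \<Longrightarrow> h (a * b) = h a * h b"
  using assms by (auto simp: hom_on_def)

lemma hom_on_more:
  assumes "hom_on R h" "is_subring R"
  shows "a \<in> R \<Longrightarrow> h (- a) = - h a" "a \<in> R \<Longrightarrow> b \<in> R \<Longrightarrow> h (a - b) = h a - h b"
    "a \<in> R \<Longrightarrow> h (a ^ n) = h a ^ n"
proof -
  show 1: "h (- a) = - h a" if "a \<in> R" for a
    using hom_onD(3)[OF assms(1), of a "- a"] that hom_onD(1)[OF assms(1)] is_subringD(5)[OF assms(2), of a]
    by (simp add: add_eq_0_iff)
  show "h (a - b) = h a - h b" if "a \<in> R" "b \<in> R"
    using hom_onD(3)[OF assms(1), of a "-b"] that 1[of b] is_subringD(5)[OF assms(2), of b] by simp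
  show "h (a ^ n) = h a ^ n" if "a \<in> R"
    using that by (induction n) (auto simp: hom_onD[OF assms(1)] is_subringD[OF assms(2)])
qed

lemma hom_on_sum:
  assumes "hom_on R h" "is_subring R" "\<And>i. i \<in> I \<Longrightarrow> f i \<in> R"
  shows "h (sum f I) = (\<Sum>i\<in>I. h (f i))"
  using assms(3)
  by (induction I rule: infinite_finite_induct)
     (auto simp: hom_onD[OF assms(1)] subring_sum[OF assms(2)])

lemma hom_on_prod:
  assumes "hom_on R h" "is_subring R" "\<And>i. i \<in> I \<Longrightarrow> f i \<in> R"
  shows "h (prod f I) = (\<Prod>i\<in>I. h (f i))"
  using assms(3)
  by (induction I rule: infinite_finite_induct)
     (auto simp: hom_onD[OF assms(1)] subring_prod[OF assms(2)])

lemma hom_on_subset: "hom_on R h \<Longrightarrow> S \<subseteq> R \<Longrightarrow> hom_on S h"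
  by (auto simp: hom_on_def)

lemma hom_on_comp: "hom_on R h \<Longrightarrow> hom_on S g \<Longrightarrow> h ` R \<subseteq> S \<Longrightarrow> hom_on R (\<lambda>x. g (h x))"
  by (auto simp: hom_on_def image_subset_iff)

lemma map_poly_hom_on:
  assumes "hom_on R h" "is_subring R" "poly_over R p" "poly_over R q"
  shows "map_poly h (p + q) = map_poly h p + map_poly h q"
    "map_poly h (p * q) = map_poly h p * map_poly h q"
    "map_poly h (p - q) = map_poly h p - map_poly h q"
proof -
  note [simp] = coeff_map_poly[of h, OF hom_onD(1)[OF assms(1)]]
  have pq: "coeff p i \<in> R" "coeff q i \<in> R" for i using assms by (auto simp: poly_over_def)
  show "map_poly h (p + q) = map_poly h p + map_poly h q"
    by (rule poly_eqI) (simp add: hom_onD[OF assms(1)] pq)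
  show "map_poly h (p * q) = map_poly h p * map_poly h q"
    by (rule poly_eqI)
       (simp add: coeff_mult hom_on_sum[OF assms(1,2)] hom_onD[OF assms(1)] pq is_subringD(4)[OF assms(2)])
  show "map_poly h (p - q) = map_poly h p - map_poly h q"
    by (rule poly_eqI) (simp add: hom_on_more[OF assms(1,2)] pq)
qed

lemma map_poly_hom_on_smult:
  assumes "hom_on R h" "poly_over R p" "c \<in> R"
  shows "map_poly h (smult c p) = smult (h c) (map_poly h p)"
  using assms(2,3) by (intro poly_eqI)
    (auto simp: coeff_map_poly[of h, OF hom_onD(1)[OF assms(1)]] hom_onD[OF assms(1)] poly_over_def)

lemma poly_map_poly_hom_on:
  assumes "hom_on R h" "is_subring R" "poly_over R p" "z \<in> R"
  shows "poly (map_poly h p) (h z) = h (poly p z)"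
  using assms(3)
  by (induction p)
     (auto simp: hom_onD[OF assms(1)] poly_over_pCons_iff Polynomial.map_poly_pCons[where f = h, OF hom_onD(1)[OF assms(1)]]
       poly_in_subring[OF assms(2)] is_subringD[OF assms(2)] assms(4))

lemma map_poly_cong_over:
  assumes "\<And>x. x \<in> R \<Longrightarrow> h x = g x" "poly_over R p"
  shows "map_poly h p = map_poly g p"
proof (rule map_poly_cong)
  fix x assume "x \<in> set (coeffs p)"
  then obtain i where "x = coeff p i" by (auto simp: coeffs_def split: if_splits)
  thus "h x = g x" using assms by (auto simp: poly_over_def)
qed

lemma adjoinI: "poly_over R p \<Longrightarrow> poly p z \<in> adjoin R z"
  by (auto simp: adjoin_def)

lemma adjoin_base: "is_subring R \<Longrightarrow> R \<subseteq> adjoin R z"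
proof
  fix x assume "is_subring R" "x \<in> R"
  hence "poly_over R [:x:]" by (simp add: poly_over_pCons_iff)
  thus "x \<in> adjoin R z" using adjoinI[of R "[:x:]" z] by simp
qed

lemma adjoin_gen: "is_subring R \<Longrightarrow> z \<in> adjoin R z"
  using adjoinI[of R "[:0, 1:]" z] by (simp add: poly_over_pCons_iff is_subringD)

lemma is_subring_adjoin: "is_subring R \<Longrightarrow> is_subring (adjoin R z)"
  unfolding is_subring_def[of "adjoin R z"]
proof (intro conjI ballI)
  assume R: "is_subring R"
  show "1 \<in> adjoin R z" using adjoin_base[OF R] is_subringD(1)[OF R] by auto
  fix a assume "a \<in> adjoin R z"
  then obtain p where p: "a = poly p z" "poly_over R p" by (auto simp: adjoin_def)
  show "- a \<in> adjoin R z" using adjoinI[OF poly_over_arith(5)[OF R p(2)], of z] p by simp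
  fix b assume "b \<in> adjoin R z"
  then obtain q where q: "b = poly q z" "poly_over R q" by (auto simp: adjoin_def)
  show "a + b \<in> adjoin R z" using adjoinI[OF poly_over_arith(2)[OF R p(2) q(2)], of z] p q by simp
  show "a * b \<in> adjoin R z" using adjoinI[OF poly_over_arith(3)[OF R p(2) q(2)], of z] p q by simp
qed

lemma adjoin_least: "is_subring S \<Longrightarrow> R \<subseteq> S \<Longrightarrow> z \<in> S \<Longrightarrow> adjoin R z \<subseteq> S"
  unfolding adjoin_def using poly_in_subring poly_over_mono by blast

text \<open>The first generator is absorbed into the base ring, so inductions over the list keep
  \<open>R\<close> arbitrary and homomorphisms are extended one generator at a time from the
  bottom.\<close>

fun adjoins :: "'a::comm_ring_1 set \<Rightarrow> 'a list \<Rightarrow> 'a set" where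
  "adjoins R [] = R" | "adjoins R (z # zs) = adjoins (adjoin R z) zs"

lemma is_subring_adjoins: "is_subring R \<Longrightarrow> is_subring (adjoins R zs)"
  by (induction zs arbitrary: R) (auto intro: is_subring_adjoin)

lemma adjoins_base: "is_subring R \<Longrightarrow> R \<subseteq> adjoins R zs"
proof (induction zs arbitrary: R)
  case (Cons z zs)
  show ?case using Cons.IH[OF is_subring_adjoin[OF Cons.prems]] adjoin_base[OF Cons.prems]
    by (metis adjoins.simps(2) subset_trans)
qed auto

lemma adjoins_gen: "is_subring R \<Longrightarrow> z \<in> set zs \<Longrightarrow> z \<in> adjoins R zs"
proof (induction zs arbitrary: R)
  case (Cons y zs)
  show ?case
  proof (cases "z = y")
    case True
    thus ?thesis using adjoins_base[OF is_subring_adjoin[OF Cons.prems(1)]] adjoin_gen[OF Cons.prems(1)]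
      by (metis adjoins.simps(2) subsetD)
  next
    case False
    thus ?thesis using Cons.prems Cons.IH[OF is_subring_adjoin[OF Cons.prems(1)]] by auto
  qed
qed auto

lemma adjoins_least: "is_subring S \<Longrightarrow> R \<subseteq> S \<Longrightarrow> set zs \<subseteq> S \<Longrightarrow> adjoins R zs \<subseteq> S"
proof (induction zs arbitrary: R)
  case (Cons z zs)
  thus ?case using adjoin_least[of S R z] by auto
qed auto

subsection \<open>Minimal polynomials and complete integral closedness\<close>

text \<open>Over a ring that is not a field an annihilator of least degree cannot simply be made
  monic; powers of its leading coefficient act as denominators.\<close>

definition is_minpoly :: "'a::idom set \<Rightarrow> 'a \<Rightarrow> 'a poly \<Rightarrow> bool" where
  "is_minpoly R z f \<longleftrightarrow> f \<noteq> 0 \<and> poly_over R f \<and> poly f z = 0 \<and>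
     (\<forall>g. g \<noteq> 0 \<longrightarrow> poly_over R g \<longrightarrow> poly g z = 0 \<longrightarrow> degree f \<le> degree g)"

definition algebraic_over :: "'a::idom set \<Rightarrow> 'a \<Rightarrow> bool" where
  "algebraic_over R z \<longleftrightarrow> (\<exists>p. p \<noteq> 0 \<and> poly_over R p \<and> poly p z = 0)"

definition integral_over :: "'a::idom set \<Rightarrow> 'a \<Rightarrow> bool" where
  "integral_over R z \<longleftrightarrow> (\<exists>p. lead_coeff p = 1 \<and> poly_over R p \<and> poly p z = 0)"

lemma integral_imp_algebraic: "integral_over R z \<Longrightarrow> algebraic_over R z"
  unfolding integral_over_def algebraic_over_def by (metis leading_coeff_0_iff zero_neq_one)

lemma algebraic_over_mono: "algebraic_over R z \<Longrightarrow> R \<subseteq> S \<Longrightarrow> algebraic_over S z"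
  unfolding algebraic_over_def using poly_over_mono by blast

lemma ex_minpoly: "algebraic_over R z \<Longrightarrow> \<exists>f. is_minpoly R z f"
  unfolding algebraic_over_def is_minpoly_def
  using ex_has_least_nat[of "\<lambda>p. p \<noteq> 0 \<and> poly_over R p \<and> poly p z = 0" _ degree] by blast

text \<open>The exponent \<open>N\<close> is fixed beforehand, surplus powers of the leading
  coefficient being multiplied in. \<open>bounded_denom_adjoin\<close> relies on an exponent that
  depends only on a degree bound.\<close>

lemma pseudo_division_over:
  assumes R: "is_subring R" and f: "poly_over R f" "f \<noteq> 0"
  shows "poly_over R p \<Longrightarrow> p = 0 \<or> degree p < N \<Longrightarrow>
    \<exists>h r. poly_over R h \<and> poly_over R r \<and> smult (lead_coeff f ^ N) p = f * h + r \<and>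
      (r = 0 \<or> degree r < degree f)"
proof (induction N arbitrary: p)
  case 0
  thus ?case using R by (intro exI[of _ 0]) auto
next
  case (Suc N)
  let ?c = "lead_coeff f"
  have c: "?c \<in> R" using f by (simp add: poly_over_def)
  show ?case
  proof (cases "p = 0 \<or> degree p < N")
    case True
    then obtain h r where *: "poly_over R h" "poly_over R r" "smult (?c ^ N) p = f * h + r"
      "r = 0 \<or> degree r < degree f" using Suc.IH[OF Suc.prems(1)] by blast
    have "smult (?c ^ Suc N) p = smult ?c (smult (?c ^ N) p)" by simp
    also have "\<dots> = f * smult ?c h + smult ?c r" unfolding *(3) by (simp add: smult_add_right)
    finally have "smult (?c ^ Suc N) p = f * smult ?c h + smult ?c r" .
    moreover have "smult ?c r = 0 \<or> degree (smult ?c r) < degree f"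
      using *(4) degree_smult_le[of ?c r] by auto
    ultimately show ?thesis using poly_over_arith(6)[OF R c *(1)] poly_over_arith(6)[OF R c *(2)] by blast
  next
    case False
    hence p: "p \<noteq> 0" "degree p = N" using Suc.prems by auto
    show ?thesis
    proof (cases "N < degree f")
      case True
      show ?thesis
      proof (intro exI conjI)
        show "poly_over R 0" using R by simp
        show "poly_over R (smult (?c ^ Suc N) p)" by (intro poly_over_arith[OF R] is_subringD(7)[OF R] c Suc.prems)
        show "smult (?c ^ Suc N) p = f * 0 + smult (?c ^ Suc N) p" by simp
        show "smult (?c ^ Suc N) p = 0 \<or> degree (smult (?c ^ Suc N) p) < degree f"
          using True p degree_smult_le[of "?c ^ Suc N" p] by auto
      qed
    next
      case False
      define m where "m = monom (lead_coeff p) (N - degree f)"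
      define p' where "p' = smult ?c p - f * m"
      have m: "poly_over R m"
        unfolding m_def using Suc.prems(1) by (intro poly_over_arith(7)[OF R]) (simp add: poly_over_def)
      have p'R: "poly_over R p'" unfolding p'_def
        using Suc.prems(1) f m c by (intro poly_over_arith[OF R])
      have "degree (f * m) \<le> N" using False degree_mult_le[of f m] degree_monom_le[of "lead_coeff p" "N - degree f"]
        by (simp add: m_def)
      hence "degree p' \<le> N" unfolding p'_def using p by (intro degree_diff_le) (auto intro: le_trans[OF degree_smult_le])
      moreover have "coeff (f * m) N = ?c * lead_coeff p"
      proof -
        have "coeff (m * f) N = lead_coeff p * ?c" using False by (simp add: m_def coeff_monom_mult)
        thus ?thesis by (simp only: mult.commute)
      qed
      hence "coeff p' N = 0" unfolding p'_def using p by simp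
      ultimately have "p' = 0 \<or> degree p' < N"
        by (metis le_neq_implies_less leading_coeff_0_iff)
      from Suc.IH[OF p'R this] obtain h r where *: "poly_over R h" "poly_over R r"
        "smult (?c ^ N) p' = f * h + r" "r = 0 \<or> degree r < degree f" by blast
      have "smult (?c ^ Suc N) p = smult (?c ^ N) (p' + f * m)" by (simp add: p'_def mult.commute)
      also have "\<dots> = f * (h + smult (?c ^ N) m) + r" using *(3) by (simp add: smult_add_right algebra_simps)
      finally show ?thesis using * c m R is_subringD(7)[OF R c]
        by (intro exI[of _ "h + smult (?c ^ N) m"] exI[of _ r]) (auto intro!: poly_over_arith)
    qed
  qed
qed

text \<open>The remainder vanishes at \<open>z\<close> and has too small a degree, hence is zero. So
  \<open>f\<close> generates the kernel of evaluation at \<open>z\<close> once its leading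
  coefficient is inverted; this is what makes homomorphisms and derivations well defined on
  \<open>adjoin R z\<close>.\<close>

lemma minpoly_kernel:
  assumes R: "is_subring R" and f: "is_minpoly R z f" and p: "poly_over R p" "poly p z = 0"
  shows "\<exists>k h. poly_over R h \<and> smult (lead_coeff f ^ k) p = f * h"
proof -
  have f': "poly_over R f" "f \<noteq> 0" "poly f z = 0" using f by (auto simp: is_minpoly_def)
  obtain h r where *: "poly_over R h" "poly_over R r"
    "smult (lead_coeff f ^ Suc (degree p)) p = f * h + r" "r = 0 \<or> degree r < degree f"
    using pseudo_division_over[OF R f'(1,2) p(1), of "Suc (degree p)"] by auto
  have "poly r z = 0" using arg_cong[OF *(3), of "\<lambda>p. poly p z"] p f' by simp
  hence "r = 0" using * f by (auto simp: is_minpoly_def not_le)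
  hence "smult (lead_coeff f ^ Suc (degree p)) p = f * h" using *(3) by (simp only: add_0_right)
  thus ?thesis using *(1) by blast
qed

lemma minpoly_degree_pos: "is_minpoly R z f \<Longrightarrow> degree f > 0"
  unfolding is_minpoly_def by (metis bot_nat_0.not_eq_extremum degree_eq_zeroE mult_zero_right pCons_0_0 poly_pCons poly_0 add.right_neutral)

text \<open>Bezout for the coprime polynomials \<open>f\<close> and \<open>G\<close>, done without
  fractions. A nonzero element \<open>r\<close> of least degree in the ideal they generate divides
  both up to powers of its leading coefficient. Once \<open>r\<close> is known to be constant,
  \<open>r = u * f + v * G\<close> evaluated at \<open>z\<close> exhibits a multiple of
  \<open>g\<close> in \<open>R\<close>.\<close>

lemma adjoin_nonzero_dvd_base:
  assumes R: "is_subring R" and f: "is_minpoly R z f" and g: "g \<in> adjoin R z" "g \<noteq> 0"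
  shows "\<exists>b\<in>adjoin R z. g * b \<in> R \<and> g * b \<noteq> 0"
proof -
  obtain G where G: "poly_over R G" "g = poly G z" using g by (auto simp: adjoin_def)
  have f': "poly_over R f" "f \<noteq> 0" "poly f z = 0" using f by (auto simp: is_minpoly_def)
  define I where "I = {u * f + v * G | u v. poly_over R u \<and> poly_over R v}"
  have IR: "poly_over R p" if "p \<in> I" for p
    using that f' G by (auto simp: I_def intro!: poly_over_arith[OF R])
  have I_comb: "smult c p - q * h \<in> I" if pq: "p \<in> I" "q \<in> I" "c \<in> R" "poly_over R h" for p q c h
  proof -
    from pq obtain u v u' v' where *: "p = u * f + v * G" "q = u' * f + v' * G" "poly_over R u"
      "poly_over R v" "poly_over R u'" "poly_over R v'" unfolding I_def by blast
    have "smult c p - q * h = (smult c u - u' * h) * f + (smult c v - v' * h) * G"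
      by (simp add: * algebra_simps smult_add_right smult_diff_right)
    moreover have "poly_over R (smult c u - u' * h)" "poly_over R (smult c v - v' * h)"
      using * pq by (intro poly_over_arith[OF R]; simp)+
    ultimately show ?thesis unfolding I_def by blast
  qed
  have fG: "f \<in> I" "G \<in> I"
  proof -
    have "f = 1 * f + 0 * G" "G = 0 * f + 1 * G" by simp_all
    moreover have "poly_over R 0" "poly_over R 1" using R by (simp_all add: poly_over_arith)
    ultimately show "f \<in> I" "G \<in> I" unfolding I_def by blast+
  qed
  obtain r where r: "r \<in> I" "r \<noteq> 0" "\<And>s. s \<in> I \<Longrightarrow> s \<noteq> 0 \<Longrightarrow> degree r \<le> degree s"
    using ex_has_least_nat[of "\<lambda>p. p \<in> I \<and> p \<noteq> 0" f degree] fG f' by blast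
  have lr: "lead_coeff r \<in> R" using IR[OF r(1)] by (simp add: poly_over_def)
  have div: "\<exists>k h. smult (lead_coeff r ^ k) p = r * h \<and> poly_over R h" if pI: "p \<in> I" for p
  proof -
    define N where "N = Suc (degree p)"
    obtain h s where *: "poly_over R h" "smult (lead_coeff r ^ N) p = r * h + s"
      "s = 0 \<or> degree s < degree r"
      using pseudo_division_over[OF R IR[OF r(1)] r(2) IR[OF pI], of N] unfolding N_def by blast
    have "s = smult (lead_coeff r ^ N) p - r * h" using *(2) by simp
    hence "s \<in> I" using I_comb[OF pI r(1) is_subringD(7)[OF R lr] *(1)] by simp
    have "s = 0"
    proof (rule ccontr)
      assume "s \<noteq> 0"
      thus False using r(3)[OF \<open>s \<in> I\<close>] *(3) by simp
    qed
    hence "smult (lead_coeff r ^ N) p = r * h" using *(2) by simp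
    thus ?thesis using *(1) by blast
  qed
  obtain k h where h: "smult (lead_coeff r ^ k) f = r * h" "poly_over R h" using div[OF fG(1)] by blast
  obtain l h2 where h2: "smult (lead_coeff r ^ l) G = r * h2" using div[OF fG(2)] by blast
  \<comment> \<open>Since \<open>r\<close> divides a constant multiple of \<open>G\<close>, it
    cannot vanish at \<open>z\<close>. The root \<open>z\<close> of \<open>f\<close> then belongs to
    the cofactor \<open>h\<close>, whose degree is at least that of \<open>f\<close>, and no degree
    is left for \<open>r\<close>.\<close>
  have rz: "poly r z \<noteq> 0"
  proof
    assume "poly r z = 0"
    hence "poly (smult (lead_coeff r ^ l) G) z = 0" unfolding h2 by simp
    thus False using g G r(2) by simp
  qed
  have "h \<noteq> 0" using h(1) f'(2) r(2) by auto
  have "poly h z = 0" using arg_cong[OF h(1), of "\<lambda>p. poly p z"] f' rz by simp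
  hence "degree f \<le> degree h" using f h \<open>h \<noteq> 0\<close> by (auto simp: is_minpoly_def)
  moreover have "degree f = degree r + degree h"
    using arg_cong[OF h(1), of degree] r(2) \<open>h \<noteq> 0\<close> by (simp add: degree_mult_eq)
  ultimately have "degree r = 0" by simp
  then obtain c where c: "r = [:c:]" by (auto elim: degree_eq_zeroE)
  have cR: "c \<in> R" "c \<noteq> 0" using lr r(2) c by auto
  obtain u v where uv: "r = u * f + v * G" "poly_over R v" using r(1) unfolding I_def by blast
  have "g * poly v z = c" using arg_cong[OF uv(1), of "\<lambda>p. poly p z"] c f' G by (simp add: mult.commute)
  thus ?thesis using adjoinI[OF uv(2), of z] cR by (intro bexI[of _ "poly v z"]) auto
qed

section \<open>Extending homomorphisms to one more element\<close>

lemma hom_on_adjoinI: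
  fixes h :: "'a::idom \<Rightarrow> 'b::idom"
  assumes R: "is_subring R" and h: "hom_on R h"
    and ker: "\<And>p. poly_over R p \<Longrightarrow> poly p z = 0 \<Longrightarrow> poly (map_poly h p) w = 0"
  shows "\<exists>h'. hom_on (adjoin R z) h' \<and> (\<forall>a\<in>R. h' a = h a) \<and> h' z = w \<and>
    (\<forall>p. poly_over R p \<longrightarrow> h' (poly p z) = poly (map_poly h p) w)"
proof -
  define h' where "h' x = poly (map_poly h (SOME p. poly_over R p \<and> poly p z = x)) w" for x
  note [simp] = hom_onD(1,2)[OF h]
  have h': "h' (poly p z) = poly (map_poly h p) w" if p: "poly_over R p" for p
  proof -
    define q where "q = (SOME q. poly_over R q \<and> poly q z = poly p z)"
    have q: "poly_over R q \<and> poly q z = poly p z" unfolding q_def by (rule someI[of _ p]) (use p in auto)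
    have "poly (map_poly h (q - p)) w = 0" using p q by (intro ker poly_over_arith[OF R]) auto
    thus ?thesis unfolding h'_def q_def[symmetric] using map_poly_hom_on(3)[OF h R] p q by simp
  qed
  have hR: "h' a = h a" if "a \<in> R" for a
    using h'[of "[:a:]"] that R by (simp add: poly_over_pCons_iff Polynomial.map_poly_pCons)
  have hz: "h' z = w"
    using h'[of "[:0, 1:]"] R by (simp add: poly_over_pCons_iff Polynomial.map_poly_pCons is_subringD)
  have "hom_on (adjoin R z) h'" unfolding hom_on_def
  proof (intro conjI ballI)
    show "h' 0 = 0" "h' 1 = 1" using hR is_subringD(1,2)[OF R] by auto
    fix a b assume "a \<in> adjoin R z" "b \<in> adjoin R z"
    then obtain p q where p: "a = poly p z" "poly_over R p" and q: "b = poly q z" "poly_over R q"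
      by (auto simp: adjoin_def)
    show "h' (a + b) = h' a + h' b"
      using h'[OF p(2)] h'[OF q(2)] h'[OF poly_over_arith(2)[OF R p(2) q(2)]] map_poly_hom_on(1)[OF h R p(2) q(2)]
      by (simp add: p q)
    show "h' (a * b) = h' a * h' b"
      using h'[OF p(2)] h'[OF q(2)] h'[OF poly_over_arith(3)[OF R p(2) q(2)]] map_poly_hom_on(2)[OF h R p(2) q(2)]
      by (simp add: p q)
  qed
  thus ?thesis using hR hz h' by blast
qed

text \<open>Applying \<open>h\<close> to the relation of \<open>minpoly_kernel\<close> shows that a
  power of \<open>h (lead_coeff f)\<close> times the value in question is zero; this is why the
  leading coefficient has to survive.\<close>

lemma hom_on_adjoin_algebraic:
  fixes h :: "'a::idom \<Rightarrow> 'b::idom"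
  assumes R: "is_subring R" and f: "is_minpoly R z f" and h: "hom_on R h"
    and lc: "h (lead_coeff f) \<noteq> 0" and w: "poly (map_poly h f) w = 0"
  shows "\<exists>h'. hom_on (adjoin R z) h' \<and> (\<forall>a\<in>R. h' a = h a) \<and> h' z = w"
proof -
  have fR: "poly_over R f" using f by (auto simp: is_minpoly_def)
  have "poly (map_poly h p) w = 0" if p: "poly_over R p" "poly p z = 0" for p
  proof -
    obtain k q where q: "poly_over R q" "smult (lead_coeff f ^ k) p = f * q"
      using minpoly_kernel[OF R f p] by blast
    have l: "lead_coeff f \<in> R" using fR by (simp add: poly_over_def)
    have "smult (h (lead_coeff f) ^ k) (map_poly h p) = map_poly h (smult (lead_coeff f ^ k) p)"
      using map_poly_hom_on_smult[OF h p(1) is_subringD(7)[OF R l]] hom_on_more(3)[OF h R l] by simp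
    also have "\<dots> = map_poly h f * map_poly h q" unfolding q(2) by (rule map_poly_hom_on(2)[OF h R fR q(1)])
    finally have "h (lead_coeff f) ^ k * poly (map_poly h p) w = 0"
      using w by (metis mult_zero_left poly_mult poly_smult)
    thus ?thesis using lc by simp
  qed
  from hom_on_adjoinI[OF R h this] show ?thesis by blast
qed

lemma hom_on_adjoin_transcendental:
  fixes h :: "'a::idom \<Rightarrow> 'b::idom"
  assumes R: "is_subring R" and z: "\<not> algebraic_over R z" and h: "hom_on R h"
  shows "\<exists>h'. hom_on (adjoin R z) h' \<and> (\<forall>a\<in>R. h' a = h a) \<and> h' z = w \<and>
    (\<forall>p. poly_over R p \<longrightarrow> h' (poly p z) = poly (map_poly h p) w)"
proof (rule hom_on_adjoinI[OF R h])
  fix p assume "poly_over R p" "poly p z = 0"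
  hence "p = 0" using z by (auto simp: algebraic_over_def)
  thus "poly (map_poly h p) w = 0" by simp
qed

text \<open>Normality in its almost-integral form. The case \<open>i = 1\<close> already places
  \<open>w\<close> in the fraction field of \<open>R\<close>; the condition asks for one denominator
  valid for all powers of \<open>w\<close>, which is what \<open>bounded_denom\<close>
  produces.\<close>

definition compl_int_closed :: "'a::idom set \<Rightarrow> bool" where
  "compl_int_closed R \<longleftrightarrow> (\<forall>w r. r \<in> R \<longrightarrow> r \<noteq> 0 \<longrightarrow> (\<forall>i. r * w ^ i \<in> R) \<longrightarrow> w \<in> R)"

lemma compl_int_closed_subfield:
  assumes "is_subring R" "\<And>x. x \<in> R \<Longrightarrow> inverse x \<in> R"
  shows "compl_int_closed (R :: 'a::field set)"
  unfolding compl_int_closed_def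
proof (intro allI impI)
  fix w r assume *: "r \<in> R" "r \<noteq> 0" "\<forall>i. r * w ^ i \<in> R"
  have "r * w ^ 1 \<in> R" using * by blast
  hence "inverse r * (r * w) \<in> R" using is_subringD(4)[OF assms(1) assms(2)[OF *(1)], of "r * w"] by simp
  moreover have "inverse r * (r * w) = w" using * by simp
  ultimately show "w \<in> R" by simp
qed

text \<open>Comparing leading coefficients turns almost integrality over the polynomial ring into almost
  integrality over the coefficient ring.\<close>
lemma compl_int_closed_adjoin:
  fixes R :: "'a::field set"
  assumes R: "is_subring R" and cic: "compl_int_closed R" and t: "\<not> algebraic_over R t"
  shows "compl_int_closed (adjoin R t)"
  unfolding compl_int_closed_def
proof (intro allI impI)
  let ?S = "adjoin R t"
  note S = is_subring_adjoin[OF R, of t]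
  fix w r assume *: "r \<in> ?S" "r \<noteq> 0" "\<forall>i. r * w ^ i \<in> ?S"
  have inj: "p = q" if "poly_over R p" "poly_over R q" "poly p t = poly q t" for p q
  proof -
    have "poly_over R (p - q)" "poly (p - q) t = 0" using that poly_over_arith[OF R] by auto
    thus ?thesis using t by (auto simp: algebraic_over_def)
  qed
  obtain C where C: "poly_over R C" "r = poly C t" using * by (auto simp: adjoin_def)
  have C0: "C \<noteq> 0" using C * by auto
  \<comment> \<open>Long division of \<open>B\<close> by \<open>C\<close>, one leading term at a
    time: each subtraction lowers the degree of the numerator and keeps the quotient almost
    integral.\<close>
  have main: "w \<in> ?S" if "poly_over R B" "w = poly B t / r" "\<forall>i. r * w ^ i \<in> ?S" for B w
    using that
  proof (induction "if B = 0 then 0 else Suc (degree B)" arbitrary: B w rule: less_induct)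
    case less
    show ?case
    proof (cases "B = 0")
      case True
      thus ?thesis using less is_subringD[OF S] by simp
    next
      case B0: False
      have "\<exists>E. poly_over R E \<and> C * B ^ i = C ^ i * E \<and> E \<noteq> 0" for i
      proof -
        have "r * w ^ i \<in> ?S" using less by blast
        then obtain E where E: "poly_over R E" "r * w ^ i = poly E t" by (auto simp: adjoin_def)
        have "poly (C * B ^ i) t = poly (C ^ i * E) t"
          using C less(3) E(2)[symmetric] *(2) by (simp add: power_divide)
        hence "C * B ^ i = C ^ i * E" using E C less(2) by (intro inj poly_over_arith[OF R])
        thus ?thesis using E C0 B0 by (intro exI[of _ E]) auto
      qed
      then obtain E where E: "\<And>i. poly_over R (E i)" "\<And>i. C * B ^ i = C ^ i * E i" "\<And>i. E i \<noteq> 0"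
        by metis
      have deg: "degree C + i * degree B = i * degree C + degree (E i)" for i
        using arg_cong[OF E(2)[of i], of degree] C0 B0 E(3)[of i]
        by (simp add: degree_mult_eq degree_power_eq mult.commute)
      \<comment> \<open>At the exponent \<open>degree C + 1\<close>, losing at least one degree per
        power would exceed the \<open>degree C\<close> contributed by the single factor
        \<open>C\<close>.\<close>
      have dle: "degree C \<le> degree B"
      proof (rule ccontr)
        assume "\<not> degree C \<le> degree B"
        hence "Suc (degree C) * Suc (degree B) \<le> Suc (degree C) * degree C" by (intro mult_le_mono) auto
        thus False using deg[of "Suc (degree C)"] by simp
      qed
      define \<omega> where "\<omega> = lead_coeff B / lead_coeff C"
      have "lead_coeff C * \<omega> ^ i \<in> R" for i
      proof -
        have "lead_coeff C * lead_coeff B ^ i = lead_coeff C ^ i * lead_coeff (E i)"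
          using arg_cong[OF E(2)[of i], of lead_coeff] by (simp add: lead_coeff_mult lead_coeff_power)
        hence "lead_coeff C * \<omega> ^ i = lead_coeff (E i)"
          using C0 by (simp add: \<omega>_def power_divide)
        thus ?thesis using E(1)[of i] by (simp add: poly_over_def)
      qed
      moreover have "lead_coeff C \<in> R" "lead_coeff C \<noteq> 0" using C C0 by (auto simp: poly_over_def)
      ultimately have \<omega>R: "\<omega> \<in> R" using cic unfolding compl_int_closed_def by blast
      define H where "H = monom \<omega> (degree B - degree C)"
      define B' where "B' = B - C * H"
      have HR: "poly_over R H" unfolding H_def by (rule poly_over_arith(7)[OF R \<omega>R])
      have B'R: "poly_over R B'" unfolding B'_def using less(2) C HR by (intro poly_over_arith[OF R])
      have "degree (C * H) \<le> degree B" using dle degree_mult_le[of C H] degree_monom_le[of \<omega> "degree B - degree C"]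
        by (simp add: H_def)
      hence "degree B' \<le> degree B" unfolding B'_def by (intro degree_diff_le order_refl)
      moreover have "coeff (C * H) (degree B) = lead_coeff B"
      proof -
        have "coeff (H * C) (degree B) = lead_coeff B" using dle C0 by (simp add: H_def coeff_monom_mult \<omega>_def)
        thus ?thesis by (simp only: mult.commute)
      qed
      hence "coeff B' (degree B) = 0" unfolding B'_def by simp
      ultimately have "B' = 0 \<or> degree B' < degree B"
        by (metis le_neq_implies_less leading_coeff_0_iff)
      hence sm: "(if B' = 0 then 0 else Suc (degree B')) < (if B = 0 then 0 else Suc (degree B))"
        using B0 by auto
      define h where "h = poly H t"
      have hS: "h \<in> ?S" unfolding h_def using HR by (rule adjoinI)
      have w': "w - h = poly B' t / r" using less(3) C(2) *(2) by (simp add: B'_def h_def field_simps)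
      \<comment> \<open>In the binomial expansion every power of \<open>w\<close> still meets the
        factor \<open>r\<close>, so the same denominator works for \<open>w - h\<close>.\<close>
      have "r * (w - h) ^ i \<in> ?S" for i
      proof -
        have "r * (w - h) ^ i = r * (w + - h) ^ i" by simp
        also have "\<dots> = (\<Sum>k\<le>i. (of_nat (i choose k) * (- h) ^ (i - k)) * (r * w ^ k))"
          unfolding binomial_ring sum_distrib_left by (simp add: mult_ac)
        also have "\<dots> \<in> ?S"
        proof (rule subring_sum[OF S])
          fix k
          have "of_nat n \<in> ?S" for n by (induction n) (simp_all add: is_subringD[OF S])
          thus "(of_nat (i choose k) * (- h) ^ (i - k)) * (r * w ^ k) \<in> ?S"
            using less(4) hS by (simp add: is_subringD[OF S])
        qed
        finally show ?thesis .
      qed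
      from less(1)[OF sm B'R w'] this have "w - h \<in> ?S" by blast
      thus ?thesis using is_subringD(3)[OF S _ hS, of "w - h"] by simp
    qed
  qed
  have "r * w ^ 1 \<in> ?S" using * by blast
  then obtain B where "poly_over R B" "r * w = poly B t" by (auto simp: adjoin_def)
  thus "w \<in> ?S" using main[of B w] * by (simp add: field_simps)
qed

text \<open>The divisibility clause is what lets the common denominator descend through a tower.\<close>
definition bounded_denom :: "'a::idom set \<Rightarrow> 'a set \<Rightarrow> bool" where
  "bounded_denom R S \<longleftrightarrow> is_subring S \<and> R \<subseteq> S \<and> (\<forall>g\<in>S. g \<noteq> 0 \<longrightarrow> (\<exists>b\<in>S. g * b \<in> R \<and> g * b \<noteq> 0)) \<and>
    (\<exists>d\<in>R. d \<noteq> 0 \<and> (\<forall>w\<in>S. (\<exists>a\<in>R. a \<noteq> 0 \<and> a * w \<in> R) \<longrightarrow> d * w \<in> R))"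

lemma bounded_denom_refl: "is_subring R \<Longrightarrow> bounded_denom R R"
  unfolding bounded_denom_def using is_subringD[of R]
  by (auto intro!: bexI[of _ 1])

text \<open>For \<open>w\<close> in \<open>adjoin S x\<close> with a nonzero multiple in
  \<open>R\<close>, the denominator must not depend on \<open>w\<close>. Reducing a representing
  polynomial modulo the monic \<open>F\<close> bounds its degree, so that division by
  \<open>f\<close> costs a fixed power \<open>?c\<close> of its leading coefficient. The remainder
  turns out to be constant, which puts \<open>?c * w\<close> into \<open>S\<close>; \<open>e\<close>
  and \<open>d\<close> bring it down to \<open>R\<close>.\<close>

lemma bounded_denom_adjoin:
  assumes R: "is_subring R" and B: "bounded_denom R S" and x: "integral_over R x"
  shows "bounded_denom R (adjoin S x)"
proof -
  have S: "is_subring S" "R \<subseteq> S" using B by (auto simp: bounded_denom_def)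
  obtain d where d: "d \<in> R" "d \<noteq> 0" "\<And>w a. w \<in> S \<Longrightarrow> a \<in> R \<Longrightarrow> a \<noteq> 0 \<Longrightarrow> a * w \<in> R \<Longrightarrow> d * w \<in> R"
    using B unfolding bounded_denom_def by blast
  have dv: "\<exists>b\<in>S. g * b \<in> R \<and> g * b \<noteq> 0" if "g \<in> S" "g \<noteq> 0" for g
    using B that unfolding bounded_denom_def by blast
  obtain F where F: "lead_coeff F = 1" "poly_over R F" "poly F x = 0" using x by (auto simp: integral_over_def)
  have FS: "poly_over S F" using F(2) S(2) by (rule poly_over_mono)
  have F0: "F \<noteq> 0" using F by auto
  have "algebraic_over S x" unfolding algebraic_over_def using FS F F0 by auto
  then obtain f where f: "is_minpoly S x f" using ex_minpoly by blast
  have f': "poly_over S f" "f \<noteq> 0" "poly f x = 0" using f by (auto simp: is_minpoly_def)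
  let ?T = "adjoin S x" and ?c = "lead_coeff f ^ degree F"
  have T: "is_subring ?T" "S \<subseteq> ?T" using is_subring_adjoin adjoin_base S by blast+
  have cS: "?c \<in> S" "?c \<noteq> 0" using f' by (auto intro!: is_subringD(7)[OF S(1)] simp: poly_over_def)
  have dvT: "\<exists>b\<in>?T. g * b \<in> R \<and> g * b \<noteq> 0" if g: "g \<in> ?T" "g \<noteq> 0" for g
  proof -
    obtain b where b: "b \<in> ?T" "g * b \<in> S" "g * b \<noteq> 0"
      using adjoin_nonzero_dvd_base[OF S(1) f g] by blast
    obtain b' where b': "b' \<in> S" "g * b * b' \<in> R" "g * b * b' \<noteq> 0" using dv[OF b(2,3)] by blast
    thus ?thesis using b T by (intro bexI[of _ "b * b'"]) (auto intro!: is_subringD(4)[OF T(1)] simp: mult.assoc)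
  qed
  obtain e where e: "e \<in> S" "?c * e \<in> R" "?c * e \<noteq> 0" using dv[OF cS] by blast
  have "d * (?c * e) * w \<in> R" if w: "w \<in> ?T" and a: "a \<in> R" "a \<noteq> 0" "a * w \<in> R" for w a
  proof -
    obtain P where P: "poly_over S P" "w = poly P x" using w by (auto simp: adjoin_def)
    obtain h1 r where r: "poly_over S r" "P = F * h1 + r" "r = 0 \<or> degree r < degree F"
      using pseudo_division_over[OF S(1) FS F0 P(1), of "Suc (degree P)"] F(1) by auto
    obtain h2 s where s: "poly_over S s" "smult ?c r = f * h2 + s" "s = 0 \<or> degree s < degree f"
      using pseudo_division_over[OF S(1) f'(1,2) r(1) r(3)] by auto
    have ws: "?c * w = poly s x"
      using arg_cong[OF s(2), of "\<lambda>p. poly p x"] P r(2) F(3) f'(3) by simp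
    \<comment> \<open>As \<open>a * w\<close> lies in \<open>R\<close>, the polynomial
      \<open>smult a s\<close> and the constant \<open>?c * (a * w)\<close> agree at
      \<open>x\<close>. Both have degree below that of \<open>f\<close>, hence they are
      equal.\<close>
    define t where "t = smult a s - [:?c * (a * w):]"
    have "poly t x = 0" unfolding t_def using ws by (simp add: mult_ac)
    moreover have "poly_over S t" unfolding t_def
      using s(1) a S cS by (auto intro!: poly_over_arith[OF S(1)] is_subringD(4)[OF S(1)] simp: poly_over_pCons_iff)
    moreover have "degree t < degree f"
    proof -
      have "degree s < degree f" using s(3) minpoly_degree_pos[OF f] by auto
      thus ?thesis unfolding t_def using minpoly_degree_pos[OF f] degree_smult_le[of a s]
        by (intro degree_diff_less) auto
    qed
    ultimately have "t = 0" using f by (auto simp: is_minpoly_def not_le[symmetric])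
    hence "coeff (smult a s) 0 = coeff [:?c * (a * w):] 0" unfolding t_def by simp
    hence "a * coeff s 0 = a * (?c * w)" by (simp add: mult_ac)
    hence "?c * w = coeff s 0" using a(2) by simp
    hence "?c * w \<in> S" using s(1) by (simp add: poly_over_def)
    hence 1: "?c * e * w \<in> S" using e(1) is_subringD(4)[OF S(1), of e "?c * w"] by (simp add: mult_ac)
    have 2: "a * (?c * e * w) \<in> R" using is_subringD(4)[OF R e(2) a(3)] by (simp add: mult_ac)
    show ?thesis using d(3)[OF 1 a(1,2) 2] by (simp add: mult.assoc)
  qed
  moreover have "d * (?c * e) \<in> R" "d * (?c * e) \<noteq> 0" using d e is_subringD(4)[OF R] by auto
  ultimately show ?thesis unfolding bounded_denom_def using T S dvT by blast
qed

lemma bounded_denom_adjoins: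
  assumes "is_subring R" "bounded_denom R S" "\<And>x. x \<in> set xs \<Longrightarrow> integral_over R x"
  shows "bounded_denom R (adjoins S xs)"
  using assms(2,3)
proof (induction xs arbitrary: S)
  case (Cons x xs)
  thus ?case using bounded_denom_adjoin[OF assms(1), of S x] by simp
qed auto

text \<open>The roots of \<open>f\<close> are among those of the monic \<open>F\<close>, hence
  integral, and the coefficients of the monic multiple \<open>g\<close> lie in the ring they
  generate. Each power of such a coefficient is carried into \<open>R\<close> by a power of
  \<open>lead_coeff f\<close>, so the common denominator \<open>d\<close> applies to all of them and
  complete integral closedness puts the coefficient itself into \<open>R\<close>.\<close>

lemma monic_minpoly:
  fixes R :: "'a::alg_closed_field set"
  assumes R: "is_subring R" and cic: "compl_int_closed R" and z: "integral_over R z"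
  shows "\<exists>f. is_minpoly R z f \<and> lead_coeff f = 1"
proof -
  obtain F where F: "lead_coeff F = 1" "poly_over R F" "poly F z = 0" using z by (auto simp: integral_over_def)
  obtain f where f: "is_minpoly R z f" using ex_minpoly[OF integral_imp_algebraic[OF z]] by blast
  have f': "poly_over R f" "f \<noteq> 0" "poly f z = 0" using f by (auto simp: is_minpoly_def)
  obtain A where A: "f = smult (lead_coeff f) (\<Prod>x\<in>#A. [:-x, 1:])"
    using alg_closed_imp_factorization[OF f'(2)] by blast
  obtain xs where xs: "A = mset xs" by (metis ex_mset)
  define g where "g = (\<Prod>x\<leftarrow>xs. [:-x, 1:])"
  have fg: "f = smult (lead_coeff f) g" using A by (simp add: xs g_def flip: prod_mset_prod_list)
  obtain k h where kh: "smult (lead_coeff f ^ k) F = f * h" using minpoly_kernel[OF R f F(2,3)] by blast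
  have "integral_over R x" if "x \<in> set xs" for x
  proof -
    have "poly g x = 0" using that unfolding g_def by (auto simp: poly_prod_list prod_list_zero_iff)
    hence "poly f x = 0" by (subst fg) simp
    hence "poly (smult (lead_coeff f ^ k) F) x = 0" unfolding kh by simp
    hence "poly F x = 0" using f' by simp
    thus ?thesis using F by (auto simp: integral_over_def)
  qed
  hence bd: "bounded_denom R (adjoins R xs)"
    using bounded_denom_adjoins[OF R bounded_denom_refl[OF R]] by blast
  let ?S = "adjoins R xs"
  note S = is_subring_adjoins[OF R, of xs]
  have "poly_over ?S (\<Prod>x\<leftarrow>ys. [:-x, 1:])" if "set ys \<subseteq> ?S" for ys
    using that by (induction ys) (auto intro!: poly_over_arith[OF S] simp: poly_over_pCons_iff S is_subringD[OF S])
  hence gS: "poly_over ?S g" unfolding g_def using adjoins_gen[OF R] by blast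
  obtain d where d: "d \<in> R" "d \<noteq> 0" "\<And>w a. w \<in> ?S \<Longrightarrow> a \<in> R \<Longrightarrow> a \<noteq> 0 \<Longrightarrow> a * w \<in> R \<Longrightarrow> d * w \<in> R"
    using bd unfolding bounded_denom_def by blast
  have "coeff g j \<in> R" for j
  proof -
    have "d * coeff g j ^ i \<in> R" for i
    proof (rule d(3))
      show "coeff g j ^ i \<in> ?S" using gS by (intro is_subringD(7)[OF S]) (simp add: poly_over_def)
      show "lead_coeff f ^ i \<in> R" using f' by (intro is_subringD(7)[OF R]) (simp add: poly_over_def)
      show "lead_coeff f ^ i \<noteq> 0" using f' by simp
      have "lead_coeff f ^ i * coeff g j ^ i = coeff f j ^ i"
        by (subst (3) fg) (simp add: power_mult_distrib)
      thus "lead_coeff f ^ i * coeff g j ^ i \<in> R" using f' by (auto intro!: is_subringD(7)[OF R] simp: poly_over_def)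
    qed
    thus ?thesis using cic d unfolding compl_int_closed_def by blast
  qed
  hence gR: "poly_over R g" by (simp add: poly_over_def)
  have "lead_coeff g = 1" unfolding g_def by (induction xs) (simp_all add: lead_coeff_mult del: mult_pCons_left)
  moreover have "degree g = degree f" using f'(2) by (subst fg) simp
  moreover have "poly g z = 0"
  proof -
    have "lead_coeff f * poly g z = 0" using f'(3) by (subst (asm) fg) simp
    thus ?thesis using f'(2) by simp
  qed
  moreover have "g \<noteq> 0" using \<open>lead_coeff g = 1\<close> by auto
  ultimately show ?thesis using f gR unfolding is_minpoly_def by auto
qed

subsection \<open>Finite modules and integrality\<close>

inductive_set lspan :: "'a::comm_ring_1 set \<Rightarrow> 'a set \<Rightarrow> 'a set" for R M where
  zero: "0 \<in> lspan R M"
| step: "x \<in> lspan R M \<Longrightarrow> r \<in> R \<Longrightarrow> m \<in> M \<Longrightarrow> x + r * m \<in> lspan R M"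

lemma lspan_add: "y \<in> lspan R M \<Longrightarrow> x \<in> lspan R M \<Longrightarrow> x + y \<in> lspan R M"
proof (induction y rule: lspan.induct)
  case (step y r m)
  thus ?case using lspan.step[of "x + y" R M r m] by (simp add: add.assoc)
qed simp

lemma lspan_sum: "(\<And>i. i \<in> I \<Longrightarrow> f i \<in> lspan R M) \<Longrightarrow> sum f I \<in> lspan R M"
  by (induction I rule: infinite_finite_induct) (simp_all add: lspan.zero lspan_add)

lemma lspan_gen: "r \<in> R \<Longrightarrow> m \<in> M \<Longrightarrow> r * m \<in> lspan R M"
  using lspan.step[OF lspan.zero, of r R m M] by simp

lemma lspan_mult:
  assumes "s \<in> lspan R M" "t \<in> N"
  shows "s * t \<in> lspan R ((\<lambda>(m, n). m * n) ` (M \<times> N))"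
  using assms(1)
proof (induction s rule: lspan.induct)
  case (step x r m)
  have "m * t \<in> (\<lambda>(m, n). m * n) ` (M \<times> N)" using step assms(2) by force
  thus ?case using lspan.step[OF step.IH step.hyps(2)] by (simp add: distrib_right mult.assoc)
qed (simp add: lspan.zero)

lemma lspan_trans:
  assumes "x \<in> lspan S N" "S \<subseteq> lspan R M"
  shows "x \<in> lspan R ((\<lambda>(m, n). m * n) ` (M \<times> N))"
  using assms(1)
proof (induction x rule: lspan.induct)
  case (step x s n)
  thus ?case using assms(2) by (intro lspan_add[OF lspan_mult]) auto
qed (simp add: lspan.zero)

lemma lspan_finite_rep:
  assumes "is_subring R" "x \<in> lspan R M" "finite M"
  shows "\<exists>c. (\<forall>m\<in>M. c m \<in> R) \<and> x = (\<Sum>m\<in>M. c m * m)"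
  using assms(2)
proof (induction x rule: lspan.induct)
  case zero
  show ?case using is_subringD[OF assms(1)] by (intro exI[of _ "\<lambda>_. 0"]) simp
next
  case (step x r m)
  then obtain c where c: "\<forall>m\<in>M. c m \<in> R" "x = (\<Sum>m\<in>M. c m * m)" by blast
  let ?d = "\<lambda>n. c n + (if n = m then r else 0)"
  have "(\<Sum>n\<in>M. ?d n * n) = (\<Sum>n\<in>M. c n * n + (if n = m then r * n else 0))"
    by (intro sum.cong) (auto simp: algebra_simps)
  also have "\<dots> = x + r * m" using step(3) assms(3) by (simp add: sum.distrib c(2))
  finally show ?case using c step(2) is_subringD[OF assms(1)]
    by (intro exI[of _ ?d]) auto
qed

definition fin_module :: "'a::comm_ring_1 set \<Rightarrow> 'a set \<Rightarrow> bool" where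
  "fin_module R S \<longleftrightarrow> (\<exists>M. finite M \<and> M \<subseteq> S \<and> S \<subseteq> lspan R M)"

lemma fin_module_refl: "is_subring R \<Longrightarrow> fin_module R R"
  unfolding fin_module_def using lspan_gen[of _ R 1 "{1}"]
  by (intro exI[of _ "{1}"]) (auto simp: is_subringD)

lemma fin_module_trans:
  assumes "is_subring T" "S \<subseteq> T" "fin_module R S" "fin_module S T"
  shows "fin_module R T"
proof -
  obtain M N where M: "finite M" "M \<subseteq> S" "S \<subseteq> lspan R M" and N: "finite N" "N \<subseteq> T" "T \<subseteq> lspan S N"
    using assms(3,4) by (auto simp: fin_module_def)
  let ?P = "(\<lambda>(m, n). m * n) ` (M \<times> N)"
  have "m * n \<in> T" if "m \<in> M" "n \<in> N" for m n
    using that M(2) N(2) assms(2) is_subringD(4)[OF assms(1)] by blast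
  hence "?P \<subseteq> T" by auto
  moreover have "T \<subseteq> lspan R ?P" using lspan_trans[OF _ M(3)] N(3) by blast
  moreover have "finite ?P" using M(1) N(1) by simp
  ultimately show ?thesis unfolding fin_module_def by blast
qed

lemma fin_module_adjoin:
  assumes R: "is_subring R" and t: "integral_over R t"
  shows "fin_module R (adjoin R t)"
proof -
  obtain F where F: "lead_coeff F = 1" "poly_over R F" "poly F t = 0" using t by (auto simp: integral_over_def)
  have F0: "F \<noteq> 0" using F by auto
  let ?M = "(\<lambda>i. t ^ i) ` {..<degree F}"
  have "x \<in> lspan R ?M" if x: "x \<in> adjoin R t" for x
  proof -
    obtain P where P: "poly_over R P" "x = poly P t" using x by (auto simp: adjoin_def)
    obtain h r where r: "poly_over R r" "P = F * h + r" "r = 0 \<or> degree r < degree F"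
      using pseudo_division_over[OF R F(2) F0 P(1), of "Suc (degree P)"] F(1) by auto
    have "x = poly r t" using P r F by simp
    also have "\<dots> = (\<Sum>i\<le>degree r. coeff r i * t ^ i)" by (rule poly_altdef)
    also have "\<dots> \<in> lspan R ?M"
    proof (cases "r = 0")
      case True
      thus ?thesis by (simp add: lspan.zero)
    next
      case False
      thus ?thesis using r by (intro lspan_sum lspan_gen) (auto simp: poly_over_def)
    qed
    finally show ?thesis .
  qed
  moreover have "?M \<subseteq> adjoin R t"
    using is_subringD(7)[OF is_subring_adjoin[OF R] adjoin_gen[OF R]] by blast
  ultimately show ?thesis unfolding fin_module_def by (intro exI[of _ ?M]) auto
qed

lemma poly_over_char_poly:
  assumes R: "is_subring R" and A: "A \<in> carrier_mat n n" "\<And>i j. i < n \<Longrightarrow> j < n \<Longrightarrow> A $$ (i, j) \<in> R"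
  shows "poly_over R (char_poly A)"
proof -
  have "poly_over R (char_poly_matrix A $$ (i, j))" if "i < n" "j < n" for i j
  proof -
    have "char_poly_matrix A $$ (i, j) = (if i = j then [:0, 1:] else 0) + [:- A $$ (i, j):]"
      using that A(1) by (simp add: char_poly_matrix_def)
    moreover have "poly_over R [:- A $$ (i, j):]" "poly_over R [:0, 1:]"
      using A(2)[OF that] by (simp_all add: poly_over_pCons_iff R is_subringD[OF R])
    ultimately show ?thesis using poly_over_arith(2)[OF R] R by simp
  qed
  moreover have "poly_over R (signof p)" for p :: "nat \<Rightarrow> nat"
    by (auto simp: sign_def poly_over_arith[OF R])
  moreover have "p i < n" if "p permutes {0..<n}" "i < n" for p i
    using that by (meson atLeastLessThan_iff permutes_in_image zero_le)
  ultimately show ?thesis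
    unfolding char_poly_def det_def'[OF char_poly_matrix_closed[OF A(1)]]
    by (intro poly_over_sum[OF R] poly_over_arith(3)[OF R] poly_over_prod[OF R]) auto
qed

text \<open>The determinant trick: multiplication by \<open>z\<close> acts on a generating family
  through a matrix over \<open>R\<close>, with the vector of generators as eigenvector. This vector
  is nonzero because \<open>1\<close> is a combination of its entries.\<close>

lemma fin_module_integral:
  fixes R :: "'a::field set"
  assumes R: "is_subring R" and S: "is_subring S" and RS: "fin_module R S" and z: "z \<in> S"
  shows "integral_over R z"
proof -
  obtain M where M: "finite M" "M \<subseteq> S" "S \<subseteq> lspan R M" using RS by (auto simp: fin_module_def)
  obtain ms where ms: "set ms = M" "distinct ms" using finite_distinct_list[OF M(1)] by blast
  define n where "n = length ms"
  have sumM: "(\<Sum>m\<in>M. f m) = (\<Sum>j = 0..<n. f (ms ! j))" for f :: "'a \<Rightarrow> 'a"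
    using sum.reindex_bij_betw[OF bij_betw_nth[OF ms(2), of "{0..<n}" M], of f] ms(1)
    by (simp add: n_def lessThan_atLeast0)
  have ex: "\<exists>c. (\<forall>m\<in>M. c m \<in> R) \<and> z * ms ! i = (\<Sum>m\<in>M. c m * m)" if i: "i < n" for i
  proof (rule lspan_finite_rep[OF R _ M(1)])
    have "ms ! i \<in> S" using i M(2) ms(1) nth_mem[of i ms] unfolding n_def by blast
    thus "z * ms ! i \<in> lspan R M" using is_subringD(4)[OF S z] M(3) by blast
  qed
  define c where "c i = (SOME c. (\<forall>m\<in>M. c m \<in> R) \<and> z * ms ! i = (\<Sum>m\<in>M. c m * m))" for i
  have c': "(\<forall>m\<in>M. c i m \<in> R) \<and> z * ms ! i = (\<Sum>m\<in>M. c i m * m)" if "i < n" for i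
    unfolding c_def by (rule someI_ex[OF ex[OF that]])
  hence c: "\<And>i m. i < n \<Longrightarrow> m \<in> M \<Longrightarrow> c i m \<in> R"
    "\<And>i. i < n \<Longrightarrow> z * ms ! i = (\<Sum>m\<in>M. c i m * m)" by blast+
  define A where "A = mat n n (\<lambda>(i, j). c i (ms ! j))"
  define v where "v = vec n (\<lambda>i. ms ! i)"
  have A: "A \<in> carrier_mat n n" and v: "v \<in> carrier_vec n" by (auto simp: A_def v_def)
  have "A *\<^sub>v v = z \<cdot>\<^sub>v v"
    by (rule eq_vecI) (auto simp: A_def v_def scalar_prod_def c(2) sumM)
  moreover have "v \<noteq> 0\<^sub>v n"
  proof
    assume "v = 0\<^sub>v n"
    hence 0: "ms ! i = 0" if "i < n" for i using that by (metis index_vec index_zero_vec(1) v_def)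
    obtain c where "1 = (\<Sum>m\<in>M. c m * m)"
      using lspan_finite_rep[OF R _ M(1), of 1] M(3) is_subringD(1)[OF S] by blast
    thus False using 0 by (simp add: sumM)
  qed
  ultimately have "eigenvalue A z" unfolding eigenvalue_def eigenvector_def using A v by auto
  hence "poly (char_poly A) z = 0" using eigenvalue_root_char_poly[OF A] by simp
  moreover have "lead_coeff (char_poly A) = 1" using degree_monic_char_poly[OF A] by simp
  moreover have "poly_over R (char_poly A)"
    using c ms by (intro poly_over_char_poly[OF R A]) (auto simp: A_def n_def)
  ultimately show ?thesis unfolding integral_over_def by blast
qed

subsection \<open>Hensel factorization\<close>

lemma bezout_linear_power:
  fixes c :: "'a::field"
  assumes "poly H c \<noteq> 0"
  shows "\<exists>u v. u * [:-c, 1:] ^ m + v * H = 1"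
proof (induction m)
  case 0
  show ?case by (intro exI[of _ 1] exI[of _ 0]) simp
next
  case (Suc m)
  let ?L = "[:-c, 1:]"
  obtain u v where uv: "u * ?L ^ m + v * H = 1" using Suc by blast
  have "poly (H - [:poly H c:]) c = 0" by simp
  then obtain K where K: "H - [:poly H c:] = ?L * K" using poly_eq_0_iff_dvd by (metis dvd_def)
  define i where "i = inverse (poly H c)"
  have i: "[:i:] * [:poly H c:] = 1" using assms by (simp add: i_def)
  have "[:i:] * H - [:i:] * K * ?L = [:i:] * (H - ?L * K)" by (simp add: algebra_simps)
  also have "H - ?L * K = [:poly H c:]" using K by (simp add: algebra_simps)
  finally have 1: "[:i:] * H - [:i:] * K * ?L = 1" using i by simp
  have "1 = (u * ?L ^ m + v * H) * ([:i:] * H - [:i:] * K * ?L)" using uv 1 by simp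
  also have "\<dots> = (- u * [:i:] * K) * ?L ^ Suc m + (u * ?L ^ m * [:i:] + v * ([:i:] * H - [:i:] * K * ?L)) * H"
    by (simp add: algebra_simps)
  finally show ?case by metis
qed

text \<open>The linearized Hensel step with degree control. Only \<open>b\<close> is reduced, modulo
  the power of the linear factor; the degree of \<open>a\<close> then follows from the equation
  itself.\<close>

lemma bezout_solve:
  fixes c :: "'a::field"
  assumes H: "poly H c \<noteq> 0" and m: "m > 0" and h: "degree H = h" "h > 0" and R: "degree R < m + h"
  shows "\<exists>a b. degree a < h \<and> degree b < m \<and> [:-c, 1:] ^ m * a + b * H = R"
proof -
  let ?G = "[:-c, 1:] ^ m"
  have dG: "degree ?G = m" "?G \<noteq> 0" by (simp_all add: degree_power_eq)
  obtain u v where uv: "u * ?G + v * H = 1" using bezout_linear_power[OF H] by blast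
  define b where "b = (v * R) mod ?G"
  define a where "a = u * R + H * ((v * R) div ?G)"
  have "?G * a + b * H = u * ?G * R + H * (?G * ((v * R) div ?G) + b)"
    by (simp add: a_def algebra_simps)
  also have "?G * ((v * R) div ?G) + b = v * R" unfolding b_def by (rule mult_div_mod_eq)
  also have "u * ?G * R + H * (v * R) = (u * ?G + v * H) * R" by (simp add: algebra_simps)
  finally have eq: "?G * a + b * H = R" using uv by simp
  have db: "degree b < m"
    using degree_mod_less[OF dG(2), of "v * R"] m dG(1) unfolding b_def by auto
  have "degree a < h"
  proof (cases "a = 0")
    case True
    thus ?thesis using h by simp
  next
    case False
    have "H \<noteq> 0" using h by auto
    have "?G * a = R - b * H" using eq by (simp add: algebra_simps)
    moreover have "degree (R - b * H) < m + h"
      using R db h degree_mult_le[of b H] by (intro degree_diff_less) auto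
    ultimately have "degree (?G * a) < m + h" by simp
    thus ?thesis using False dG by (simp add: degree_mult_eq)
  qed
  thus ?thesis using db eq by blast
qed

text \<open>Course-of-values recursion through a relation: entry \<open>n\<close> is any value
  related to the list of earlier entries. In Hensel lifting the equation at order \<open>n\<close>
  involves products of all lower coefficients; solvability is shown separately by induction.\<close>

fun strong_rec :: "('a list \<Rightarrow> 'a \<Rightarrow> bool) \<Rightarrow> nat \<Rightarrow> 'a" where
  "strong_rec P n = (SOME r. P (map (strong_rec P) [0..<n]) r)"

declare strong_rec.simps [simp del]

abbreviation fps_poly_nth :: "nat \<Rightarrow> 'a::comm_ring_1 fps poly \<Rightarrow> 'a poly" where
  "fps_poly_nth i P \<equiv> map_poly (\<lambda>f. fps_nth f i) P"

text \<open>The pair \<open>s n\<close> holds the coefficients of order \<open>n\<close> of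
  \<open>A\<close> and \<open>B\<close>. Comparing that order in \<open>P = A * B\<close> gives a
  linear equation for the pair, solvable because \<open>?G\<close> and \<open>H\<close> are coprime.
  The corrections to \<open>A\<close> have degree below \<open>m\<close>, so \<open>A\<close> stays
  monic.\<close>

lemma hensel_factor:
  fixes P :: "'a::field fps poly"
  assumes P: "degree P = m + h" "lead_coeff P = 1"
    and P0: "fps_poly_nth 0 P = [:-c, 1:] ^ m * H" and H: "poly H c \<noteq> 0" "degree H = h"
    and mh: "m > 0" "h > 0"
  shows "\<exists>A B. P = A * B \<and> degree A = m \<and> lead_coeff A = 1"
proof -
  let ?G = "[:-c, 1:] ^ m"
  let ?F = "\<lambda>i. fps_poly_nth i P"
  have dG: "degree ?G = m" by (simp add: degree_power_eq)
  have Fdeg: "degree (?F i) < m + h" if "i > 0" for i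
  proof -
    have "coeff (?F i) (m + h) = 0" using P that by (simp add: coeff_map_poly)
    moreover have "degree (?F i) \<le> m + h" using P(1) map_poly_degree_leq[of "\<lambda>f. fps_nth f i" P] by simp
    ultimately show ?thesis using mh
      by (metis add_is_0 degree_0 le_neq_implies_less leading_coeff_0_iff less_numeral_extra(3) neq0_conv)
  qed
  define Q :: "('a poly \<times> 'a poly) list \<Rightarrow> ('a poly \<times> 'a poly) \<Rightarrow> bool" where
    "Q xs r \<longleftrightarrow> (if xs = [] then r = (?G, H) else degree (snd r) < h \<and> degree (fst r) < m \<and>
       ?G * snd r + fst r * H =
         ?F (length xs) - (\<Sum>j = 1..<length xs. fst (xs ! j) * snd (xs ! (length xs - j))))" for xs r
  define s where "s = strong_rec Q"
  have s_eq: "s n = (SOME r. Q (map s [0..<n]) r)" for n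
    unfolding s_def by (subst strong_rec.simps) simp
  have sQ: "Q (map s [0..<n]) (s n)" for n
  proof (induction n rule: less_induct)
    case (less n)
    have "\<exists>r. Q (map s [0..<n]) r"
    proof (cases "n = 0")
      case True
      thus ?thesis by (simp add: Q_def)
    next
      case False
      have d: "degree (snd (s j)) < h \<and> degree (fst (s j)) < m" if "0 < j" "j < n" for j
        using less[OF that(2)] that(1) by (auto simp: Q_def split: if_splits)
      let ?R = "?F n - (\<Sum>j = 1..<n. fst (s j) * snd (s (n - j)))"
      have "degree (fst (s j) * snd (s (n - j))) < m + h" if "j \<in> {1..<n}" for j
        using d[of j] d[of "n - j"] that degree_mult_le[of "fst (s j)" "snd (s (n - j))"] by auto
      hence "degree (\<Sum>j = 1..<n. fst (s j) * snd (s (n - j))) < m + h"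
        using mh by (intro degree_sum_less) auto
      hence "degree ?R < m + h" using Fdeg[of n] False by (intro degree_diff_less) auto
      from bezout_solve[OF H(1) mh(1) H(2) mh(2) this] obtain a b where
        "degree a < h" "degree b < m" "?G * a + b * H = ?R" by blast
      hence "Q (map s [0..<n]) (b, a)" using False by (simp add: Q_def)
      thus ?thesis by blast
    qed
    thus ?case unfolding s_eq[of n] by (rule someI_ex)
  qed
  have s0: "s 0 = (?G, H)" using sQ[of 0] by (simp add: Q_def)
  have sn: "degree (snd (s n)) < h" "degree (fst (s n)) < m"
    "?G * snd (s n) + fst (s n) * H = ?F n - (\<Sum>j = 1..<n. fst (s j) * snd (s (n - j)))" if "n > 0" for n
    using sQ[of n] that by (simp_all add: Q_def)
  have conv: "(\<Sum>j\<le>n. fst (s j) * snd (s (n - j))) = ?F n" for n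
  proof (cases "n = 0")
    case True
    thus ?thesis by (simp add: s0 P0)
  next
    case False
    have "{..n} = insert 0 (insert n {1..<n})" using False by auto
    hence "(\<Sum>j\<le>n. fst (s j) * snd (s (n - j))) =
      fst (s 0) * snd (s n) + (fst (s n) * snd (s 0) + (\<Sum>j = 1..<n. fst (s j) * snd (s (n - j))))"
      using False by simp
    thus ?thesis using sn(3)[of n] False by (simp add: s0 algebra_simps)
  qed
  define A where "A = Abs_poly (\<lambda>r. if r \<le> m then Abs_fps (\<lambda>i. coeff (fst (s i)) r) else 0)"
  define B where "B = Abs_poly (\<lambda>r. if r \<le> h then Abs_fps (\<lambda>i. coeff (snd (s i)) r) else 0)"
  have dle: "degree (fst (s i)) \<le> m" "degree (snd (s i)) \<le> h" for i
    using sn(1,2)[of i] s0 dG H by (cases "i = 0"; simp)+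
  have cA: "fps_nth (coeff A r) i = coeff (fst (s i)) r" for r i
    using dle(1)[of i] coeff_eq_0[of "fst (s i)" r] by (cases "r \<le> m") (simp_all add: A_def coeff_Abs_poly_If_le)
  have cB: "fps_nth (coeff B r) i = coeff (snd (s i)) r" for r i
    using dle(2)[of i] coeff_eq_0[of "snd (s i)" r] by (cases "r \<le> h") (simp_all add: B_def coeff_Abs_poly_If_le)
  have "P = A * B"
  proof (rule poly_eqI, rule fps_ext)
    fix r i
    have "fps_nth (coeff (A * B) r) i = (\<Sum>t\<le>r. \<Sum>j = 0..i. coeff (fst (s j)) t * coeff (snd (s (i - j))) (r - t))"
      by (simp add: coeff_mult fps_sum_nth fps_mult_nth cA cB)
    also have "\<dots> = (\<Sum>j = 0..i. \<Sum>t\<le>r. coeff (fst (s j)) t * coeff (snd (s (i - j))) (r - t))"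
      by (rule sum.swap)
    also have "\<dots> = coeff (\<Sum>j\<le>i. fst (s j) * snd (s (i - j))) r"
      by (simp add: coeff_sum coeff_mult atMost_atLeast0)
    finally show "fps_nth (coeff P r) i = fps_nth (coeff (A * B) r) i"
      by (simp add: conv coeff_map_poly)
  qed
  moreover have "coeff A m = 1"
  proof (rule fps_ext)
    fix i show "fps_nth (coeff A m) i = fps_nth 1 i"
      using sn(2)[of i] by (cases "i = 0") (auto simp: cA s0 coeff_linear_power intro: coeff_eq_0)
  qed
  moreover have "degree A = m"
  proof (rule antisym)
    show "degree A \<le> m" by (rule degree_le) (simp add: A_def coeff_Abs_poly_If_le)
    show "m \<le> degree A" using \<open>coeff A m = 1\<close> by (intro le_degree) simp
  qed
  ultimately show ?thesis by auto
qed

text \<open>The two top coefficients decide which shift removes the second one. A bound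
  \<open>n\<close> replaces the degree, so the coefficient at \<open>n\<close> may vanish during the
  induction.\<close>

lemma coeff_pcompose_shift:
  fixes p :: "'a::comm_ring_1 poly"
  shows "degree p \<le> n \<Longrightarrow> coeff (pcompose p [:b, 1:]) n = coeff p n \<and>
    (n > 0 \<longrightarrow> coeff (pcompose p [:b, 1:]) (n - 1) = coeff p (n - 1) + of_nat n * b * coeff p n)"
proof (induction p arbitrary: n)
  case (pCons a p)
  show ?case
  proof (cases n)
    case 0
    hence "p = 0" using pCons.prems pCons.hyps by (metis bot_nat_0.extremum_uniqueI degree_pCons_eq nat.simps(3))
    thus ?thesis using 0 by (simp add: pcompose_pCons)
  next
    case (Suc n')
    have d: "degree p \<le> n'" using pCons.prems Suc by (cases "p = 0") auto
    note IH = pCons.IH[OF d]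
    have z: "coeff (pcompose p [:b, 1:]) (Suc n') = 0"
    proof (rule coeff_eq_0)
      show "degree (pcompose p [:b, 1:]) < Suc n'" using degree_pcompose_le[of p "[:b, 1:]"] d by simp
    qed
    show ?thesis using IH z Suc
      by (cases n') (auto simp: pcompose_pCons algebra_simps)
  qed
qed simp

subsection \<open>Puiseux roots\<close>

no_notation index_mat (infixl "$$" 100)
notation fls_nth (infixl "$$" 75)

text \<open>Substitution of \<open>X^e\<close> for the uniformizer. Series with fractional exponents
  are never built: a root in \<open>X^(1/e)\<close> appears as a Laurent root of the polynomial with
  \<open>cpow e\<close> applied to its coefficients.\<close>

abbreviation cpow :: "nat \<Rightarrow> 'a::field fls \<Rightarrow> 'a fls" where
  "cpow e \<equiv> \<lambda>f. fls_compose_power f e"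

lemma hom_on_cpow: "e > 0 \<Longrightarrow> hom_on R (cpow e)"
  by (simp add: hom_on_def)

lemma cpow_cpow: "d > 0 \<Longrightarrow> e > 0 \<Longrightarrow> cpow d (cpow e f) = cpow (e * d) f"
proof (rule fls_eqI)
  fix n assume de: "d > 0" "e > 0"
  have "int d dvd n \<and> int e dvd (n div int d) \<longleftrightarrow> int (e * d) dvd n"
    using de by (auto simp: mult.commute elim!: dvdE)
  moreover have "n div int d div int e = n div int (e * d)"
    using de by (simp add: div_mult2_eq zdiv_zmult2_eq mult.commute)
  ultimately show "cpow d (cpow e f) $$ n = cpow (e * d) f $$ n"
    using de by (auto simp: fls_nth_compose_power)
qed

lemma cpow_eq_0_iff: "e > 0 \<Longrightarrow> cpow e f = 0 \<longleftrightarrow> f = 0"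
proof
  assume e: "e > 0" and 0: "cpow e f = 0"
  show "f = 0"
  proof (rule fls_eqI)
    fix n
    have "cpow e f $$ (int e * n) = 0" using 0 by simp
    thus "f $$ n = 0 $$ n" using e by (simp add: fls_nth_compose_power)
  qed
qed simp

lemma cpow_subdegree:
  assumes "e > 0" "f \<noteq> 0"
  shows "fls_subdegree (cpow e f) = int e * fls_subdegree f"
proof (rule fls_subdegree_eqI)
  show "cpow e f $$ (int e * fls_subdegree f) \<noteq> 0" using assms by (simp add: fls_nth_compose_power)
  fix k assume "k < int e * fls_subdegree f"
  hence "f $$ (k div int e) = 0" if "int e dvd k" using that assms by (auto elim!: dvdE)
  thus "cpow e f $$ k = 0" using assms by (simp add: fls_nth_compose_power)
qed

lemma map_poly_cpow_simps:
  assumes "e > 0"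
  shows "map_poly (cpow e) (p * q) = map_poly (cpow e) p * map_poly (cpow e) q"
    "map_poly (cpow e) (p + q) = map_poly (cpow e) p + map_poly (cpow e) q"
    "map_poly (cpow e) (smult c p) = smult (cpow e c) (map_poly (cpow e) p)"
    "map_poly (cpow e) (pCons c p) = pCons (cpow e c) (map_poly (cpow e) p)"
    "degree (map_poly (cpow e) p) = degree p"
    "lead_coeff (map_poly (cpow e) p) = cpow e (lead_coeff p)"
    "poly (map_poly (cpow e) p) (cpow e z) = cpow e (poly p z)"
proof -
  note h = hom_on_cpow[OF assms, of UNIV]
  show "map_poly (cpow e) (p * q) = map_poly (cpow e) p * map_poly (cpow e) q"
    "map_poly (cpow e) (p + q) = map_poly (cpow e) p + map_poly (cpow e) q"
    "map_poly (cpow e) (smult c p) = smult (cpow e c) (map_poly (cpow e) p)"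
    "poly (map_poly (cpow e) p) (cpow e z) = cpow e (poly p z)"
    using map_poly_hom_on[OF h] map_poly_hom_on_smult[OF h] poly_map_poly_hom_on[OF h] by simp_all
  show "map_poly (cpow e) (pCons c p) = pCons (cpow e c) (map_poly (cpow e) p)"
    by (rule Polynomial.map_poly_pCons) simp
  show d: "degree (map_poly (cpow e) p) = degree p"
    by (cases "p = 0") (auto intro!: degree_map_poly simp: cpow_eq_0_iff[OF assms])
  show "lead_coeff (map_poly (cpow e) p) = cpow e (lead_coeff p)"
    unfolding d by (simp add: coeff_map_poly)
qed

lemma map_poly_cpow_pcompose:
  "e > 0 \<Longrightarrow> map_poly (cpow e) (pcompose p q) = pcompose (map_poly (cpow e) p) (map_poly (cpow e) q)"
  by (induction p) (simp_all add: pcompose_pCons map_poly_cpow_simps)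

lemma map_poly_cpow_cpow:
  "d > 0 \<Longrightarrow> e > 0 \<Longrightarrow> map_poly (cpow d) (map_poly (cpow e) p) = map_poly (cpow (e * d)) p"
  by (rule poly_eqI) (simp add: coeff_map_poly cpow_cpow)

text \<open>Newton's method: after removing the coefficient of degree \<open>n - 1\<close> and rescaling by the
  smallest slope, the reduction has two distinct roots, and Hensel lifting lowers the degree.\<close>
lemma puiseux_root_monic:
  fixes P :: "'a::{alg_closed_field, field_char_0} fls poly"
  shows "degree P > 0 \<Longrightarrow> lead_coeff P = 1 \<Longrightarrow> \<exists>e>0. \<exists>w. poly (map_poly (cpow e) P) w = 0"
proof (induction "degree P" arbitrary: P rule: less_induct)
  case less
  define n where "n = degree P"
  have n: "n > 0" using less n_def by simp
  \<comment> \<open>The Tschirnhaus shift; dividing by \<open>n\<close> uses characteristic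
    zero.\<close>
  define b where "b = - coeff P (n - 1) / of_nat n"
  define T where "T = pcompose P [:b, 1:]"
  have T: "degree T = n" "coeff T n = 1" "coeff T (n - 1) = 0"
  proof -
    show "degree T = n" unfolding T_def n_def by (simp add: degree_pcompose)
    show "coeff T n = 1" using coeff_pcompose_shift[of P n b] less(3) by (simp add: T_def n_def)
    show "coeff T (n - 1) = 0"
      using coeff_pcompose_shift[of P n b] less(3) n by (simp add: T_def b_def n_def[symmetric])
  qed
  have pull: "\<exists>e>0. \<exists>w. poly (map_poly (cpow e) P) w = 0" if "e > 0" "poly (map_poly (cpow e) T) w = 0" for e w
    using that by (intro exI[of _ e] conjI exI[of _ "cpow e b + w"])
      (simp_all add: T_def map_poly_cpow_pcompose map_poly_cpow_simps poly_pcompose)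
  show ?case
  proof (cases "\<forall>i<n. coeff T i = 0")
    case True
    hence "poly T 0 = 0" using n by (simp add: poly_0_coeff_0)
    hence "poly (map_poly (cpow 1) T) (cpow 1 0) = 0" by (subst map_poly_cpow_simps(7)) simp_all
    thus ?thesis using pull[of 1 "cpow 1 0"] by simp
  next
    case False
    define I where "I = {i. i < n \<and> coeff T i \<noteq> 0}"
    have I: "finite I" "I \<noteq> {}" using False by (auto simp: I_def)
    \<comment> \<open>Ramifying by \<open>n!\<close> turns all slopes
      \<open>fls_subdegree (coeff T i) / (n - i)\<close> into integers at once.\<close>
    define E where "E = (fact n :: nat)"
    have E: "E > 0" by (simp add: E_def)
    define sl where "sl i = int E * fls_subdegree (coeff T i) div int (n - i)" for i
    have sl: "sl i * int (n - i) = int E * fls_subdegree (coeff T i)" if "i < n" for i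
    proof -
      have "int (n - i) dvd int E" unfolding E_def using that by (intro int_dvd_int_iff[THEN iffD2] dvd_fact) auto
      thus ?thesis unfolding sl_def by (intro dvd_div_mult_self dvd_mult2)
    qed
    define \<mu> where "\<mu> = Min (sl ` I)"
    have "\<mu> \<in> sl ` I" unfolding \<mu>_def using I by (intro Min_in) simp_all
    then obtain i0 where i0: "i0 \<in> I" "\<mu> = sl i0" by blast
    have \<mu>: "\<mu> \<le> sl i" if "i \<in> I" for i using that I by (simp add: \<mu>_def)
    define \<xi> :: "'a fls" where "\<xi> = fls_X_intpow \<mu>"
    have \<xi>: "\<xi> \<noteq> 0" "fls_subdegree (\<xi> ^ k) = int k * \<mu>" for k
      by (simp_all add: \<xi>_def fls_subdegree_pow)
    \<comment> \<open>Rescaling the variable by \<open>\<xi>\<close> and dividing by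
      \<open>\<xi> ^ n\<close> keeps the polynomial monic. By minimality of the slope all
      coefficients become power series, and the one at \<open>i0\<close> a unit.\<close>
    define U where "U = smult (inverse (\<xi> ^ n)) (pcompose (map_poly (cpow E) T) [:0, \<xi>:])"
    have cU: "coeff U i = cpow E (coeff T i) / \<xi> ^ (n - i)" if "i \<le> n" for i
    proof -
      have "\<xi> ^ n = \<xi> ^ i * \<xi> ^ (n - i)" using that by (simp flip: power_add)
      thus ?thesis unfolding U_def using \<xi>(1) by (simp add: coeff_pcompose_linear coeff_map_poly field_simps)
    qed
    have degU: "degree U = n" unfolding U_def using \<xi>(1)
      by (simp add: degree_pcompose map_poly_cpow_simps(5)[OF E] T)
    have Un: "coeff U n = 1" "coeff U (n - 1) = 0" using n E T(2,3) cU[of n] cU[of "n - 1"] by simp_all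
    have subU: "fls_subdegree (coeff U i) = int (n - i) * (sl i - \<mu>) \<and> coeff U i \<noteq> 0" if "i \<in> I" for i
    proof -
      have i: "i < n" "coeff T i \<noteq> 0" using that by (auto simp: I_def)
      have "fls_subdegree (coeff U i) = int E * fls_subdegree (coeff T i) - int (n - i) * \<mu>"
        using i \<xi> E by (simp add: cU fls_divide_subdegree cpow_subdegree cpow_eq_0_iff)
      thus ?thesis using sl[OF i(1)] i \<xi>(1) E
        by (simp add: cU cpow_eq_0_iff algebra_simps)
    qed
    have Uint: "fls_subdegree (coeff U i) \<ge> 0" for i
    proof (cases "i \<in> I")
      case True
      thus ?thesis using subU[OF True] \<mu>[OF True] by simp
    next
      case False
      hence "i = n \<or> coeff U i = 0" using cU[of i] degU by (cases "i < n") (auto simp: I_def intro: coeff_eq_0)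
      thus ?thesis using Un by auto
    qed
    define V where "V = map_poly fls_regpart U"
    have UV: "U = map_poly fps_to_fls V"
      by (rule poly_eqI) (simp add: V_def coeff_map_poly fls_regpart_to_fls_trivial[OF Uint])
    have degV: "degree V = n"
    proof (rule antisym)
      show "degree V \<le> n" unfolding V_def using map_poly_degree_leq[of fls_regpart U] degU by simp
      show "n \<le> degree V" by (rule le_degree) (simp add: V_def coeff_map_poly Un)
    qed
    have Vn: "coeff V n = 1" "coeff V (n - 1) = 0" using Un by (simp_all add: V_def coeff_map_poly)
    let ?V0 = "fps_poly_nth 0 V"
    have V0: "coeff ?V0 n = 1" "coeff ?V0 (n - 1) = 0" using Vn by (simp_all add: coeff_map_poly)
    have V0deg: "degree ?V0 = n"
      using map_poly_degree_leq[of "\<lambda>f. fps_nth f 0" V] degV V0 by (intro antisym le_degree) auto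
    have V0i: "coeff ?V0 i0 \<noteq> 0"
    proof -
      have "fls_subdegree (coeff U i0) = 0" "coeff U i0 \<noteq> 0" using subU[OF i0(1)] i0(2) by auto
      hence "coeff U i0 $$ 0 \<noteq> 0" by (metis nth_fls_subdegree_nonzero)
      thus ?thesis by (simp add: V_def coeff_map_poly)
    qed
    have i0n: "i0 < n" using i0 by (simp add: I_def)
    obtain c where c: "poly ?V0 c = 0" using alg_closed_imp_poly_has_root[of ?V0] V0deg n by auto
    have V00: "?V0 \<noteq> 0" using V0 by auto
    obtain H where H: "?V0 = [:-c, 1:] ^ order c ?V0 * H" "\<not> [:-c, 1:] dvd H" using order_decomp[OF V00] by blast
    define m where "m = order c ?V0"
    have m: "m > 0" using c V00 by (simp add: m_def order_root)
    have Hc: "poly H c \<noteq> 0" using H(2) by (simp add: poly_eq_0_iff_dvd)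
    hence H0: "H \<noteq> 0" by auto
    have nmh: "n = m + degree H"
      using arg_cong[OF H(1), of degree] H0 unfolding V0deg m_def[symmetric]
      by (simp add: degree_mult_eq degree_power_eq)
    \<comment> \<open>Otherwise the reduction is \<open>(X - c)^n\<close>. Its vanishing coefficient
      at \<open>n - 1\<close> forces \<open>c = 0\<close>, and \<open>X^n\<close> has no nonzero
      coefficient at \<open>i0\<close>.\<close>
    have "degree H > 0"
    proof (rule ccontr)
      assume "\<not> degree H > 0"
      then obtain a where a: "H = [:a:]" by (auto elim: degree_eq_zeroE)
      have mn: "m = n" using nmh a by simp
      have V0': "?V0 = smult a ([:-c, 1:] ^ n)" using H(1) a unfolding m_def[symmetric] mn by simp
      have "a = 1" using V0(1) unfolding V0' by (simp add: coeff_linear_power)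
      have "of_nat (n choose (n - 1)) * (-c) = 0"
        using V0(2) n unfolding V0' \<open>a = 1\<close> by (simp add: coeff_linear_poly_power)
      hence "c = 0" using n by (auto simp: binomial_eq_0_iff)
      hence "?V0 = monom 1 n" using V0' \<open>a = 1\<close> by (simp add: monom_altdef)
      thus False using V0i i0n by simp
    qed
    then obtain A B where AB: "V = A * B" "degree A = m" "lead_coeff A = 1"
      using hensel_factor[of V m "degree H" c H] degV Vn H(1) Hc m nmh unfolding m_def[symmetric] by auto
    define A' where "A' = map_poly fps_to_fls A"
    have A': "degree A' = m" "lead_coeff A' = 1"
    proof -
      have "degree A' = degree A" unfolding A'_def by (rule degree_map_poly) simp
      thus "degree A' = m" "lead_coeff A' = 1" using AB(2,3) by (simp_all add: A'_def coeff_map_poly)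
    qed
    have "hom_on UNIV (fps_to_fls :: 'a fps \<Rightarrow> 'a fls)"
      by (simp add: hom_on_def fls_times_fps_to_fls)
    hence UAB: "U = A' * map_poly fps_to_fls B"
      unfolding UV AB(1) A'_def by (rule map_poly_hom_on(2)) simp_all
    have "m < n" using nmh \<open>degree H > 0\<close> by simp
    then obtain e w where e: "e > 0" "poly (map_poly (cpow e) A') w = 0"
      using less(1)[of A'] A' m unfolding n_def by auto
    have "poly (map_poly (cpow e) U) w = 0" using e by (simp add: UAB map_poly_cpow_simps)
    \<comment> \<open>A root of \<open>U\<close> becomes a root of \<open>T\<close> once the scaling
      is undone; the two ramifications multiply.\<close>
    hence "poly (map_poly (cpow (E * e)) T) (w * cpow e \<xi>) = 0"
      using e(1) E \<xi>(1) unfolding U_def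
      by (simp add: map_poly_cpow_simps map_poly_cpow_pcompose map_poly_cpow_cpow poly_pcompose cpow_eq_0_iff)
    thus ?thesis using pull[of "E * e"] E e(1) by auto
  qed
qed

lemma puiseux_root:
  fixes P :: "'a::{alg_closed_field, field_char_0} fls poly"
  assumes "degree P > 0"
  shows "\<exists>e>0. \<exists>w. poly (map_poly (cpow e) P) w = 0"
proof -
  let ?c = "lead_coeff P"
  have c: "?c \<noteq> 0" using assms by auto
  obtain e w where "e > 0" "poly (map_poly (cpow e) (smult (inverse ?c) P)) w = 0"
    using puiseux_root_monic[of "smult (inverse ?c) P"] assms c by auto
  thus ?thesis using c by (intro exI[of _ e] conjI exI[of _ w]) (auto simp: map_poly_cpow_simps cpow_eq_0_iff)
qed

lemma puiseux_split:
  fixes P :: "'a::{alg_closed_field, field_char_0} fls poly"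
  shows "lead_coeff P = 1 \<Longrightarrow> \<exists>e>0. \<exists>ws. map_poly (cpow e) P = (\<Prod>w\<leftarrow>ws. [:-w, 1:])"
proof (induction "degree P" arbitrary: P)
  case 0
  obtain a where "P = [:a:]" using degree_eq_zeroE[OF 0(1)[symmetric]] by blast
  thus ?case using 0 by (intro exI[of _ 1] conjI exI[of _ "[]"]) auto
next
  case (Suc n)
  obtain e w where e: "e > 0" "poly (map_poly (cpow e) P) w = 0" using puiseux_root[of P] Suc(2) by auto
  have "[:-w, 1:] dvd map_poly (cpow e) P" using e(2) by (simp add: poly_eq_0_iff_dvd)
  then obtain Q where Q: "map_poly (cpow e) P = [:-w, 1:] * Q" by (elim dvdE)
  have lcP: "lead_coeff (map_poly (cpow e) P) = 1" using Suc(3) e(1) by (simp only: map_poly_cpow_simps(6)) simp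
  hence "lead_coeff [:-w, 1:] * lead_coeff Q = 1" unfolding Q lead_coeff_mult .
  hence lcQ: "lead_coeff Q = 1" by simp
  hence "Q \<noteq> 0" by auto
  hence "degree ([:-w, 1:] * Q) = degree [:-w, 1:] + degree Q" by (intro degree_mult_eq) simp_all
  moreover have "degree ([:-w, 1:] * Q) = Suc n"
    using Suc(2) map_poly_cpow_simps(5)[OF e(1), of P] by (simp only: Q)
  ultimately have "n = degree Q" by (simp del: mult_pCons_left)
  from Suc(1)[OF this lcQ] obtain d ws where d: "d > 0" "map_poly (cpow d) Q = (\<Prod>w\<leftarrow>ws. [:-w, 1:])"
    by (elim exE conjE)
  have "map_poly (cpow (e * d)) P = map_poly (cpow d) ([:-w, 1:] * Q)"
    unfolding Q[symmetric] by (rule map_poly_cpow_cpow[OF d(1) e(1), symmetric])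
  also have "\<dots> = (\<Prod>w\<leftarrow>cpow d w # ws. [:-w, 1:])"
    using d by (simp only: map_poly_cpow_simps(1)[OF d(1)]) (simp add: map_poly_cpow_simps(4)[OF d(1)])
  finally show ?case using e(1) d(1) by (intro exI[of _ "e * d"] conjI exI[of _ "cpow d w # ws"]) auto
qed

section \<open>Integral Laurent series, residues and the choice of a Puiseux root\<close>

definition fls_int :: "'a::field fls set" where
  "fls_int = range fps_to_fls"

lemma fls_int_iff: "f \<in> fls_int \<longleftrightarrow> fls_subdegree f \<ge> 0"
proof
  assume "fls_subdegree f \<ge> 0"
  from fls_regpart_to_fls_trivial[OF this] show "f \<in> fls_int" unfolding fls_int_def by (metis rangeI)
qed (auto simp: fls_int_def fls_subdegree_fls_to_fps_gt0)

lemma is_subring_fls_int: "is_subring (fls_int :: 'a::field fls set)"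
  unfolding is_subring_def fls_int_def
  by (auto simp flip: fls_times_fps_to_fls fps_to_fls_plus fps_to_fls_uminus)

lemma hom_on_residue: "hom_on fls_int (\<lambda>f. (f :: 'a::field fls) $$ 0)"
  unfolding hom_on_def fls_int_def by (auto simp flip: fls_times_fps_to_fls)

lemma residue_cpow: "e > 0 \<Longrightarrow> cpow e f $$ 0 = f $$ 0"
  by (simp add: fls_nth_compose_power)

lemma cpow_fls_int: "e > 0 \<Longrightarrow> f \<in> fls_int \<Longrightarrow> cpow e f \<in> fls_int"
  by (cases "f = 0") (auto simp: fls_int_iff cpow_subdegree)

text \<open>If \<open>w\<close> had a pole, its inverse \<open>y\<close> would vanish at the origin.
  Multiplying the equation by \<open>y ^ degree P\<close> and taking constant terms leaves only the
  leading coefficient and gives \<open>1 = 0\<close>.\<close>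

lemma fls_int_integral:
  fixes w :: "'a::field fls"
  assumes P: "lead_coeff P = 1" "poly_over fls_int P" "poly P w = 0"
  shows "w \<in> fls_int"
proof (rule ccontr)
  assume w: "w \<notin> fls_int"
  define y where "y = inverse w"
  have w0: "w \<noteq> 0" "fls_subdegree w < 0" using w by (auto simp: fls_int_iff)
  have y: "fls_subdegree y > 0" using w0 by (simp add: y_def)
  hence yi: "y \<in> fls_int" "y $$ 0 = 0" by (auto simp: fls_int_iff)
  let ?n = "degree P"
  have wy: "w ^ i * y ^ ?n = y ^ (?n - i)" if "i \<le> ?n" for i
  proof -
    have "y ^ ?n = y ^ i * y ^ (?n - i)" using that by (simp flip: power_add)
    thus ?thesis using w0 by (simp add: y_def field_simps)
  qed
  note S = is_subring_fls_int and h = hom_on_residue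
  have cP: "coeff P i \<in> fls_int" for i using P(2) by (simp add: poly_over_def)
  have t: "(coeff P i * y ^ k) $$ 0 = coeff P i $$ 0 * 0 ^ k" for i k
    using hom_onD(4)[OF h cP[of i] is_subringD(7)[OF S yi(1), of k]] hom_on_more(3)[OF h S yi(1), of k] yi(2)
    by simp
  have "0 = poly P w * y ^ ?n" using P(3) by simp
  also have "\<dots> = (\<Sum>i\<le>?n. coeff P i * y ^ (?n - i))"
    unfolding poly_altdef sum_distrib_right by (intro sum.cong) (simp_all add: mult.assoc wy)
  finally have "0 = (\<Sum>i\<le>?n. coeff P i * y ^ (?n - i)) $$ 0" by simp
  also have "\<dots> = (\<Sum>i\<le>?n. (coeff P i * y ^ (?n - i)) $$ 0)"
    using yi cP by (intro hom_on_sum[OF h S] is_subringD[OF S])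
  also have "\<dots> = (\<Sum>i\<le>?n. coeff P i $$ 0 * 0 ^ (?n - i))"
    by (simp only: t)
  also have "\<dots> = (\<Sum>i\<le>?n. if i = ?n then coeff P i $$ 0 else 0)"
    by (intro sum.cong) auto
  finally show False using P(1) by simp
qed

text \<open>A single Puiseux root might have the wrong residue, so \<open>P\<close> is split
  completely. Its reduction is then the product of the linear factors at the residues of the roots,
  and \<open>c\<close> must be one of these residues.\<close>

lemma puiseux_root_residue:
  fixes P :: "'a::{alg_closed_field, field_char_0} fls poly"
  assumes P: "lead_coeff P = 1" "poly_over fls_int P" and c: "poly (map_poly (\<lambda>f. f $$ 0) P) c = 0"
  shows "\<exists>e>0. \<exists>w\<in>fls_int. w $$ 0 = c \<and> poly (map_poly (cpow e) P) w = 0"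
proof -
  note S = is_subring_fls_int and h = hom_on_residue
  obtain e ws where e: "e > 0" "map_poly (cpow e) P = (\<Prod>w\<leftarrow>ws. [:-w, 1:])" using puiseux_split[OF P(1)] by blast
  let ?Q = "map_poly (cpow e) P"
  have Q: "lead_coeff ?Q = 1" "poly_over fls_int ?Q"
    using P e(1) map_poly_cpow_simps(6)[OF e(1), of P] cpow_fls_int[OF e(1)]
    by (auto simp: poly_over_def coeff_map_poly)
  have roots: "poly ?Q w = 0" if "w \<in> set ws" for w
    using that unfolding e(2) by (auto simp: poly_prod_list prod_list_zero_iff)
  hence ws: "set ws \<subseteq> fls_int" using fls_int_integral[OF Q] by blast
  have "poly_over fls_int (\<Prod>w\<leftarrow>ws. [:-w, 1:]) \<and>
    map_poly (\<lambda>f. f $$ 0) (\<Prod>w\<leftarrow>ws. [:-w, 1:]) = (\<Prod>w\<leftarrow>ws. [:-(w $$ 0), 1:])"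
    if "set ws \<subseteq> fls_int" for ws :: "'a fls list"
    using that
  proof (induction ws)
    case (Cons w ws)
    have 1: "poly_over fls_int [:-w, 1:]"
      using Cons.prems by (simp add: poly_over_pCons_iff S is_subringD[OF S])
    have 2: "map_poly (\<lambda>f. f $$ 0) [:-w, 1:] = [:-(w $$ 0), 1:]"
      by (simp add: Polynomial.map_poly_pCons)
    show ?case using Cons map_poly_hom_on(2)[OF h S 1] poly_over_arith(3)[OF S 1] 2
      by (simp del: mult_pCons_left)
  qed (simp add: poly_over_arith[OF S])
  from this[OF ws] have "map_poly (\<lambda>f. f $$ 0) ?Q = (\<Prod>w\<leftarrow>ws. [:-(w $$ 0), 1:])" unfolding e(2) by blast
  moreover have "map_poly (\<lambda>f. f $$ 0) ?Q = map_poly (\<lambda>f. f $$ 0) P"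
    by (rule poly_eqI) (simp add: coeff_map_poly residue_cpow[OF e(1)])
  ultimately have "poly (\<Prod>w\<leftarrow>ws. [:-(w $$ 0), 1:]) c = 0" using c by simp
  then obtain w where "w \<in> set ws" "w $$ 0 = c" by (auto simp: poly_prod_list prod_list_zero_iff)
  thus ?thesis using e(1) ws roots by blast
qed

subsection \<open>Polynomial expressions and Noether normalization\<close>

text \<open>Polynomials as syntax trees: one expression can be evaluated in the base field, in
  polynomial rings, in the generic field and in Laurent series, and homomorphisms commute with
  evaluation by structural induction. Vanishing is always expressed through values.\<close>

datatype ('a, 'v) pexp = Const 'a | Var 'v | Add "('a, 'v) pexp" "('a, 'v) pexp" | Mul "('a, 'v) pexp" "('a, 'v) pexp"

primrec peval :: "('a \<Rightarrow> 'r::comm_ring_1) \<Rightarrow> ('v \<Rightarrow> 'r) \<Rightarrow> ('a, 'v) pexp \<Rightarrow> 'r" where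
  "peval h \<rho> (Const c) = h c"
| "peval h \<rho> (Var v) = \<rho> v"
| "peval h \<rho> (Add p q) = peval h \<rho> p + peval h \<rho> q"
| "peval h \<rho> (Mul p q) = peval h \<rho> p * peval h \<rho> q"

lemma peval_hom:
  assumes "hom_on UNIV g"
  shows "g (peval h \<rho> p) = peval (\<lambda>c. g (h c)) (\<lambda>v. g (\<rho> v)) p"
  by (induction p) (simp_all add: hom_onD[OF assms])

lemma peval_hom_on:
  assumes "hom_on R g" "is_subring R" "\<And>c. c \<in> set1_pexp p \<Longrightarrow> h c \<in> R" "\<And>v. v \<in> set2_pexp p \<Longrightarrow> \<rho> v \<in> R"
  shows "g (peval h \<rho> p) = peval (\<lambda>c. g (h c)) (\<lambda>v. g (\<rho> v)) p \<and> peval h \<rho> p \<in> R"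
  using assms(3,4) by (induction p) (simp_all add: hom_onD[OF assms(1)] is_subringD[OF assms(2)])

lemma peval_cong:
  "(\<And>c. c \<in> set1_pexp p \<Longrightarrow> h c = h' c) \<Longrightarrow> (\<And>v. v \<in> set2_pexp p \<Longrightarrow> \<rho> v = \<rho>' v) \<Longrightarrow>
    peval h \<rho> p = peval h' \<rho>' p"
  by (induction p) simp_all

lemma peval_in_subring:
  assumes "is_subring R" "\<And>c. c \<in> set1_pexp p \<Longrightarrow> h c \<in> R" "\<And>v. v \<in> set2_pexp p \<Longrightarrow> \<rho> v \<in> R"
  shows "peval h \<rho> p \<in> R"
  using assms(2,3) by (induction p) (simp_all add: is_subringD[OF assms(1)])

lemma finite_set2_pexp: "finite (set2_pexp p)"
  by (induction p) simp_all

text \<open>Coordinates outside \<open>U\<close> are confined to \<open>R\<close>; freeing one more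
  uses that a nonzero univariate polynomial has finitely many roots. \<open>F\<close> is abstract
  because values and homogeneous components of expressions are both treated this way.\<close>

lemma vanish_from_infinite:
  fixes F :: "('v \<Rightarrow> 'a::idom) \<Rightarrow> 'a"
  assumes R: "infinite R" and S: "finite S"
    and dep: "\<And>\<rho> \<rho>'. (\<And>v. v \<in> S \<Longrightarrow> \<rho> v = \<rho>' v) \<Longrightarrow> F \<rho> = F \<rho>'"
    and pol: "\<And>\<rho> v. \<exists>P. \<forall>t. poly P t = F (\<rho>(v := t))"
    and zero: "\<And>\<rho>. (\<And>v. \<rho> v \<in> R) \<Longrightarrow> F \<rho> = 0"
  shows "F \<rho> = 0"
proof -
  have main: "finite U \<Longrightarrow> (\<And>v. v \<notin> U \<Longrightarrow> \<rho> v \<in> R) \<Longrightarrow> F \<rho> = 0" for U \<rho>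
  proof (induction U arbitrary: \<rho> rule: finite_induct)
    case (insert v U)
    obtain P where P: "\<forall>t. poly P t = F (\<rho>(v := t))" using pol by blast
    have "F (\<rho>(v := t)) = 0" if "t \<in> R" for t by (rule insert.IH) (use insert.prems that in auto)
    hence sub: "R \<subseteq> {t. poly P t = 0}" using P by auto
    have "P = 0"
    proof (rule ccontr)
      assume "P \<noteq> 0"
      thus False using finite_subset[OF sub poly_roots_finite] R by simp
    qed
    thus ?case using P[rule_format, of "\<rho> v"] by simp
  qed (use zero in auto)
  obtain r where r: "r \<in> R" using R by (metis finite.emptyI equals0I)
  have "F \<rho> = F (\<lambda>v. if v \<in> S then \<rho> v else r)" by (rule dep) simp
  also have "\<dots> = 0" by (rule main[OF S]) (simp add: r)
  finally show ?thesis .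
qed

lemma peval_vanish:
  fixes h :: "'c \<Rightarrow> 'a::idom" and p :: "('c, 'v) pexp"
  assumes R: "infinite R" and zero: "\<And>\<rho>. (\<And>v. \<rho> v \<in> R) \<Longrightarrow> peval h \<rho> p = 0"
  shows "peval h \<rho> p = 0"
proof (rule vanish_from_infinite[where F = "\<lambda>\<rho>. peval h \<rho> p" and R = R, OF R finite_set2_pexp[of p]])
  fix \<rho> :: "'v \<Rightarrow> 'a" and v
  have hom: "hom_on UNIV (\<lambda>q. poly q t)" for t :: 'a by (simp add: hom_on_def)
  have "poly (peval (\<lambda>c. [:h c:]) (\<lambda>w. if w = v then [:0, 1:] else [:\<rho> w:]) p) t = peval h (\<rho>(v := t)) p" for t
    unfolding peval_hom[OF hom] by (rule peval_cong) auto
  thus "\<exists>P. \<forall>t. poly P t = peval h (\<rho>(v := t)) p" by blast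
next
  fix \<rho> \<rho>' :: "'v \<Rightarrow> 'a"
  assume "\<And>v. v \<in> set2_pexp p \<Longrightarrow> \<rho> v = \<rho>' v"
  thus "peval h \<rho> p = peval h \<rho>' p" by (intro peval_cong refl)
qed (rule zero)

section \<open>Homogeneous components and restriction to lines\<close>

primrec tdeg :: "('a, 'v) pexp \<Rightarrow> nat" where
  "tdeg (Const c) = 0"
| "tdeg (Var v) = 1"
| "tdeg (Add p q) = max (tdeg p) (tdeg q)"
| "tdeg (Mul p q) = tdeg p + tdeg q"

lemma degree_peval_le:
  "degree (peval (\<lambda>c. [:h c:]) (\<lambda>v. [:0, r v:]) p) \<le> tdeg p"
proof (induction p)
  case (Add p q)
  let ?e = "peval (\<lambda>c. [:h c:]) (\<lambda>v. [:0, r v:])"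
  have "degree (?e p + ?e q) \<le> max (degree (?e p)) (degree (?e q))" by (rule degree_add_le_max)
  thus ?case using Add by simp
next
  case (Mul p q)
  let ?e = "peval (\<lambda>c. [:h c:]) (\<lambda>v. [:0, r v:])"
  have "degree (?e p * ?e q) \<le> degree (?e p) + degree (?e q)" by (rule degree_mult_le)
  thus ?case using Mul by simp
qed auto

lemma coeff_mult_bounds:
  fixes p q :: "'a::comm_ring_1 poly"
  assumes "degree p \<le> a" "degree q \<le> b"
  shows "coeff (p * q) (a + b) = coeff p a * coeff q b"
proof -
  have "coeff p i * coeff q (a + b - i) = (if i = a then coeff p a * coeff q b else 0)" for i
  proof (cases i a rule: linorder_cases)
    case less
    hence "coeff q (a + b - i) = 0" using assms by (intro coeff_eq_0) auto
    thus ?thesis using less by simp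
  next
    case greater
    hence "coeff p i = 0" using assms by (intro coeff_eq_0) auto
    thus ?thesis using greater by simp
  qed auto
  thus ?thesis by (simp add: coeff_mult)
qed

text \<open>Value at \<open>\<rho>\<close> of the homogeneous component of degree \<open>i\<close>.\<close>
definition hcomp :: "('a::comm_ring_1, 'v) pexp \<Rightarrow> nat \<Rightarrow> ('v \<Rightarrow> 'a) \<Rightarrow> 'a" where
  "hcomp p i \<rho> = coeff (peval (\<lambda>c. [:c:]) (\<lambda>v. [:0, \<rho> v:]) p) i"

text \<open>Two gradings at once: the outer variable counts the homogeneous degree, the inner one is
  the parameter of the line \<open>a + t * l\<close>.\<close>

definition line_poly :: "('a::comm_ring_1, 'v) pexp \<Rightarrow> ('v \<Rightarrow> 'a) \<Rightarrow> ('v \<Rightarrow> 'a) \<Rightarrow> 'a poly poly" where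
  "line_poly p a l = peval (\<lambda>c. [:[:c:]:]) (\<lambda>v. [:0, [:a v, l v:]:]) p"

text \<open>A variable contributes to the inner degree at most what it contributes to the outer one,
  with equality only through its \<open>l\<close> part. So the extreme coefficient sees the
  direction and not the base point.\<close>

lemma line_poly_coeff:
  "degree (coeff (line_poly p a l) i) \<le> i \<and> coeff (coeff (line_poly p a l) i) i = hcomp p i l"
proof (induction p arbitrary: i)
  case (Const c)
  show ?case by (cases i) (simp_all add: line_poly_def hcomp_def)
next
  case (Var v)
  show ?case by (cases i; cases "i - 1") (simp_all add: line_poly_def hcomp_def)
next
  case (Add p q)
  thus ?case by (simp add: line_poly_def hcomp_def degree_add_le)
next
  case (Mul p q)
  let ?P = "line_poly p a l" and ?Q = "line_poly q a l"
  have eq: "coeff (line_poly (Mul p q) a l) i = (\<Sum>j\<le>i. coeff ?P j * coeff ?Q (i - j))"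
    by (simp add: line_poly_def coeff_mult)
  have d: "degree (coeff ?P j * coeff ?Q (i - j)) \<le> i" if "j \<le> i" for j
    using Mul(1)[of j, THEN conjunct1] Mul(2)[of "i - j", THEN conjunct1]
      degree_mult_le[of "coeff ?P j" "coeff ?Q (i - j)"] that by linarith
  have c: "coeff (coeff ?P j * coeff ?Q (i - j)) i = hcomp p j l * hcomp q (i - j) l" if "j \<le> i" for j
    using coeff_mult_bounds[of "coeff ?P j" j "coeff ?Q (i - j)" "i - j"] Mul(1)[of j] Mul(2)[of "i - j"] that
    by simp
  have "degree (\<Sum>j\<le>i. coeff ?P j * coeff ?Q (i - j)) \<le> i" using d by (intro degree_sum_le) auto
  moreover have "coeff (\<Sum>j\<le>i. coeff ?P j * coeff ?Q (i - j)) i = hcomp (Mul p q) i l"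
    using c by (simp add: coeff_sum hcomp_def coeff_mult)
  ultimately show ?case unfolding eq by blast
qed

lemma poly_line_poly_coeff:
  "poly (coeff (line_poly p a l) i) t = hcomp p i (\<lambda>v. a v + t * l v)"
proof -
  have h: "hom_on UNIV (\<lambda>q. poly q t)" by (simp add: hom_on_def)
  have h2: "hom_on UNIV (map_poly (\<lambda>q. poly q t))"
    unfolding hom_on_def[of UNIV "map_poly (\<lambda>q. poly q t)"] using map_poly_hom_on[OF h] by simp
  have "poly (coeff (line_poly p a l) i) t = coeff (map_poly (\<lambda>q. poly q t) (line_poly p a l)) i"
    by (simp add: coeff_map_poly)
  also have "map_poly (\<lambda>q. poly q t) (line_poly p a l) = peval (\<lambda>c. [:c:]) (\<lambda>v. [:0, a v + t * l v:]) p"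
    unfolding line_poly_def peval_hom[OF h2] by (simp add: Polynomial.map_poly_pCons)
  finally show ?thesis by (simp add: hcomp_def)
qed

lemma hcomp_cong: "(\<And>v. v \<in> set2_pexp p \<Longrightarrow> \<rho> v = \<rho>' v) \<Longrightarrow> hcomp p i \<rho> = hcomp p i \<rho>'"
  unfolding hcomp_def by (subst peval_cong[of p]) auto

lemma hcomp_vanish:
  fixes p :: "('a::idom, 'v) pexp"
  assumes R: "infinite R" and zero: "\<And>\<rho>. (\<And>v. \<rho> v \<in> R) \<Longrightarrow> hcomp p i \<rho> = 0"
  shows "hcomp p i \<rho> = 0"
proof (rule vanish_from_infinite[where F = "hcomp p i" and R = R, OF R finite_set2_pexp[of p]])
  fix \<rho> :: "'v \<Rightarrow> 'a" and v
  have "poly (coeff (line_poly p (\<rho>(v := 0)) (\<lambda>w. if w = v then 1 else 0)) i) t = hcomp p i (\<rho>(v := t))" for t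
    unfolding poly_line_poly_coeff by (rule hcomp_cong) auto
  thus "\<exists>P. \<forall>t. poly P t = hcomp p i (\<rho>(v := t))" by blast
next
  fix \<rho> \<rho>' :: "'v \<Rightarrow> 'a"
  assume "\<And>v. v \<in> set2_pexp p \<Longrightarrow> \<rho> v = \<rho>' v"
  thus "hcomp p i \<rho> = hcomp p i \<rho>'" by (rule hcomp_cong)
qed (rule zero)

lemma poly_line_poly_1:
  "poly (line_poly p a l) 1 = peval (\<lambda>c. [:c:]) (\<lambda>v. [:a v, l v:]) p"
proof -
  have h: "hom_on UNIV (\<lambda>q. poly q (1 :: 'a poly))" by (simp add: hom_on_def)
  show ?thesis unfolding line_poly_def peval_hom[OF h] by simp
qed

lemma peval_sum_hcomp: "peval id \<rho> p = (\<Sum>i\<le>tdeg p. hcomp p i \<rho>)"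
proof -
  let ?G = "peval (\<lambda>c. [:c:]) (\<lambda>v. [:0, \<rho> v:]) p"
  have h: "hom_on UNIV (\<lambda>q. poly q (1 :: 'a))" by (simp add: hom_on_def)
  have "peval id \<rho> p = poly ?G 1" unfolding peval_hom[OF h] by (simp add: id_def)
  also have "\<dots> = (\<Sum>i\<le>degree ?G. coeff ?G i)" by (simp add: poly_altdef)
  also have "\<dots> = (\<Sum>i\<le>tdeg p. coeff ?G i)"
    using degree_peval_le[of "\<lambda>c. c" \<rho> p] by (intro sum.mono_neutral_left) (auto intro: coeff_eq_0)
  finally show ?thesis by (simp add: hcomp_def)
qed

text \<open>Only the top form can reach degree \<open>D\<close> on a line, and there it is evaluated
  at the direction. Noether normalization thus gets a leading coefficient that does not involve
  \<open>a\<close>.\<close>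

lemma line_restriction:
  fixes p :: "('a::field_char_0, 'v) pexp" and a l
  assumes top: "\<And>i \<rho>. i > D \<Longrightarrow> hcomp p i \<rho> = 0"
  defines "Q \<equiv> peval (\<lambda>c. [:c:]) (\<lambda>v. [:a v, l v:]) p"
  shows "degree Q \<le> D" "coeff Q D = hcomp p D l" "poly Q t = peval id (\<lambda>v. a v + t * l v) p"
proof -
  let ?L = "line_poly p a l"
  have 0: "coeff ?L i = 0" if "i > D" for i
    by (rule poly_eq_poly_eq_iff[THEN iffD1]) (simp add: fun_eq_iff poly_line_poly_coeff top[OF that])
  have "Q = poly ?L 1" by (simp add: poly_line_poly_1 Q_def)
  also have "\<dots> = (\<Sum>i\<le>degree ?L. coeff ?L i)" by (simp add: poly_altdef)
  also have "\<dots> = (\<Sum>i\<le>max D (degree ?L). coeff ?L i)"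
    by (intro sum.mono_neutral_left) (auto intro: coeff_eq_0)
  also have "\<dots> = (\<Sum>i\<le>D. coeff ?L i)"
    by (intro sum.mono_neutral_right) (auto intro: 0)
  finally have Q: "Q = (\<Sum>i\<le>D. coeff ?L i)" .
  show "degree Q \<le> D" unfolding Q
  proof (rule degree_sum_le)
    fix i assume "i \<in> {..D}"
    thus "degree (coeff ?L i) \<le> D" using line_poly_coeff[of p a l i] by simp
  qed simp
  have "coeff Q D = (\<Sum>i\<le>D. if i = D then hcomp p D l else 0)" unfolding Q coeff_sum
  proof (rule sum.cong[OF refl])
    fix i assume "i \<in> {..D}"
    thus "coeff (coeff ?L i) D = (if i = D then hcomp p D l else 0)"
      using line_poly_coeff[of p a l i] by (auto intro: coeff_eq_0)
  qed
  thus "coeff Q D = hcomp p D l" by simp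
  have h: "hom_on UNIV (\<lambda>q. poly q t)" by (simp add: hom_on_def)
  show "poly Q t = peval id (\<lambda>v. a v + t * l v) p"
    unfolding Q_def peval_hom[OF h] by (simp add: id_def)
qed

lemma is_subring_poly_over: "is_subring R \<Longrightarrow> is_subring {p. poly_over R p}"
  unfolding is_subring_def[of "{p. poly_over R p}"] by (simp add: poly_over_arith)

lemma adjoins_pexp:
  assumes R: "is_subring R" and x: "x \<in> adjoins R ss"
  shows "\<exists>p. set1_pexp p \<subseteq> R \<and> set2_pexp p \<subseteq> {..<length ss} \<and> x = peval id (\<lambda>i. ss ! i) p"
proof -
  define ok where "ok p \<longleftrightarrow> set1_pexp p \<subseteq> R \<and> set2_pexp p \<subseteq> {..<length ss}" for p :: "('a, nat) pexp"
  let ?S = "{peval id (\<lambda>i. ss ! i) p | p. ok p}"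
  have mem: "peval id (\<lambda>i. ss ! i) p \<in> ?S" if "ok p" for p using that by blast
  have "is_subring ?S"
    unfolding is_subring_def
  proof (intro conjI ballI)
    show "1 \<in> ?S" using mem[of "Const 1"] is_subringD[OF R] by (simp add: ok_def)
    fix x assume "x \<in> ?S"
    then obtain p where p: "x = peval id (\<lambda>i. ss ! i) p" "ok p" by blast
    show "- x \<in> ?S" using mem[of "Mul (Const (- 1)) p"] p is_subringD[OF R] by (simp add: ok_def)
    fix y assume "y \<in> ?S"
    then obtain q where q: "y = peval id (\<lambda>i. ss ! i) q" "ok q" by blast
    show "x + y \<in> ?S" using mem[of "Add p q"] p q by (simp add: ok_def)
    show "x * y \<in> ?S" using mem[of "Mul p q"] p q by (simp add: ok_def)
  qed
  moreover have "R \<subseteq> ?S" using mem[of "Const c" for c] by (fastforce simp: ok_def)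
  moreover have "set ss \<subseteq> ?S" using mem[of "Var i" for i] by (fastforce simp: ok_def in_set_conv_nth)
  ultimately have "adjoins R ss \<subseteq> ?S" by (rule adjoins_least)
  then obtain p where "x = peval id (\<lambda>i. ss ! i) p" "ok p" using x by blast
  thus ?thesis unfolding ok_def by blast
qed

section \<open>Algebraic independence and Noether normalization\<close>

fun indep_over :: "'a::idom set \<Rightarrow> 'a list \<Rightarrow> bool" where
  "indep_over R [] = True"
| "indep_over R (s # ss) \<longleftrightarrow> \<not> algebraic_over R s \<and> indep_over (adjoin R s) ss"

lemma not_indep_over:
  "\<not> indep_over R ss \<Longrightarrow> \<exists>i<length ss. algebraic_over (adjoins R (take i ss)) (ss ! i)"
proof (induction ss arbitrary: R)
  case (Cons s ss)
  show ?case
  proof (cases "algebraic_over R s")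
    case True
    thus ?thesis by (intro exI[of _ 0]) simp
  next
    case False
    then obtain i where "i < length ss" "algebraic_over (adjoins (adjoin R s) (take i ss)) (ss ! i)"
      using Cons by auto
    thus ?thesis by (intro exI[of _ "Suc i"]) simp
  qed
qed simp

primrec psum :: "(nat \<Rightarrow> ('a::zero, 'v) pexp) \<Rightarrow> nat \<Rightarrow> ('a, 'v) pexp" where
  "psum f 0 = Const 0"
| "psum f (Suc n) = Add (psum f n) (f n)"

primrec pprod :: "(nat \<Rightarrow> ('a::one, 'v) pexp) \<Rightarrow> nat \<Rightarrow> ('a, 'v) pexp" where
  "pprod f 0 = Const 1"
| "pprod f (Suc n) = Mul (pprod f n) (f n)"

lemma peval_psum: "h 0 = 0 \<Longrightarrow> peval h \<rho> (psum f n) = (\<Sum>i<n. peval h \<rho> (f i))"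
  by (induction n) simp_all

lemma peval_pprod: "h 1 = 1 \<Longrightarrow> peval h \<rho> (pprod f n) = (\<Prod>i<n. peval h \<rho> (f i))"
  by (induction n) simp_all

lemma set_psum: "set1_pexp (psum f n) = insert 0 (\<Union>i<n. set1_pexp (f i))"
  "set2_pexp (psum f n) = (\<Union>i<n. set2_pexp (f i))"
  by (induction n) (auto simp: lessThan_Suc)

lemma set_pprod: "set1_pexp (pprod f n) = insert 1 (\<Union>i<n. set1_pexp (f i))"
  "set2_pexp (pprod f n) = (\<Union>i<n. set2_pexp (f i))"
  by (induction n) (auto simp: lessThan_Suc)

text \<open>A tree may represent the zero polynomial, so nontriviality is recorded as a nonzero
  value at a point of \<open>R\<close>. Such a point is found from a nonzero coefficient of the
  one-variable relation: first make this coefficient survive, then choose the value \<open>t\<close>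
  of the last variable.\<close>

lemma dependence_relation:
  fixes R :: "'a::idom set"
  assumes R: "is_subring R" "infinite R" and dep: "\<not> indep_over R ss"
  shows "\<exists>p \<rho>. set1_pexp p \<subseteq> R \<and> set2_pexp p \<subseteq> {..<length ss} \<and> peval id (\<lambda>i. ss ! i) p = 0 \<and>
    (\<forall>v. \<rho> v \<in> R) \<and> peval id \<rho> p \<noteq> 0"
proof -
  obtain i where i: "i < length ss" "algebraic_over (adjoins R (take i ss)) (ss ! i)"
    using not_indep_over[OF dep] by blast
  let ?A = "adjoins R (take i ss)"
  obtain P where P: "P \<noteq> 0" "poly_over ?A P" "poly P (ss ! i) = 0" using i(2) by (auto simp: algebraic_over_def)
  have "\<exists>p. set1_pexp p \<subseteq> R \<and> set2_pexp p \<subseteq> {..<i} \<and> coeff P j = peval id (\<lambda>i. ss ! i) p" for j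
  proof -
    have "coeff P j \<in> ?A" using P(2) by (simp add: poly_over_def)
    then obtain p where p: "set1_pexp p \<subseteq> R" "set2_pexp p \<subseteq> {..<length (take i ss)}"
      "coeff P j = peval id (\<lambda>k. take i ss ! k) p" using adjoins_pexp[OF R(1)] by blast
    have "peval id (\<lambda>k. take i ss ! k) p = peval id (\<lambda>k. ss ! k) p"
      using p(2) by (intro peval_cong) auto
    thus ?thesis using p i(1) by (intro exI[of _ p]) auto
  qed
  then obtain g where g: "\<And>j. set1_pexp (g j) \<subseteq> R" "\<And>j. set2_pexp (g j) \<subseteq> {..<i}"
    "\<And>j. coeff P j = peval id (\<lambda>i. ss ! i) (g j)" by metis
  define n where "n = Suc (degree P)"
  define p where "p = psum (\<lambda>j. Mul (g j) (pprod (\<lambda>_. Var i) j)) n"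
  have ev: "peval id \<rho> p = (\<Sum>j<n. peval id \<rho> (g j) * \<rho> i ^ j)" for \<rho> :: "nat \<Rightarrow> 'a"
    by (simp add: p_def peval_psum peval_pprod)
  have 1: "set1_pexp p \<subseteq> R" using g(1) is_subringD[OF R(1)] by (auto simp: p_def set_psum set_pprod)
  have "set2_pexp (g j) \<subseteq> {..<length ss}" for j
    using g(2)[of j] i(1) by (meson lessThan_subset_iff less_imp_le subset_trans)
  hence 2: "set2_pexp p \<subseteq> {..<length ss}" using i(1) by (auto simp: p_def set_psum set_pprod split: if_splits)
  have 3: "peval id (\<lambda>i. ss ! i) p = 0"
    using P(3) by (simp add: ev poly_altdef g(3)[symmetric] n_def lessThan_Suc_atMost)
  obtain j where j: "coeff P j \<noteq> 0" "j < n" using P(1) by (intro that[of "degree P"]) (simp_all add: n_def)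
  obtain \<rho> where \<rho>: "\<And>v. \<rho> v \<in> R" "peval id \<rho> (g j) \<noteq> 0"
    using peval_vanish[OF R(2), of id "g j" "\<lambda>i. ss ! i"] j(1) g(3)[of j] by metis
  define Q where "Q = (\<Sum>j<n. monom (peval id \<rho> (g j)) j)"
  have "coeff Q j \<noteq> 0" using j \<rho> by (simp add: Q_def coeff_sum if_distrib cong: if_cong)
  hence "finite {t. poly Q t = 0}" by (intro poly_roots_finite) auto
  then obtain t where t: "t \<in> R" "poly Q t \<noteq> 0"
    using R(2) finite_subset[of R "{t. poly Q t = 0}"] by auto
  have "peval id (\<rho>(i := t)) p = poly Q t"
    unfolding ev Q_def poly_sum poly_monom
  proof (intro sum.cong refl)
    fix j
    have "peval id (\<rho>(i := t)) (g j) = peval id \<rho> (g j)" using g(2)[of j] by (intro peval_cong) auto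
    thus "peval id (\<rho>(i := t)) (g j) * (\<rho>(i := t)) i ^ j = peval id \<rho> (g j) * t ^ j" by simp
  qed
  hence "peval id (\<rho>(i := t)) p \<noteq> 0" "\<forall>v. (\<rho>(i := t)) v \<in> R" using t \<rho> by auto
  thus ?thesis using 1 2 3 by blast
qed

text \<open>The linear change of coordinates available over an infinite field. For a direction
  \<open>l\<close> on which the top form is nonzero, the generators are written as
  \<open>a v + t * l v\<close>; the relation becomes an equation for \<open>t\<close> over the
  \<open>a v\<close> whose leading coefficient is a unit of \<open>R\<close>.\<close>

lemma noether_step:
  fixes R :: "'a::field_char_0 set"
  assumes R: "is_subring R" "\<And>x. x \<in> R \<Longrightarrow> inverse x \<in> R" "infinite R" and dep: "\<not> indep_over R ss"
  shows "\<exists>ts. length ts < length ss \<and> adjoins R ts \<subseteq> adjoins R ss \<and> fin_module (adjoins R ts) (adjoins R ss)"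
proof -
  let ?s = "\<lambda>i. ss ! i"
  obtain p \<rho> where p: "set1_pexp p \<subseteq> R" "set2_pexp p \<subseteq> {..<length ss}" "peval id ?s p = 0"
    and \<rho>: "\<forall>v. \<rho> v \<in> R" "peval id \<rho> p \<noteq> 0"
    using dependence_relation[OF R(1,3) dep] by blast
  \<comment> \<open>The degrees in which the relation has a form not vanishing on
    \<open>R\<close>-points; the syntactic bound \<open>tdeg\<close> need not be attained.\<close>
  define I where "I = {i. i \<le> tdeg p \<and> (\<exists>l. (\<forall>v. l v \<in> R) \<and> hcomp p i l \<noteq> 0)}"
  have "\<exists>i\<le>tdeg p. hcomp p i \<rho> \<noteq> 0" using \<rho>(2) unfolding peval_sum_hcomp by (auto dest: sum.not_neutral_contains_not_neutral)
  hence I: "I \<noteq> {}" "finite I" using \<rho>(1) unfolding I_def by auto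
  define D where "D = Max I"
  have "D \<in> I" unfolding D_def using I by (intro Max_in)
  then obtain l where l: "\<And>v. l v \<in> R" "hcomp p D l \<noteq> 0" by (auto simp: I_def)
  have top: "hcomp p i x = 0" if "i > D" for i x
  proof (rule hcomp_vanish[OF R(3)])
    fix y :: "nat \<Rightarrow> 'a" assume y: "\<And>v. y v \<in> R"
    show "hcomp p i y = 0"
    proof (cases "i \<le> tdeg p")
      case True
      have "i \<notin> I" using \<open>i > D\<close> Max_ge[OF I(2), of i] unfolding D_def by auto
      thus ?thesis using True y unfolding I_def by blast
    next
      case False
      thus ?thesis unfolding hcomp_def using degree_peval_le[of "\<lambda>c. c" y p] by (intro coeff_eq_0) simp
    qed
  qed
  note line = line_restriction[of D p, OF top]
  \<comment> \<open>If \<open>l\<close> vanished on all variables, the restriction would be the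
    constant value of \<open>p\<close> at \<open>ss\<close>, which is zero, whereas its coefficient
    at \<open>D\<close> is the nonzero top form.\<close>
  have "\<exists>k<length ss. l k \<noteq> 0"
  proof (rule ccontr)
    assume "\<not> ?thesis"
    hence l0: "hcomp p D l = hcomp p D (\<lambda>_. 0)" using p(2) by (intro hcomp_cong) auto
    let ?Q = "peval (\<lambda>c. [:c:]) (\<lambda>v. [:?s v, 0:]) p"
    have "poly ?Q t = 0" for t using line(3)[of ?s "\<lambda>_. 0" t] p(3) by simp
    hence "?Q = 0" by (intro poly_eq_poly_eq_iff[THEN iffD1] ext) (simp only: poly_0)
    thus False using line(2)[of ?s "\<lambda>_. 0"] l0 l(2) by (metis coeff_0)
  qed
  then obtain k where k: "k < length ss" "l k \<noteq> 0" by blast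
  \<comment> \<open>This choice makes \<open>a k\<close> zero, which is how one generator
    disappears.\<close>
  define t where "t = ?s k / l k"
  define a where "a v = ?s v - t * l v" for v
  have ak: "a k = 0" using k by (simp add: a_def t_def)
  define ts where "ts = map a (filter (\<lambda>v. v \<noteq> k) [0..<length ss])"
  let ?S = "adjoins R ss" and ?T = "adjoins R ts"
  note S = is_subring_adjoins[OF R(1), of ss] and T = is_subring_adjoins[OF R(1), of ts]
  note RS = adjoins_base[OF R(1), of ss] and RT = adjoins_base[OF R(1), of ts]
  have sS: "?s v \<in> ?S" if "v < length ss" for v using adjoins_gen[OF R(1), of "?s v" ss] that by simp
  have tS: "t \<in> ?S"
    unfolding t_def divide_inverse using sS[OF k(1)] R(2)[OF l(1)[of k]] RS by (intro is_subringD(4)[OF S]) auto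
  have aS: "a v \<in> ?S" if "v < length ss" for v
  proof -
    have "l v \<in> ?S" using l(1) RS by blast
    thus ?thesis unfolding a_def using sS[OF that] tS by (intro is_subringD(4,6)[OF S])
  qed
  have aT: "a v \<in> ?T" if "v < length ss" for v
  proof (cases "v = k")
    case True
    thus ?thesis using ak is_subringD(2)[OF T] by simp
  next
    case False
    thus ?thesis using that by (intro adjoins_gen[OF R(1)]) (auto simp: ts_def)
  qed
  have len: "length ts < length ss"
    unfolding ts_def using k(1) length_filter_less[of k "[0..<length ss]" "\<lambda>v. v \<noteq> k"] by simp
  have TS: "?T \<subseteq> ?S" using aS by (intro adjoins_least[OF S RS]) (auto simp: ts_def)
  let ?Q = "peval (\<lambda>c. [:c:]) (\<lambda>v. [:a v, l v:]) p"
  have QT: "poly_over ?T ?Q"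
  proof -
    have "?Q \<in> {q. poly_over ?T q}"
      using p(1,2) aT l(1) RT by (intro peval_in_subring is_subring_poly_over[OF T]) (auto simp: poly_over_pCons_iff T)
    thus ?thesis by simp
  qed
  have Qt: "poly ?Q t = 0"
  proof -
    have "peval id (\<lambda>v. a v + t * l v) p = peval id ?s p" by (simp add: a_def)
    thus ?thesis using line(3)[of a l t] p(3) by simp
  qed
  have lcQ: "lead_coeff ?Q = hcomp p D l"
  proof -
    have "degree ?Q = D" using line(1,2)[of a l] l(2) by (intro antisym le_degree) auto
    thus ?thesis using line(2)[of a l] by simp
  qed
  have "hcomp p D l \<in> R"
  proof -
    have "peval (\<lambda>c. [:c:]) (\<lambda>v. [:0, l v:]) p \<in> {q. poly_over R q}"
      using p(1) l(1) R(1) is_subringD[OF R(1)]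
      by (intro peval_in_subring is_subring_poly_over) (auto simp: poly_over_pCons_iff)
    thus ?thesis by (simp add: hcomp_def poly_over_def)
  qed
  hence inv: "inverse (hcomp p D l) \<in> ?T" using R(2) RT by blast
  have "integral_over ?T t"
    unfolding integral_over_def
    by (intro exI[of _ "smult (inverse (hcomp p D l)) ?Q"] conjI poly_over_arith(6)[OF T inv QT])
       (use Qt lcQ l(2) in simp_all)
  hence "fin_module ?T (adjoin ?T t)" by (rule fin_module_adjoin[OF T])
  moreover have "adjoin ?T t = ?S"
  proof
    show "adjoin ?T t \<subseteq> ?S" by (rule adjoin_least[OF S TS tS])
    note S' = is_subring_adjoin[OF T, of t]
    have "?s v \<in> adjoin ?T t" if "v < length ss" for v
    proof -
      have "a v \<in> adjoin ?T t" "l v \<in> adjoin ?T t" "t \<in> adjoin ?T t"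
        using aT[OF that] adjoin_base[OF T, of t] adjoin_gen[OF T, of t] l(1)[of v] RT by blast+
      hence "a v + t * l v \<in> adjoin ?T t" by (intro is_subringD(3,4)[OF S'])
      thus ?thesis by (simp add: a_def)
    qed
    hence "set ss \<subseteq> adjoin ?T t" by (auto simp: in_set_conv_nth)
    moreover have "R \<subseteq> adjoin ?T t" using RT adjoin_base[OF T, of t] by blast
    ultimately show "?S \<subseteq> adjoin ?T t" by (intro adjoins_least[OF S'])
  qed
  ultimately show ?thesis using len TS by auto
qed

lemma noether_normalization:
  fixes R :: "'a::field_char_0 set"
  assumes R: "is_subring R" "\<And>x. x \<in> R \<Longrightarrow> inverse x \<in> R" "infinite R"
  shows "\<exists>ss. indep_over R ss \<and> adjoins R ss \<subseteq> adjoins R ys \<and> fin_module (adjoins R ss) (adjoins R ys)"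
proof -
  let ?A = "adjoins R ys"
  note A = is_subring_adjoins[OF R(1), of ys]
  let ?ok = "\<lambda>ss. adjoins R ss \<subseteq> ?A \<and> fin_module (adjoins R ss) ?A"
  have "?ok ys" using fin_module_refl[OF A] by simp
  then obtain ss where ss: "?ok ss" "\<And>ts. ?ok ts \<Longrightarrow> length ss \<le> length ts"
    using ex_has_least_nat[of ?ok ys length] by blast
  have "indep_over R ss"
  proof (rule ccontr)
    assume "\<not> ?thesis"
    then obtain ts where ts: "length ts < length ss" "adjoins R ts \<subseteq> adjoins R ss"
      "fin_module (adjoins R ts) (adjoins R ss)" using noether_step[OF R] by blast
    have "fin_module (adjoins R ts) ?A" using fin_module_trans[OF A _ ts(3)] ss(1) by blast
    thus False using ss(2)[of ts] ts ss(1) by auto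
  qed
  thus ?thesis using ss(1) by blast
qed

subsection \<open>Curve selection\<close>

lemma hom_on_eq_adjoins:
  assumes R: "is_subring R" and f: "hom_on (adjoins R zs) f" and g: "hom_on (adjoins R zs) g"
    and eq: "\<And>a. a \<in> R \<Longrightarrow> f a = g a" "\<And>z. z \<in> set zs \<Longrightarrow> f z = g z" and a: "a \<in> adjoins R zs"
  shows "f a = g a"
proof -
  let ?A = "adjoins R zs"
  note A = is_subring_adjoins[OF R, of zs]
  have "is_subring {a \<in> ?A. f a = g a}"
    unfolding is_subring_def
    by (auto simp: hom_onD[OF f] hom_onD[OF g] hom_on_more[OF f A] hom_on_more[OF g A] is_subringD[OF A])
  moreover have "R \<subseteq> {a \<in> ?A. f a = g a}" using adjoins_base[OF R, of zs] eq by auto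
  moreover have "set zs \<subseteq> {a \<in> ?A. f a = g a}" using adjoins_gen[OF R] eq by auto
  ultimately have "?A \<subseteq> {a \<in> ?A. f a = g a}" by (rule adjoins_least)
  thus ?thesis using a by blast
qed

lemma compl_int_closed_adjoins:
  fixes R :: "'a::field set"
  shows "is_subring R \<Longrightarrow> compl_int_closed R \<Longrightarrow> indep_over R ss \<Longrightarrow> compl_int_closed (adjoins R ss)"
  by (induction ss arbitrary: R) (auto intro: compl_int_closed_adjoin is_subring_adjoin)

lemma map_poly_nonzero:
  assumes "h 0 = 0" "h (lead_coeff P) \<noteq> 0"
  shows "map_poly h P \<noteq> 0" "degree (map_poly h P) = degree P"
proof -
  have c: "coeff (map_poly h P) (degree P) \<noteq> 0" using assms by (simp add: coeff_map_poly)
  thus "map_poly h P \<noteq> 0" by auto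
  show "degree (map_poly h P) = degree P"
    by (rule antisym[OF map_poly_degree_leq le_degree[OF c]])
qed

text \<open>Each variable is sent to its value plus a generic multiple of the uniformizer.\<close>
lemma generic_deformation:
  fixes q :: "'e::idom \<Rightarrow> 'k::field_char_0"
  shows "is_subring R \<Longrightarrow> indep_over R ss \<Longrightarrow> hom_on (adjoins R ss) q \<Longrightarrow> g \<in> adjoins R ss \<Longrightarrow> g \<noteq> 0 \<Longrightarrow>
    \<exists>c\<in>R. c \<noteq> 0 \<and> (\<forall>j. hom_on R j \<and> (\<forall>a\<in>R. j a \<in> fls_int \<and> fls_nth (j a) 0 = q a) \<and> j c \<noteq> 0 \<longrightarrow>
      (\<exists>j'. hom_on (adjoins R ss) j' \<and> (\<forall>a\<in>R. j' a = j a) \<and>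
        (\<forall>a\<in>adjoins R ss. j' a \<in> fls_int \<and> fls_nth (j' a) 0 = q a) \<and> j' g \<noteq> 0))"
proof (induction ss arbitrary: R)
  case Nil
  thus ?case by (intro bexI[of _ g]) auto
next
  case (Cons s ss)
  let ?S = "adjoin R s"
  note R = Cons.prems(1) and S = is_subring_adjoin[OF Cons.prems(1), of s]
  have tr: "\<not> algebraic_over R s" and ind: "indep_over ?S ss" using Cons.prems(2) by auto
  have q: "hom_on (adjoins ?S ss) q" using Cons.prems(3) by simp
  have qS: "hom_on ?S q" using hom_on_subset[OF q adjoins_base[OF S]] .
  have g: "g \<in> adjoins ?S ss" using Cons.prems(4) by simp
  obtain c' where c': "c' \<in> ?S" "c' \<noteq> 0" and ext: "\<And>j. hom_on ?S j \<Longrightarrow>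
      (\<forall>a\<in>?S. j a \<in> fls_int \<and> fls_nth (j a) 0 = q a) \<Longrightarrow> j c' \<noteq> 0 \<Longrightarrow>
      (\<exists>j'. hom_on (adjoins ?S ss) j' \<and> (\<forall>a\<in>?S. j' a = j a) \<and>
        (\<forall>a\<in>adjoins ?S ss. j' a \<in> fls_int \<and> fls_nth (j' a) 0 = q a) \<and> j' g \<noteq> 0)"
    using Cons.IH[OF S ind q g Cons.prems(5)] by blast
  obtain P where P: "poly_over R P" "c' = poly P s" using c' by (auto simp: adjoin_def)
  have P0: "P \<noteq> 0" using P c' by auto
  \<comment> \<open>The leading coefficient is the condition passed down the tower: if
    \<open>j\<close> does not kill it, \<open>map_poly j P\<close> has finitely many roots and some
    slope \<open>u\<close> avoids them.\<close>
  have lP: "lead_coeff P \<in> R" "lead_coeff P \<noteq> 0" using P P0 by (auto simp: poly_over_def)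
  show ?case
  proof (rule bexI[OF _ lP(1)], intro conjI allI impI, rule lP(2))
    fix j :: "'e \<Rightarrow> 'k fls"
    assume "hom_on R j \<and> (\<forall>a\<in>R. j a \<in> fls_int \<and> fls_nth (j a) 0 = q a) \<and> j (lead_coeff P) \<noteq> 0"
    hence j: "hom_on R j" "\<forall>a\<in>R. j a \<in> fls_int \<and> fls_nth (j a) 0 = q a" "j (lead_coeff P) \<noteq> 0" by auto
    have jP: "map_poly j P \<noteq> 0" using map_poly_nonzero(1)[OF hom_onD(1)[OF j(1)] j(3)] .
    define W where "W u = fps_to_fls (fps_const (q s) + fps_const u * fps_X)" for u
    have W: "W u \<in> fls_int" "fls_nth (W u) 0 = q s" for u
      unfolding W_def fls_int_def by (rule rangeI) simp
    have "inj W"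
    proof (rule injI)
      fix u v assume "W u = W v"
      hence "fps_const (q s) + fps_const u * fps_X = fps_const (q s) + fps_const v * fps_X"
        unfolding W_def fps_to_fls_eq_iff .
      from arg_cong[OF this, of "\<lambda>f. fps_nth f 1"] show "u = v" by simp
    qed
    hence "infinite (range W)" using finite_imageD infinite_UNIV_char_0 by blast
    moreover have "finite {w. poly (map_poly j P) w = 0}" using jP by (rule poly_roots_finite)
    ultimately have "\<not> range W \<subseteq> {w. poly (map_poly j P) w = 0}" using finite_subset by blast
    then obtain u where u: "poly (map_poly j P) (W u) \<noteq> 0" by auto
    obtain j1 where j1: "hom_on ?S j1" "\<forall>a\<in>R. j1 a = j a" "j1 s = W u"
      "\<And>p. poly_over R p \<Longrightarrow> j1 (poly p s) = poly (map_poly j p) (W u)"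
      using hom_on_adjoin_transcendental[OF R tr j(1), of "W u"] by blast
    have res: "j1 a \<in> fls_int \<and> fls_nth (j1 a) 0 = q a" if a: "a \<in> ?S" for a
    proof -
      obtain p where p: "poly_over R p" "a = poly p s" using a by (auto simp: adjoin_def)
      have jp: "poly_over fls_int (map_poly j p)"
        using p(1) j(2) by (auto simp: poly_over_def coeff_map_poly hom_onD(1)[OF j(1)])
      have "fls_nth (poly (map_poly j p) (W u)) 0 = poly (map_poly (\<lambda>f. fls_nth f 0) (map_poly j p)) (fls_nth (W u) 0)"
        using poly_map_poly_hom_on[OF hom_on_residue is_subring_fls_int jp W(1)[of u]] by simp
      also have "map_poly (\<lambda>f. fls_nth f 0) (map_poly j p) = map_poly q p"
      proof (rule poly_eqI)
        fix i show "coeff (map_poly (\<lambda>f. fls_nth f 0) (map_poly j p)) i = coeff (map_poly q p) i"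
          using p(1) j(2) by (simp add: coeff_map_poly hom_onD(1)[OF j(1)] hom_onD(1)[OF q] poly_over_def)
      qed
      also have "poly (map_poly q p) (fls_nth (W u) 0) = q a"
        unfolding W(2) p(2)
        by (rule poly_map_poly_hom_on[OF qS S poly_over_mono[OF p(1) adjoin_base[OF R]] adjoin_gen[OF R]])
      finally show ?thesis
        using j1(4)[OF p(1)] p(2) poly_in_subring[OF is_subring_fls_int jp W(1)[of u]] by simp
    qed
    have "j1 c' \<noteq> 0" using j1(4)[OF P(1)] P(2) u by simp
    with ext[OF j1(1)] res obtain j' where j': "hom_on (adjoins ?S ss) j'" "\<forall>a\<in>?S. j' a = j1 a"
      "\<forall>a\<in>adjoins ?S ss. j' a \<in> fls_int \<and> fls_nth (j' a) 0 = q a" "j' g \<noteq> 0" by blast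
    moreover have "\<forall>a\<in>R. j' a = j a" using j'(2) j1(2) adjoin_base[OF R, of s] by auto
    ultimately show "\<exists>j'. hom_on (adjoins R (s # ss)) j' \<and> (\<forall>a\<in>R. j' a = j a) \<and>
        (\<forall>a\<in>adjoins R (s # ss). j' a \<in> fls_int \<and> fls_nth (j' a) 0 = q a) \<and> j' g \<noteq> 0"
      by (intro exI[of _ j']) simp
  qed
qed

text \<open>The exponent \<open>e\<close> records the ramification introduced by adjoining algebraic elements.\<close>
lemma extension_to_adjoins:
  shows "is_subring R \<Longrightarrow> g \<in> adjoins R xs \<Longrightarrow> g \<noteq> 0 \<Longrightarrow>
    \<exists>c\<in>R. c \<noteq> 0 \<and> (\<forall>h :: 'e::idom \<Rightarrow> 'k::{alg_closed_field, field_char_0} fls. hom_on R h \<and> h c \<noteq> 0 \<longrightarrow>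
      (\<exists>e>0. \<exists>h'. hom_on (adjoins R xs) h' \<and> (\<forall>a\<in>R. h' a = cpow e (h a)) \<and> h' g \<noteq> 0))"
proof (induction xs arbitrary: R)
  case Nil
  show ?case
  proof (rule bexI[of _ g], intro conjI allI impI)
    fix h :: "'e \<Rightarrow> 'k fls" assume "hom_on R h \<and> h g \<noteq> 0"
    thus "\<exists>e>0. \<exists>h'. hom_on (adjoins R []) h' \<and> (\<forall>a\<in>R. h' a = cpow e (h a)) \<and> h' g \<noteq> 0"
      by (intro exI[of _ 1] conjI exI[of _ h]) (auto intro!: fls_eqI simp: fls_nth_compose_power)
  qed (use Nil in auto)
next
  case (Cons x xs)
  let ?S = "adjoin R x"
  note R = Cons.prems(1) and S = is_subring_adjoin[OF Cons.prems(1), of x]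
  have "g \<in> adjoins ?S xs" using Cons.prems(2) by simp
  from Cons.IH[OF S this Cons.prems(3)] obtain c' where c': "c' \<in> ?S" "c' \<noteq> 0" and
    ext: "\<And>h :: 'e \<Rightarrow> 'k fls. hom_on ?S h \<Longrightarrow> h c' \<noteq> 0 \<Longrightarrow>
      \<exists>e>0. \<exists>h'. hom_on (adjoins ?S xs) h' \<and> (\<forall>a\<in>?S. h' a = cpow e (h a)) \<and> h' g \<noteq> 0" by blast
  have finish: "\<exists>e>0. \<exists>h'. hom_on (adjoins R (x # xs)) h' \<and> (\<forall>a\<in>R. h' a = cpow e (h a)) \<and> h' g \<noteq> 0"
    if h1: "hom_on ?S h1" "h1 c' \<noteq> 0" "\<forall>a\<in>R. h1 a = cpow e (h a)" "e > 0" for h h1 :: "'e \<Rightarrow> 'k fls" and e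
  proof -
    obtain e' h' where h': "e' > 0" "hom_on (adjoins ?S xs) h'" "\<forall>a\<in>?S. h' a = cpow e' (h1 a)" "h' g \<noteq> 0"
      using ext[OF h1(1,2)] by blast
    have "h' a = cpow (e * e') (h a)" if "a \<in> R" for a
      using that h'(1,3) h1(3,4) adjoin_base[OF R, of x] by (auto simp: cpow_cpow)
    thus ?thesis using h' h1(4) by (intro exI[of _ "e * e'"] conjI exI[of _ h']) auto
  qed
  show ?case
  proof (cases "algebraic_over R x")
    case True
    then obtain f where f: "is_minpoly R x f" using ex_minpoly by blast
    have fR: "poly_over R f" "f \<noteq> 0" using f by (auto simp: is_minpoly_def)
    obtain b where b: "b \<in> ?S" "c' * b \<in> R" "c' * b \<noteq> 0" using adjoin_nonzero_dvd_base[OF R f c'] by blast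
    \<comment> \<open>The first factor must survive for the extension to \<open>x\<close> to exist,
      the second for the image of \<open>c'\<close> to be nonzero afterwards.\<close>
    let ?c = "lead_coeff f * (c' * b)"
    have lf: "lead_coeff f \<in> R" using fR by (simp add: poly_over_def)
    show ?thesis
    proof (rule bexI[of _ ?c], intro conjI allI impI)
      show "?c \<in> R" by (rule is_subringD(4)[OF R lf b(2)])
      show "?c \<noteq> 0" using b fR by simp
      fix h :: "'e \<Rightarrow> 'k fls" assume "hom_on R h \<and> h ?c \<noteq> 0"
      hence h: "hom_on R h" "h (lead_coeff f) \<noteq> 0" "h (c' * b) \<noteq> 0"
        using hom_onD(4)[of R h, OF _ lf b(2)] by auto
      have "degree (map_poly h f) > 0"
        using map_poly_nonzero(2)[of h f, OF hom_onD(1)[OF h(1)] h(2)] minpoly_degree_pos[OF f] by simp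
      then obtain e w where e: "e > 0" "poly (map_poly (cpow e) (map_poly h f)) w = 0"
        using puiseux_root by blast
      let ?h = "\<lambda>a. cpow e (h a)"
      have h1: "hom_on R ?h" by (rule hom_on_comp[OF h(1) hom_on_cpow[OF e(1), of UNIV]]) simp
      have "map_poly (cpow e) (map_poly h f) = map_poly ?h f"
        by (rule poly_eqI) (simp add: coeff_map_poly hom_onD(1)[OF h(1)])
      hence w: "poly (map_poly ?h f) w = 0" using e(2) by simp
      have "?h (lead_coeff f) \<noteq> 0" using h(2) e(1) by (simp add: cpow_eq_0_iff)
      from hom_on_adjoin_algebraic[OF R f h1 this w] obtain h2 where
        h2: "hom_on ?S h2" "\<forall>a\<in>R. h2 a = ?h a" by blast
      have "h2 c' * h2 b = ?h (c' * b)" using hom_onD(4)[OF h2(1) c'(1) b(1)] h2(2) b(2) by simp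
      hence "h2 c' \<noteq> 0" using h(3) e(1) by (auto simp: cpow_eq_0_iff)
      thus "\<exists>e>0. \<exists>h'. hom_on (adjoins R (x # xs)) h' \<and> (\<forall>a\<in>R. h' a = cpow e (h a)) \<and> h' g \<noteq> 0"
        using finish[OF h2(1) _ h2(2) e(1)] by blast
    qed
  next
    case False
    obtain P where P: "poly_over R P" "c' = poly P x" using c' by (auto simp: adjoin_def)
    have P0: "P \<noteq> 0" using P c' by auto
    have lP: "lead_coeff P \<in> R" "lead_coeff P \<noteq> 0" using P P0 by (auto simp: poly_over_def)
    show ?thesis
    proof (rule bexI[OF _ lP(1)], intro conjI allI impI, rule lP(2))
      fix h :: "'e \<Rightarrow> 'k fls" assume "hom_on R h \<and> h (lead_coeff P) \<noteq> 0"
      hence h: "hom_on R h" "h (lead_coeff P) \<noteq> 0" by auto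
      have "map_poly h P \<noteq> 0" using map_poly_nonzero(1)[of h P, OF hom_onD(1)[OF h(1)] h(2)] .
      hence "finite {w. poly (map_poly h P) w = 0}" by (rule poly_roots_finite)
      hence "{w. poly (map_poly h P) w = 0} \<noteq> UNIV" using infinite_UNIV_char_0 by metis
      then obtain w where w: "poly (map_poly h P) w \<noteq> 0" by auto
      obtain h2 where h2: "hom_on ?S h2" "\<forall>a\<in>R. h2 a = h a"
        "\<And>p. poly_over R p \<Longrightarrow> h2 (poly p x) = poly (map_poly h p) w"
        using hom_on_adjoin_transcendental[OF R False h(1), of w] by blast
      have "h2 c' \<noteq> 0" using h2(3)[OF P(1)] P(2) w by simp
      moreover have "\<forall>a\<in>R. h2 a = cpow 1 (h a)"
        using h2(2) by (auto intro!: fls_eqI simp: fls_nth_compose_power)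
      ultimately show "\<exists>e>0. \<exists>h'. hom_on (adjoins R (x # xs)) h' \<and> (\<forall>a\<in>R. h' a = cpow e (h a)) \<and> h' g \<noteq> 0"
        by (rule finish[OF h2(1), where e = 1]) simp
    qed
  qed
qed

text \<open>For each competitor \<open>\<rho>\<close> in the finite product of the
  \<open>Z i\<close>, the difference of the two sums is a nonzero polynomial in \<open>t\<close>; so
  all but finitely many \<open>t\<close> separate \<open>y\<close> from the whole fibre.\<close>

lemma separating_combination:
  fixes y :: "nat \<Rightarrow> 'k::field"
  assumes R: "infinite R" and Z: "\<And>i. i < n \<Longrightarrow> finite (Z i)"
  shows "\<exists>t\<in>R. \<forall>\<rho>. (\<forall>i<n. \<rho> i \<in> Z i) \<longrightarrow> (\<Sum>i<n. t ^ i * \<rho> i) = (\<Sum>i<n. t ^ i * y i) \<longrightarrow> (\<forall>i<n. \<rho> i = y i)"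
proof -
  define T where "T = {\<rho> \<in> (\<Pi>\<^sub>E i\<in>{..<n}. Z i). \<exists>i<n. \<rho> i \<noteq> y i}"
  have T: "finite T" unfolding T_def by (rule finite_subset[OF Collect_restrict finite_PiE]) (use Z in auto)
  define Q where "Q \<rho> = (\<Sum>i<n. monom (\<rho> i - y i) i)" for \<rho>
  have Q0: "Q \<rho> \<noteq> 0" if \<rho>: "\<rho> \<in> T" for \<rho>
  proof -
    obtain i where i: "i < n" "\<rho> i \<noteq> y i" using \<rho> by (auto simp: T_def)
    hence "coeff (Q \<rho>) i \<noteq> 0" by (simp add: Q_def coeff_sum if_distrib cong: if_cong)
    thus ?thesis by auto
  qed
  have "finite (\<Union>\<rho>\<in>T. {t. poly (Q \<rho>) t = 0})" using T Q0 by (intro finite_UN_I poly_roots_finite)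
  hence "\<not> R \<subseteq> (\<Union>\<rho>\<in>T. {t. poly (Q \<rho>) t = 0})" using R finite_subset by blast
  then obtain t where t: "t \<in> R" "\<And>\<rho>. \<rho> \<in> T \<Longrightarrow> poly (Q \<rho>) t \<noteq> 0" by blast
  have "\<forall>i<n. \<rho> i = y i"
    if \<rho>: "\<forall>i<n. \<rho> i \<in> Z i" "(\<Sum>i<n. t ^ i * \<rho> i) = (\<Sum>i<n. t ^ i * y i)" for \<rho>
  proof (rule ccontr)
    assume no: "\<not> (\<forall>i<n. \<rho> i = y i)"
    let ?\<rho> = "restrict \<rho> {..<n}"
    have "?\<rho> \<in> T" using \<rho>(1) no unfolding T_def by auto
    moreover have "poly (Q ?\<rho>) t = 0"
      using \<rho>(2) by (simp add: Q_def poly_sum poly_monom algebra_simps sum_subtractf)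
    ultimately show False using t(2) by blast
  qed
  thus ?thesis using t(1) by blast
qed

lemma integral_image_root:
  assumes "hom_on S h" "is_subring S" "R \<subseteq> S" "poly_over R F" "poly F a = 0" "a \<in> S"
  shows "poly (map_poly h F) (h a) = 0"
  using poly_map_poly_hom_on[OF assms(1,2) poly_over_mono[OF assms(4,3)] assms(6)] assms(5) hom_onD(1)[OF assms(1)]
  by simp

text \<open>Here \<open>q\<close> is a point of the ring generated by \<open>ys\<close>, and
  \<open>J\<close> is a curve through it, generic enough to be defined on the further elements
  \<open>xs\<close>, possibly with poles. The residue of a lifted curve could be another point of
  the same finite fibre over \<open>?B\<close>; the element \<open>z\<close>, whose residue is
  prescribed, excludes this.\<close>

theorem curve_selection:
  fixes R :: "'e::{alg_closed_field, field_char_0} set" and q :: "'e \<Rightarrow> 'k::{alg_closed_field, field_char_0}"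
  assumes R: "is_subring R" "\<And>x. x \<in> R \<Longrightarrow> inverse x \<in> R" "infinite R"
    and q: "hom_on (adjoins R ys) q"
  shows "\<exists>J. hom_on (adjoins R (ys @ xs)) J \<and>
    (\<forall>a\<in>adjoins R ys. J a \<in> fls_int \<and> fls_nth (J a) 0 = q a)"
proof -
  let ?A = "adjoins R ys"
  note A = is_subring_adjoins[OF R(1), of ys]
  obtain ss where ss: "indep_over R ss" "adjoins R ss \<subseteq> ?A" "fin_module (adjoins R ss) ?A"
    using noether_normalization[OF R] by blast
  let ?B = "adjoins R ss"
  note B = is_subring_adjoins[OF R(1), of ss] and RB = adjoins_base[OF R(1), of ss]
    and RA = adjoins_base[OF R(1), of ys]
  note int = fin_module_integral[OF B A ss(3)]
  have cic: "compl_int_closed ?B" using compl_int_closed_adjoins[OF R(1) compl_int_closed_subfield[OF R(1,2)] ss(1)] .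
  have qB: "hom_on ?B q" using hom_on_subset[OF q ss(2)] .
  define n where "n = length ys"
  have yA: "ys ! i \<in> ?A" if "i < n" for i using adjoins_gen[OF R(1), of "ys ! i" ys] that by (simp add: n_def)
  have "\<exists>F. lead_coeff F = 1 \<and> poly_over ?B F \<and> poly F (ys ! i) = 0" if "i < n" for i
    using int[OF yA[OF that]] by (auto simp: integral_over_def)
  then obtain F where F: "\<And>i. i < n \<Longrightarrow> lead_coeff (F i) = 1" "\<And>i. i < n \<Longrightarrow> poly_over ?B (F i)"
    "\<And>i. i < n \<Longrightarrow> poly (F i) (ys ! i) = 0" by metis
  \<comment> \<open>Contains the values at \<open>ys ! i\<close> of all points lying over the same
    point of \<open>?B\<close> as \<open>q\<close>.\<close>
  define Z where "Z i = {c. poly (map_poly q (F i)) c = 0}" for i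
  have Zfin: "finite (Z i)" if "i < n" for i
    unfolding Z_def using map_poly_nonzero(1)[of q "F i"] F(1)[OF that] hom_onD(1,2)[OF q]
    by (intro poly_roots_finite) auto
  have "inj_on q R"
  proof (rule inj_onI)
    fix a b assume ab: "a \<in> R" "b \<in> R" "q a = q b"
    have hR: "hom_on R q" using hom_on_subset[OF q RA] .
    have "a - b \<in> R" using ab is_subringD(6)[OF R(1)] by blast
    moreover have "q (a - b) = 0" using hom_on_more(2)[OF hR R(1) ab(1,2)] ab(3) by simp
    ultimately have "q ((a - b) * inverse (a - b)) = 0" using hom_onD(4)[OF hR _ R(2)] by simp
    thus "a = b" using hom_onD(2)[OF q] by (cases "a - b = 0") auto
  qed
  hence "infinite (q ` R)" using R(3) finite_imageD by blast
  hence "\<exists>t\<in>q ` R. \<forall>\<rho>. (\<forall>i<n. \<rho> i \<in> Z i) \<longrightarrow>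
     (\<Sum>i<n. t ^ i * \<rho> i) = (\<Sum>i<n. t ^ i * q (ys ! i)) \<longrightarrow> (\<forall>i<n. \<rho> i = q (ys ! i))"
    by (rule separating_combination[OF _ Zfin])
  then obtain t where t: "t \<in> R" and sep: "\<And>\<rho>. (\<forall>i<n. \<rho> i \<in> Z i) \<Longrightarrow>
     (\<Sum>i<n. q t ^ i * \<rho> i) = (\<Sum>i<n. q t ^ i * q (ys ! i)) \<Longrightarrow> (\<forall>i<n. \<rho> i = q (ys ! i))" by blast
  define z where "z = (\<Sum>i<n. t ^ i * ys ! i)"
  have tA: "t \<in> ?A" using t RA by blast
  have zA: "z \<in> ?A" unfolding z_def using yA tA by (intro subring_sum[OF A] is_subringD(4,7)[OF A]) auto
  have hz: "h z = (\<Sum>i<n. h t ^ i * h (ys ! i))" if h: "hom_on ?A h" for h :: "'e \<Rightarrow> 'k"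
  proof -
    have "h z = (\<Sum>i<n. h (t ^ i * ys ! i))"
      unfolding z_def using yA tA by (intro hom_on_sum[OF h A] is_subringD(4,7)[OF A]) auto
    also have "\<dots> = (\<Sum>i<n. h t ^ i * h (ys ! i))"
    proof (rule sum.cong[OF refl])
      fix i assume "i \<in> {..<n}"
      hence "h (t ^ i * ys ! i) = h (t ^ i) * h (ys ! i)"
        by (intro hom_onD(4)[OF h] is_subringD(7)[OF A tA] yA) simp
      thus "h (t ^ i * ys ! i) = h t ^ i * h (ys ! i)" using hom_on_more(3)[OF h A tA] by simp
    qed
    finally show ?thesis .
  qed
  \<comment> \<open>Because \<open>f\<close> is monic, its image under \<open>j\<close> stays monic,
    roots of that image are integral, and \<open>q z\<close> is a root of its reduction.\<close>
  obtain f where f: "is_minpoly ?B z f" "lead_coeff f = 1" using monic_minpoly[OF B cic int[OF zA]] by blast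
  have fB: "poly_over ?B f" "poly f z = 0" using f by (auto simp: is_minpoly_def)
  \<comment> \<open>\<open>z\<close> is adjoined before the generators so that its image can be
    prescribed; the other elements are then sent wherever the extension allows.\<close>
  let ?S = "adjoin ?B z" and ?T = "adjoins (adjoin ?B z) (ys @ xs)"
  note S = is_subring_adjoin[OF B, of z] and BS = adjoin_base[OF B, of z]
  note T = is_subring_adjoins[OF S, of "ys @ xs"] and ST = adjoins_base[OF S, of "ys @ xs"]
  have "\<exists>c\<in>?S. c \<noteq> 0 \<and> (\<forall>h :: 'e \<Rightarrow> 'k fls. hom_on ?S h \<and> h c \<noteq> 0 \<longrightarrow>
      (\<exists>e>0. \<exists>h'. hom_on ?T h' \<and> (\<forall>a\<in>?S. h' a = cpow e (h a)) \<and> h' 1 \<noteq> 0))"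
    by (rule extension_to_adjoins[OF S is_subringD(1)[OF T] one_neq_zero])
  then obtain c where c: "c \<in> ?S" "c \<noteq> 0" and ext: "\<And>h :: 'e \<Rightarrow> 'k fls. hom_on ?S h \<Longrightarrow> h c \<noteq> 0 \<Longrightarrow>
      \<exists>e>0. \<exists>h'. hom_on ?T h' \<and> (\<forall>a\<in>?S. h' a = cpow e (h a)) \<and> h' 1 \<noteq> 0"
    by (elim bexE conjE) simp
  obtain b where b: "b \<in> ?S" "c * b \<in> ?B" "c * b \<noteq> 0" using adjoin_nonzero_dvd_base[OF B f(1) c] by blast
  obtain c0 where c0: "c0 \<in> R" "c0 \<noteq> 0" and defm: "\<And>j. hom_on R j \<Longrightarrow>
      (\<forall>a\<in>R. j a \<in> fls_int \<and> fls_nth (j a) 0 = q a) \<Longrightarrow> j c0 \<noteq> 0 \<Longrightarrow>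
      (\<exists>j'. hom_on ?B j' \<and> (\<forall>a\<in>?B. j' a \<in> fls_int \<and> fls_nth (j' a) 0 = q a) \<and> j' (c * b) \<noteq> 0)"
    using generic_deformation[OF R(1) ss(1) qB b(2,3)] by blast
  \<comment> \<open>On the ground field the curve is constant; the deformation begins with the
    generators \<open>ss\<close>.\<close>
  define j0 where "j0 = (\<lambda>a. fps_to_fls (fps_const (q a)))"
  have qR: "hom_on R q" using hom_on_subset[OF qB RB] .
  have "hom_on R j0"
    unfolding hom_on_def j0_def by (auto simp: hom_onD[OF qR] fls_plus_const)
  moreover have "\<forall>a\<in>R. j0 a \<in> fls_int \<and> fls_nth (j0 a) 0 = q a"
    unfolding j0_def fls_int_def by (intro ballI conjI rangeI) simp
  moreover have "j0 c0 \<noteq> 0"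
  proof
    assume "j0 c0 = 0"
    hence "q c0 = q 0" using hom_onD(1)[OF q] by (simp add: j0_def)
    thus False using \<open>inj_on q R\<close> c0 is_subringD(2)[OF R(1)] by (auto dest: inj_onD)
  qed
  ultimately obtain j where j: "hom_on ?B j" "\<forall>a\<in>?B. j a \<in> fls_int \<and> fls_nth (j a) 0 = q a" "j (c * b) \<noteq> 0"
    using defm by blast
  let ?P = "map_poly j f"
  note j00 = hom_onD(1)[OF j(1)]
  have lP: "lead_coeff ?P = 1"
    using map_poly_nonzero(2)[of j f, OF j00] f(2) hom_onD(2)[OF j(1)] by (simp add: coeff_map_poly j00)
  have PO: "poly_over fls_int ?P" using fB(1) j(2) by (auto simp: poly_over_def coeff_map_poly j00)
  have "map_poly (\<lambda>f. fls_nth f 0) ?P = map_poly q f"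
  proof (rule poly_eqI)
    fix i show "coeff (map_poly (\<lambda>f. fls_nth f 0) ?P) i = coeff (map_poly q f) i"
      using fB(1) j(2) by (simp add: coeff_map_poly j00 hom_onD(1)[OF q] poly_over_def)
  qed
  moreover have "poly (map_poly q f) (q z) = 0" using integral_image_root[OF q A ss(2) fB zA] .
  ultimately have "poly (map_poly (\<lambda>f. fls_nth f 0) ?P) (q z) = 0" by simp
  from puiseux_root_residue[OF lP PO this] obtain e w where
    e: "e > 0" "w \<in> fls_int" "fls_nth w 0 = q z" "poly (map_poly (cpow e) ?P) w = 0" by blast
  let ?j = "\<lambda>a. cpow e (j a)"
  have j1: "hom_on ?B ?j" by (rule hom_on_comp[OF j(1) hom_on_cpow[OF e(1), of UNIV]]) simp
  have "map_poly (cpow e) ?P = map_poly ?j f" by (rule poly_eqI) (simp add: coeff_map_poly j00)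
  hence "poly (map_poly ?j f) w = 0" using e(4) by simp
  moreover have "?j (lead_coeff f) \<noteq> 0" using f(2) hom_onD(2)[OF j1] by simp
  ultimately obtain j2 where j2: "hom_on ?S j2" "\<forall>a\<in>?B. j2 a = ?j a" "j2 z = w"
    using hom_on_adjoin_algebraic[OF B f(1) j1] by blast
  have "j2 c * j2 b = ?j (c * b)" using hom_onD(4)[OF j2(1) c(1) b(1)] j2(2) b(2) by simp
  hence "j2 c \<noteq> 0" using j(3) e(1) by (auto simp: cpow_eq_0_iff)
  then obtain e' J where J: "e' > 0" "hom_on ?T J" "\<forall>a\<in>?S. J a = cpow e' (j2 a)" using ext[OF j2(1)] by blast
  have sub: "adjoins R (ys @ xs) \<subseteq> ?T"
    using RB BS ST adjoins_gen[OF S, of _ "ys @ xs"] by (intro adjoins_least[OF T]) blast+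
  have AT: "?A \<subseteq> ?T"
    using RB BS ST adjoins_gen[OF S, of _ "ys @ xs"] by (intro adjoins_least[OF T]) auto
  have JB: "J a \<in> fls_int \<and> fls_nth (J a) 0 = q a" if a: "a \<in> ?B" for a
  proof -
    have "J a = cpow e' (cpow e (j a))" using J(3) j2(2) BS a by auto
    thus ?thesis using j(2) a J(1) e(1) by (simp add: cpow_fls_int residue_cpow)
  qed
  have BT: "?B \<subseteq> ?T" using BS ST by blast
  \<comment> \<open>Elements of \<open>?A\<close> are integral over \<open>?B\<close>, whose images
    are power series, so they acquire no poles.\<close>
  have JA: "J a \<in> fls_int" if a: "a \<in> ?A" for a
  proof -
    obtain G where G: "lead_coeff G = 1" "poly_over ?B G" "poly G a = 0"
      using int[OF a] by (auto simp: integral_over_def)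
    note J00 = hom_onD(1,2)[OF J(2)]
    have "lead_coeff (map_poly J G) = 1"
      using map_poly_nonzero(2)[of J G, OF J00(1)] G(1) J00(2) by (simp add: coeff_map_poly J00(1))
    moreover have "poly_over fls_int (map_poly J G)"
      using G(2) JB by (auto simp: poly_over_def coeff_map_poly J00(1))
    moreover have "poly (map_poly J G) (J a) = 0"
      using integral_image_root[OF J(2) T BT G(2,3)] a AT by blast
    ultimately show ?thesis by (rule fls_int_integral)
  qed
  \<comment> \<open>The residue of \<open>J\<close> is a point over the same point of
    \<open>?B\<close> as \<open>q\<close> with the same value at \<open>z\<close>; the choice of
    \<open>t\<close> leaves only \<open>q\<close> itself.\<close>
  define r where "r a = fls_nth (J a) 0" for a
  have r: "hom_on ?A r"
    unfolding r_def using JA by (intro hom_on_comp[OF hom_on_subset[OF J(2) AT] hom_on_residue]) auto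
  have rB: "r a = q a" if "a \<in> ?B" for a using JB[OF that] by (simp add: r_def)
  have "r z = q z"
  proof -
    have "J z = cpow e' w" using J(3) j2(3) adjoin_gen[OF B, of z] by simp
    thus ?thesis using e(3) J(1) by (simp add: r_def residue_cpow)
  qed
  hence "(\<Sum>i<n. q t ^ i * r (ys ! i)) = (\<Sum>i<n. q t ^ i * q (ys ! i))"
    using hz[OF r] hz[OF q] rB[of t] t RB by auto
  moreover have "\<forall>i<n. r (ys ! i) \<in> Z i"
  proof (intro allI impI)
    fix i assume i: "i < n"
    have "poly (map_poly r (F i)) (r (ys ! i)) = 0" by (rule integral_image_root[OF r A ss(2) F(2,3)[OF i] yA[OF i]])
    moreover have "map_poly r (F i) = map_poly q (F i)" by (rule map_poly_cong_over[OF rB F(2)[OF i]])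
    ultimately show "r (ys ! i) \<in> Z i" by (simp add: Z_def)
  qed
  ultimately have ry: "\<forall>i<n. r (ys ! i) = q (ys ! i)" using sep[of "\<lambda>i. r (ys ! i)"] by blast
  have "r a = q a" if a: "a \<in> ?A" for a
  proof (rule hom_on_eq_adjoins[OF R(1) r q _ _ a])
    show "r y = q y" if "y \<in> set ys" for y using that ry by (auto simp: in_set_conv_nth n_def)
  qed (use rB RB in blast)
  thus ?thesis using hom_on_subset[OF J(2) sub] JA by (intro exI[of _ J]) (auto simp: r_def)
qed

subsection \<open>Generic points and derivations\<close>

text \<open>Over an infinite field polynomials can be identified with the functions they induce.
  This makes the polynomial ring in any set of variables a type, from which the fraction field and
  its algebraic closure can be formed.\<close>

typedef (overloaded) ('a::field_char_0, 'v) polyfun =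
  "{f :: ('v \<Rightarrow> 'a) \<Rightarrow> 'a. \<exists>p. f = (\<lambda>\<rho>. peval id \<rho> p)}"
  by blast

setup_lifting type_definition_polyfun

instantiation polyfun :: (field_char_0, type) comm_ring_1
begin

lift_definition zero_polyfun :: "('a, 'b) polyfun" is "\<lambda>\<rho>. 0"
  by (rule exI[of _ "Const 0"]) simp
lift_definition one_polyfun :: "('a, 'b) polyfun" is "\<lambda>\<rho>. 1"
  by (rule exI[of _ "Const 1"]) simp
lift_definition plus_polyfun :: "('a, 'b) polyfun \<Rightarrow> ('a, 'b) polyfun \<Rightarrow> ('a, 'b) polyfun" is "\<lambda>f g \<rho>. f \<rho> + g \<rho>"
proof -
  fix f g :: "('b \<Rightarrow> 'a) \<Rightarrow> 'a" assume "\<exists>p. f = (\<lambda>\<rho>. peval id \<rho> p)" "\<exists>p. g = (\<lambda>\<rho>. peval id \<rho> p)"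
  then obtain p q where "f = (\<lambda>\<rho>. peval id \<rho> p)" "g = (\<lambda>\<rho>. peval id \<rho> q)" by blast
  thus "\<exists>p. (\<lambda>\<rho>. f \<rho> + g \<rho>) = (\<lambda>\<rho>. peval id \<rho> p)" by (intro exI[of _ "Add p q"]) simp
qed
lift_definition times_polyfun :: "('a, 'b) polyfun \<Rightarrow> ('a, 'b) polyfun \<Rightarrow> ('a, 'b) polyfun" is "\<lambda>f g \<rho>. f \<rho> * g \<rho>"
proof -
  fix f g :: "('b \<Rightarrow> 'a) \<Rightarrow> 'a" assume "\<exists>p. f = (\<lambda>\<rho>. peval id \<rho> p)" "\<exists>p. g = (\<lambda>\<rho>. peval id \<rho> p)"
  then obtain p q where "f = (\<lambda>\<rho>. peval id \<rho> p)" "g = (\<lambda>\<rho>. peval id \<rho> q)" by blast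
  thus "\<exists>p. (\<lambda>\<rho>. f \<rho> * g \<rho>) = (\<lambda>\<rho>. peval id \<rho> p)" by (intro exI[of _ "Mul p q"]) simp
qed
lift_definition uminus_polyfun :: "('a, 'b) polyfun \<Rightarrow> ('a, 'b) polyfun" is "\<lambda>f \<rho>. - f \<rho>"
proof -
  fix f :: "('b \<Rightarrow> 'a) \<Rightarrow> 'a" assume "\<exists>p. f = (\<lambda>\<rho>. peval id \<rho> p)"
  then obtain p where "f = (\<lambda>\<rho>. peval id \<rho> p)" by blast
  thus "\<exists>p. (\<lambda>\<rho>. - f \<rho>) = (\<lambda>\<rho>. peval id \<rho> p)" by (intro exI[of _ "Mul (Const (-1)) p"]) simp
qed
definition minus_polyfun :: "('a, 'b) polyfun \<Rightarrow> ('a, 'b) polyfun \<Rightarrow> ('a, 'b) polyfun" where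
  "minus_polyfun f g = f + - g"

instance
proof
  fix f g h :: "('a, 'b) polyfun"
  show "f + g + h = f + (g + h)" "f + g = g + f" "0 + f = f" "- f + f = 0" "f * g * h = f * (g * h)"
    "f * g = g * f" "1 * f = f" "(f + g) * h = f * h + g * h"
    by (transfer; simp add: algebra_simps)+
  show "(0 :: ('a, 'b) polyfun) \<noteq> 1" by transfer (simp add: fun_eq_iff)
  show "f - g = f + - g" by (simp add: minus_polyfun_def)
qed

end

lift_definition pfun :: "('a::field_char_0, 'v) pexp \<Rightarrow> ('a, 'v) polyfun" is "\<lambda>p \<rho>. peval id \<rho> p"
  by blast

lemma pfun_simps:
  "pfun (Add p q) = pfun p + pfun q" "pfun (Mul p q) = pfun p * pfun q" "pfun (Const 0) = 0" "pfun (Const 1) = 1"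
  by (transfer; simp)+

lemma pfun_surj: "\<exists>p. f = pfun p"
  by transfer blast

lemma pfun_eq_iff: "pfun p = pfun q \<longleftrightarrow> (\<forall>\<rho>. peval id \<rho> p = peval id \<rho> q)"
  by transfer (simp add: fun_eq_iff)

lemma pfun_eq_0_iff: "pfun p = 0 \<longleftrightarrow> (\<forall>\<rho>. peval id \<rho> p = 0)"
  by transfer (simp add: fun_eq_iff)

lemma poly_peval_line:
  "poly (peval (\<lambda>c. [:c:]) (\<lambda>v. [:a v, l v:]) p) t = peval id (\<lambda>v. a v + t * l v) p"
proof -
  have h: "hom_on UNIV (\<lambda>q. poly q t)" by (simp add: hom_on_def)
  show ?thesis unfolding peval_hom[OF h] by (simp add: id_def)
qed

text \<open>The two factors may be nonzero at different points; restricting both to the line through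
  these points reduces the claim to univariate polynomials.\<close>

instance polyfun :: (field_char_0, type) idom
proof
  fix f g :: "('a, 'b) polyfun" assume fg: "f \<noteq> 0" "g \<noteq> 0"
  obtain p q where pq: "f = pfun p" "g = pfun q" using pfun_surj by metis
  obtain \<rho> \<sigma> where r: "peval id \<rho> p \<noteq> 0" "peval id \<sigma> q \<noteq> 0" using fg pq pfun_eq_0_iff by metis
  let ?l = "\<lambda>e. peval (\<lambda>c. [:c:]) (\<lambda>v. [:\<rho> v, \<sigma> v - \<rho> v:]) e"
  have "poly (?l p) 0 \<noteq> 0" "poly (?l q) 1 \<noteq> 0" using r by (simp_all add: poly_peval_line)
  hence "?l p * ?l q \<noteq> 0" by auto
  then obtain t where "poly (?l p * ?l q) t \<noteq> 0" using poly_eq_poly_eq_iff[of "?l p * ?l q" 0] by (auto simp: fun_eq_iff)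
  hence "peval id (\<lambda>v. \<rho> v + t * (\<sigma> v - \<rho> v)) (Mul p q) \<noteq> 0" by (simp add: poly_peval_line)
  hence "pfun (Mul p q) \<noteq> 0" using pfun_eq_0_iff by blast
  thus "f * g \<noteq> 0" using pq by (simp add: pfun_simps)
qed

lemma of_nat_polyfun: "(of_nat n :: ('a::field_char_0, 'v) polyfun) = pfun (Const (of_nat n))"
proof (induction n)
  case (Suc n)
  have "pfun (Const (of_nat (Suc n))) = pfun (Add (Const 1) (Const (of_nat n)) :: ('a, 'v) pexp)"
    unfolding pfun_eq_iff by simp
  thus ?case by (simp add: pfun_simps Suc)
qed (simp add: pfun_simps)

instance polyfun :: (field_char_0, type) ring_char_0
proof
  show "inj (of_nat :: nat \<Rightarrow> ('a, 'b) polyfun)"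
    by (rule injI) (simp add: of_nat_polyfun pfun_eq_iff)
qed

instance fract :: ("{idom, ring_char_0}") field_char_0
proof
  show "inj (of_nat :: nat \<Rightarrow> 'a fract)"
    by (rule injI) (simp add: of_nat_fract eq_fract)
qed

text \<open>Algebraic closedness is needed for Puiseux roots; algebraicity over the polynomial ring
  is what lets partial derivatives extend.\<close>

type_synonym ('a, 'v) genfield = "('a, 'v) polyfun fract alg_closure"

definition gembed :: "('a::field_char_0, 'v) polyfun \<Rightarrow> ('a, 'v) genfield" where
  "gembed f = to_ac (Fract f 1)"

definition gconst :: "'a::field_char_0 \<Rightarrow> ('a, 'v) genfield" where
  "gconst c = gembed (pfun (Const c))"

definition gvar :: "'v \<Rightarrow> ('a::field_char_0, 'v) genfield" where
  "gvar v = gembed (pfun (Var v))"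

lemma gembed_hom: "gembed (f + g) = gembed f + gembed g" "gembed (f * g) = gembed f * gembed g"
  "gembed 0 = 0" "gembed 1 = 1" "gembed f = 0 \<longleftrightarrow> f = 0"
  by (simp_all add: gembed_def Zero_fract_def[symmetric] One_fract_def[symmetric] flip: to_ac_add to_ac_mult)
     (simp add: Zero_fract_def eq_fract)

lemma peval_generic: "peval gconst gvar p = gembed (pfun p)"
  by (induction p) (simp_all add: gconst_def gvar_def gembed_hom pfun_simps)

lemma peval_generic_eq_0: "peval gconst gvar p = 0 \<Longrightarrow> peval id \<rho> p = 0"
  by (simp add: peval_generic gembed_hom pfun_eq_0_iff)

lemma hom_on_gconst: "hom_on UNIV (gconst :: 'a::field_char_0 \<Rightarrow> ('a, 'v) genfield)"
proof -
  have "pfun (Const (a + b)) = pfun (Add (Const a) (Const b) :: ('a, 'v) pexp)"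
    "pfun (Const (a * b)) = pfun (Mul (Const a) (Const b) :: ('a, 'v) pexp)" for a b :: 'a
    unfolding pfun_eq_iff by simp_all
  thus ?thesis unfolding hom_on_def by (simp add: gconst_def pfun_simps gembed_hom)
qed

lemma gconst_eq_0_iff: "gconst c = 0 \<longleftrightarrow> c = 0"
  by (simp add: gconst_def gembed_hom pfun_eq_0_iff)

definition gpolys :: "('a::field_char_0, 'v) genfield set" where
  "gpolys = range (peval gconst gvar)"

lemma gpolys_eq: "gpolys = range gembed"
proof -
  have "range pfun = UNIV" using pfun_surj by blast
  thus ?thesis unfolding gpolys_def peval_generic by (metis image_image)
qed

lemma is_subring_gpolys: "is_subring gpolys"
  unfolding is_subring_def gpolys_eq
proof (intro conjI ballI)
  show "1 \<in> range gembed" using gembed_hom(4) by (metis rangeI)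
  fix a :: "('a, 'b) genfield" assume "a \<in> range gembed"
  then obtain f where f: "a = gembed f" by blast
  have "gembed f + gembed (- f) = 0" by (simp flip: gembed_hom(1) add: gembed_hom(3))
  hence "- a = gembed (- f)" unfolding f by (rule minus_unique)
  thus "- a \<in> range gembed" by blast
  fix b :: "('a, 'b) genfield" assume "b \<in> range gembed"
  then obtain g where "b = gembed g" by blast
  thus "a + b \<in> range gembed" "a * b \<in> range gembed" using f gembed_hom(1,2) by (metis rangeI)+
qed

lemma common_denominator:
  fixes P :: "'a::idom fract poly"
  shows "\<exists>d. d \<noteq> 0 \<and> (\<forall>i. \<exists>a. coeff P i * Fract d 1 = Fract a 1)"
proof (induction P)
  case 0
  have "coeff 0 i * Fract 1 1 = Fract (0 :: 'a) 1" for i by (simp add: Zero_fract_def[symmetric])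
  thus ?case by (intro exI[of _ 1]) auto
next
  case (pCons c P)
  then obtain d where d: "d \<noteq> 0" "\<And>i. \<exists>a. coeff P i * Fract d 1 = Fract a 1" by blast
  obtain a b where ab: "c = Fract a b" "b \<noteq> 0" by (cases c) auto
  have "\<exists>a. coeff (pCons c P) i * Fract (b * d) 1 = Fract a 1" for i
  proof (cases i)
    case 0
    have "c * Fract (b * d) 1 = Fract (a * d) 1" using ab d by (simp add: eq_fract)
    thus ?thesis using 0 by auto
  next
    case (Suc j)
    obtain e where "coeff P j * Fract d 1 = Fract e 1" using d by blast
    hence "coeff P j * Fract d 1 * Fract b 1 = Fract (e * b) 1" by simp
    moreover have "coeff P j * Fract d 1 * Fract b 1 = coeff P j * Fract (b * d) 1"
      by (simp add: mult.assoc mult.commute)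
    ultimately show ?thesis using Suc by auto
  qed
  thus ?case using ab d by (intro exI[of _ "b * d"]) auto
qed

lemma algebraic_over_gpolys: "algebraic_over gpolys z"
proof -
  obtain P where P: "P \<noteq> 0" "poly (map_poly to_ac P) z = 0" by (rule alg_closure_algebraic)
  obtain d where d: "d \<noteq> 0" "\<And>i. \<exists>a. coeff P i * Fract d 1 = Fract a 1" using common_denominator[of P] by blast
  let ?Q = "smult (gembed d) (map_poly to_ac P)"
  have "coeff ?Q i \<in> gpolys" for i
  proof -
    obtain a where "coeff P i * Fract d 1 = Fract a 1" using d by blast
    hence "coeff ?Q i = gembed a"
      by (simp add: gembed_def coeff_map_poly mult.commute flip: to_ac_mult)
    thus ?thesis by (simp add: gpolys_eq)
  qed
  moreover have "map_poly to_ac P \<noteq> 0" using P(1) map_poly_nonzero(1)[of to_ac P] by simp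
  hence "?Q \<noteq> 0" using d(1) by (simp add: gembed_hom)
  ultimately show ?thesis unfolding algebraic_over_def poly_over_def
    using P(2) by (intro exI[of _ ?Q]) auto
qed

section \<open>Derivations and their extension to algebraic elements\<close>

definition derivation_on :: "'a::comm_ring_1 set \<Rightarrow> ('a \<Rightarrow> 'a) \<Rightarrow> bool" where
  "derivation_on R D \<longleftrightarrow> (\<forall>a\<in>R. \<forall>b\<in>R. D (a + b) = D a + D b \<and> D (a * b) = D a * b + a * D b)"

lemma derivation_onD:
  assumes "derivation_on R D" "is_subring R"
  shows "a \<in> R \<Longrightarrow> b \<in> R \<Longrightarrow> D (a + b) = D a + D b" "a \<in> R \<Longrightarrow> b \<in> R \<Longrightarrow> D (a * b) = D a * b + a * D b"
    "D 0 = 0" "(\<And>i. i \<in> I \<Longrightarrow> f i \<in> R) \<Longrightarrow> D (sum f I) = (\<Sum>i\<in>I. D (f i))"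
proof -
  show 1: "D (a + b) = D a + D b" if "a \<in> R" "b \<in> R" for a b using assms(1) that by (auto simp: derivation_on_def)
  show "a \<in> R \<Longrightarrow> b \<in> R \<Longrightarrow> D (a * b) = D a * b + a * D b" using assms(1) by (auto simp: derivation_on_def)
  show 0: "D 0 = 0" using 1[of 0 0] is_subringD(2)[OF assms(2)] by simp
  show "(\<And>i. i \<in> I \<Longrightarrow> f i \<in> R) \<Longrightarrow> D (sum f I) = (\<Sum>i\<in>I. D (f i))"
    by (induction I rule: infinite_finite_induct) (simp_all add: 0 1 subring_sum[OF assms(2)])
qed

text \<open>The value that the Leibniz rule forces on \<open>poly p z\<close> when \<open>z\<close>
  is sent to \<open>w\<close>.\<close>

definition poly_deriv_at :: "('a::idom \<Rightarrow> 'a) \<Rightarrow> 'a \<Rightarrow> 'a \<Rightarrow> 'a poly \<Rightarrow> 'a" where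
  "poly_deriv_at D z w p = poly (map_poly D p) z + poly (pderiv p) z * w"

lemma poly_deriv_at_simps:
  fixes R :: "'a::idom set"
  assumes D: "derivation_on R D" and R: "is_subring R" and p: "poly_over R p" and q: "poly_over R q"
  shows "poly_deriv_at D z w (p + q) = poly_deriv_at D z w p + poly_deriv_at D z w q"
    "poly_deriv_at D z w (p * q) = poly_deriv_at D z w p * poly q z + poly p z * poly_deriv_at D z w q"
proof -
  note [simp] = coeff_map_poly[where f = D, OF derivation_onD(3)[OF D R]]
  have pq: "coeff p i \<in> R" "coeff q i \<in> R" for i using p q by (auto simp: poly_over_def)
  have "map_poly D (p + q) = map_poly D p + map_poly D q"
    by (rule poly_eqI) (simp add: derivation_onD(1)[OF D R] pq)
  thus "poly_deriv_at D z w (p + q) = poly_deriv_at D z w p + poly_deriv_at D z w q"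
    by (simp add: poly_deriv_at_def pderiv_add algebra_simps)
  have "map_poly D (p * q) = map_poly D p * q + p * map_poly D q"
  proof (rule poly_eqI)
    fix n
    have "D (coeff (p * q) n) = (\<Sum>i\<le>n. D (coeff p i * coeff q (n - i)))"
      unfolding coeff_mult by (rule derivation_onD(4)[OF D R]) (intro is_subringD(4)[OF R] pq)
    also have "\<dots> = (\<Sum>i\<le>n. D (coeff p i) * coeff q (n - i) + coeff p i * D (coeff q (n - i)))"
      by (intro sum.cong refl derivation_onD(2)[OF D R] pq)
    finally show "coeff (map_poly D (p * q)) n = coeff (map_poly D p * q + p * map_poly D q) n"
      by (simp add: coeff_mult sum.distrib)
  qed
  thus "poly_deriv_at D z w (p * q) = poly_deriv_at D z w p * poly q z + poly p z * poly_deriv_at D z w q"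
    by (simp add: poly_deriv_at_def pderiv_mult algebra_simps)
qed

lemma pderiv_minpoly_nonzero:
  fixes R :: "'a::field_char_0 set"
  assumes R: "is_subring R" and f: "is_minpoly R z f"
  shows "poly (pderiv f) z \<noteq> 0"
proof
  assume 0: "poly (pderiv f) z = 0"
  have deg: "degree f > 0" using minpoly_degree_pos[OF f] .
  have fR: "coeff f i \<in> R" for i using f by (auto simp: is_minpoly_def poly_over_def)
  have "of_nat n \<in> R" for n by (induction n) (simp_all add: is_subringD[OF R])
  hence "poly_over R (pderiv f)" using fR by (auto simp: poly_over_def coeff_pderiv simp del: of_nat_Suc intro!: is_subringD(4)[OF R])
  moreover have "pderiv f \<noteq> 0" using deg by (simp add: pderiv_eq_0_iff)
  ultimately have "degree f \<le> degree (pderiv f)" using f 0 by (auto simp: is_minpoly_def)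
  thus False using deg by (simp add: degree_pderiv)
qed

text \<open>Differentiating \<open>poly f z = 0\<close> gives a linear equation for the value
  \<open>w\<close> at \<open>z\<close>, with nonzero coefficient in characteristic zero. Conversely,
  this \<open>w\<close> makes \<open>poly_deriv_at\<close> vanish on the multiples of
  \<open>f\<close>, hence on every relation of \<open>z\<close>.\<close>

lemma derivation_extend:
  fixes R :: "'a::field_char_0 set"
  assumes R: "is_subring R" and D: "derivation_on R D" and z: "algebraic_over R z"
  shows "\<exists>D'. derivation_on (adjoin R z) D' \<and> (\<forall>a\<in>R. D' a = D a)"
proof -
  obtain f where f: "is_minpoly R z f" using ex_minpoly[OF z] by blast
  have f': "poly_over R f" "f \<noteq> 0" "poly f z = 0" using f by (auto simp: is_minpoly_def)
  define w where "w = - poly (map_poly D f) z / poly (pderiv f) z"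
  let ?d = "poly_deriv_at D z w"
  note ds = poly_deriv_at_simps[OF D R, of _ _ z w]
  have df: "?d f = 0" using pderiv_minpoly_nonzero[OF R f] by (simp add: poly_deriv_at_def w_def)
  have ker: "?d p = 0" if p: "poly_over R p" "poly p z = 0" for p
  proof -
    obtain k h where h: "poly_over R h" "smult (lead_coeff f ^ k) p = f * h" using minpoly_kernel[OF R f p] by blast
    let ?c = "lead_coeff f ^ k"
    have "?c \<in> R" using f'(1) by (intro is_subringD(7)[OF R]) (simp add: poly_over_def)
    hence c: "poly_over R [:?c:]" using R by (simp add: poly_over_pCons_iff)
    have "?d (f * h) = 0" using ds(2)[OF f'(1) h(1)] df f'(3) by simp
    moreover have "f * h = [:?c:] * p" using h(2) by simp
    ultimately have "?d ([:?c:] * p) = 0" by simp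
    hence "?c * ?d p = 0" using ds(2)[OF c p(1)] p(2) by simp
    thus ?thesis using f'(2) by simp
  qed
  define D' where "D' x = ?d (SOME p. poly_over R p \<and> poly p z = x)" for x
  have D': "D' (poly p z) = ?d p" if p: "poly_over R p" for p
  proof -
    define q where "q = (SOME q. poly_over R q \<and> poly q z = poly p z)"
    have q: "poly_over R q \<and> poly q z = poly p z" unfolding q_def by (rule someI[of _ p]) (use p in auto)
    have qp: "poly_over R (q - p)" using q p by (intro poly_over_arith[OF R]) auto
    have "?d (q - p) = 0" using q by (intro ker qp) simp
    moreover have "?d q = ?d (q - p) + ?d p" using ds(1)[OF qp p] by simp
    ultimately show ?thesis unfolding D'_def q_def[symmetric] by simp
  qed
  have "derivation_on (adjoin R z) D'" unfolding derivation_on_def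
  proof (intro ballI conjI)
    fix a b assume "a \<in> adjoin R z" "b \<in> adjoin R z"
    then obtain p q where p: "a = poly p z" "poly_over R p" and q: "b = poly q z" "poly_over R q"
      by (auto simp: adjoin_def)
    show "D' (a + b) = D' a + D' b"
      using D'[OF p(2)] D'[OF q(2)] D'[OF poly_over_arith(2)[OF R p(2) q(2)]] ds(1)[OF p(2) q(2)] by (simp add: p q)
    show "D' (a * b) = D' a * b + a * D' b"
      using D'[OF p(2)] D'[OF q(2)] D'[OF poly_over_arith(3)[OF R p(2) q(2)]] ds(2)[OF p(2) q(2)] by (simp add: p q)
  qed
  moreover have "D' a = D a" if "a \<in> R" for a
    using D'[of "[:a:]"] that R
    by (simp add: poly_over_pCons_iff poly_deriv_at_def Polynomial.map_poly_pCons derivation_onD(3)[OF D R])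
  ultimately show ?thesis by blast
qed

text \<open>The formula depends on \<open>f\<close> and \<open>D\<close> but not on
  \<open>S\<close>, so it can define one global derivation that restricts to all local
  extensions.\<close>

lemma derivation_unique:
  fixes R :: "'a::field_char_0 set"
  assumes R: "is_subring R" and f: "is_minpoly R z f" and S: "is_subring S" "R \<subseteq> S" "z \<in> S"
    and D': "derivation_on S D'" "\<And>a. a \<in> R \<Longrightarrow> D' a = D a"
  shows "D' z = - poly (map_poly D f) z / poly (pderiv f) z"
proof -
  have f': "poly_over R f" "poly f z = 0" using f by (auto simp: is_minpoly_def)
  have chain: "D' (poly p z) = poly_deriv_at D' z (D' z) p" if "poly_over S p" for p
    using that
  proof (induction p)
    case 0
    show ?case by (simp add: poly_deriv_at_def derivation_onD(3)[OF D'(1) S(1)])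
  next
    case (pCons a p)
    have ap: "a \<in> S" "poly_over S p" using pCons.prems by (auto simp: poly_over_pCons_iff)
    have "poly p z \<in> S" using poly_in_subring[OF S(1) ap(2) S(3)] .
    thus ?case using pCons.IH[OF ap(2)] ap S(3)
      by (simp add: poly_deriv_at_def derivation_onD[OF D'(1) S(1)] is_subringD[OF S(1)] pderiv_pCons
          Polynomial.map_poly_pCons algebra_simps)
  qed
  have "map_poly D' f = map_poly D f" by (rule map_poly_cong_over[OF D'(2) f'(1)])
  moreover have "D' (poly f z) = 0" using f'(2) derivation_onD(3)[OF D'(1) S(1)] by simp
  ultimately have "poly (map_poly D f) z + poly (pderiv f) z * D' z = 0"
    using chain[OF poly_over_mono[OF f'(1) S(2)]] by (simp add: poly_deriv_at_def)
  thus ?thesis using pderiv_minpoly_nonzero[OF R f] by (simp add: field_simps add_eq_0_iff)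
qed

text \<open>Uniqueness makes the local extensions to \<open>adjoin (adjoin R x) y\<close> agree, so that additivity and
  the Leibniz rule at \<open>x, y\<close> can be checked there.\<close>
lemma derivation_extend_algebraic:
  fixes R :: "'a::field_char_0 set"
  assumes R: "is_subring R" and D: "derivation_on R D" and alg: "\<And>z. algebraic_over R z"
  shows "\<exists>D'. derivation_on UNIV D' \<and> (\<forall>a\<in>R. D' a = D a)"
proof -
  define mp where "mp z = (SOME f. is_minpoly R z f)" for z
  have mp: "is_minpoly R z (mp z)" for z unfolding mp_def using ex_minpoly[OF alg] by (rule someI_ex)
  define D' where "D' z = - poly (map_poly D (mp z)) z / poly (pderiv (mp z)) z" for z
  have loc: "D' (x + y) = D' x + D' y \<and> D' (x * y) = D' x * y + x * D' y \<and> (x \<in> R \<longrightarrow> D' x = D x)" for x y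
  proof -
    let ?S = "adjoin R x" and ?T = "adjoin (adjoin R x) y"
    note S = is_subring_adjoin[OF R, of x]
    note T = is_subring_adjoin[OF S, of y]
    obtain D1 where D1: "derivation_on ?S D1" "\<forall>a\<in>R. D1 a = D a" using derivation_extend[OF R D alg] by blast
    obtain D2 where D2: "derivation_on ?T D2" "\<forall>a\<in>?S. D2 a = D1 a"
      using derivation_extend[OF S D1(1) algebraic_over_mono[OF alg adjoin_base[OF R]]] by blast
    have RT: "R \<subseteq> ?T" using adjoin_base[OF R, of x] adjoin_base[OF S, of y] by blast
    have D2R: "D2 a = D a" if "a \<in> R" for a using D1(2) D2(2) that adjoin_base[OF R, of x] by auto
    have eq: "D2 u = D' u" if "u \<in> ?T" for u
      unfolding D'_def by (rule derivation_unique[OF R mp T RT that D2(1) D2R])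
    have xy: "x \<in> ?T" "y \<in> ?T" using adjoin_gen[OF R, of x] adjoin_base[OF S, of y] adjoin_gen[OF S, of y] by blast+
    have "x + y \<in> ?T" "x * y \<in> ?T" using xy by (simp_all add: is_subringD[OF T])
    thus ?thesis using derivation_onD(1,2)[OF D2(1) T xy] eq xy D2R by metis
  qed
  hence "derivation_on UNIV D'" by (simp add: derivation_on_def)
  thus ?thesis using loc by blast
qed

section \<open>Partial derivatives of the generic field\<close>

primrec dpexp :: "'v \<Rightarrow> ('a::{zero, one}, 'v) pexp \<Rightarrow> ('a, 'v) pexp" where
  "dpexp x (Const c) = Const 0"
| "dpexp x (Var v) = Const (if v = x then 1 else 0)"
| "dpexp x (Add p q) = Add (dpexp x p) (dpexp x q)"
| "dpexp x (Mul p q) = Add (Mul (dpexp x p) q) (Mul p (dpexp x q))"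

text \<open>Value and derivative are the first two coefficients on the line through
  \<open>\<rho>\<close> in the direction of \<open>x\<close>. This line polynomial is determined by
  the induced function, so the tree derivative is as well.\<close>

lemma peval_dpexp:
  "coeff (peval (\<lambda>c. [:c:]) (\<lambda>v. [:\<rho> v, if v = x then 1 else 0:]) p) 0 = peval id \<rho> p \<and>
   coeff (peval (\<lambda>c. [:c:]) (\<lambda>v. [:\<rho> v, if v = x then 1 else 0:]) p) 1 = peval id \<rho> (dpexp x p)"
  by (induction p) (simp_all add: coeff_mult numeral_2_eq_2 algebra_simps)

lemma dpexp_cong:
  fixes p q :: "('a::field_char_0, 'v) pexp"
  assumes "\<And>\<rho>. peval id \<rho> p = peval id \<rho> q"
  shows "peval id \<rho> (dpexp x p) = peval id \<rho> (dpexp x q)"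
proof -
  let ?l = "\<lambda>e. peval (\<lambda>c. [:c:]) (\<lambda>v. [:\<rho> v, if v = x then 1 else 0:]) e"
  have "?l p = ?l q"
    by (rule poly_eq_poly_eq_iff[THEN iffD1]) (simp add: fun_eq_iff poly_peval_line assms)
  thus ?thesis using peval_dpexp[of \<rho> x p] peval_dpexp[of \<rho> x q] by simp
qed

lemma partial_derivation:
  "\<exists>D. derivation_on UNIV D \<and>
    (\<forall>p. D (peval gconst gvar p) = (peval gconst gvar (dpexp x p) :: ('a::field_char_0, 'v) genfield))"
proof -
  let ?e = "peval gconst gvar :: ('a, 'v) pexp \<Rightarrow> ('a, 'v) genfield"
  have eqD: "?e (dpexp x p) = ?e (dpexp x q)" if "?e p = ?e q" for p q
  proof -
    have m1: "(gconst (- 1) :: ('a, 'v) genfield) = - 1"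
      by (simp add: hom_on_more(1)[OF hom_on_gconst is_subring_UNIV] hom_onD(2)[OF hom_on_gconst])
    have 0: "?e (Add p (Mul (Const (-1)) q)) = 0"
      unfolding peval.simps m1 that by simp
    have "peval id \<rho> p = peval id \<rho> q" for \<rho>
    proof -
      have "peval id \<rho> p + id (- 1) * peval id \<rho> q = 0"
        using peval_generic_eq_0[OF 0, of \<rho>] unfolding peval.simps .
      thus ?thesis by (simp add: eq_neg_iff_add_eq_0)
    qed
    from dpexp_cong[OF this] have "pfun (dpexp x p) = pfun (dpexp x q)" by (simp add: pfun_eq_iff)
    thus ?thesis by (simp add: peval_generic)
  qed
  define D where "D a = ?e (dpexp x (SOME p. a = ?e p))" for a
  have D: "D (?e p) = ?e (dpexp x p)" for p
    unfolding D_def by (rule eqD) (rule someI[of "\<lambda>q. ?e p = ?e q", symmetric], rule refl)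
  have "derivation_on gpolys D"
    unfolding derivation_on_def gpolys_def
  proof (intro ballI conjI)
    fix a b assume "a \<in> range ?e" "b \<in> range ?e"
    then obtain p q where pq: "a = ?e p" "b = ?e q" by blast
    show "D (a + b) = D a + D b" using D[of "Add p q"] D[of p] D[of q] pq by simp
    show "D (a * b) = D a * b + a * D b" using D[of "Mul p q"] D[of p] D[of q] pq by simp
  qed
  then obtain D' where "derivation_on UNIV D'" "\<forall>a\<in>gpolys. D' a = D a"
    using derivation_extend_algebraic[OF is_subring_gpolys _ algebraic_over_gpolys] by blast
  thus ?thesis using D by (intro exI[of _ D']) (auto simp: gpolys_def)
qed

subsection \<open>Leibniz expansion and regrouping\<close>

lemma tidx_altdef: "tidx m k = {xs. set xs \<subseteq> {..<m} \<and> length xs = k}"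
  by (auto simp: tidx_def)

lemma finite_tidx [simp]: "finite (tidx m k)"
  unfolding tidx_altdef by (rule finite_lists_length_eq) simp

lemma card_tidx: "card (tidx m k) = m ^ k"
  unfolding tidx_altdef using card_lists_length_eq[of "{..<m}" k] by simp

lemma tidx_nth: "xs \<in> tidx m k \<Longrightarrow> j < k \<Longrightarrow> xs ! j < m"
  by (auto simp: tidx_def)

lemma tidx_length: "xs \<in> tidx m k \<Longrightarrow> length xs = k"
  by (simp add: tidx_def)

lemma tidx_Suc: "tidx m (Suc k) = (\<lambda>(xs, j). xs @ [j]) ` (tidx m k \<times> {..<m})"
proof
  show "tidx m (Suc k) \<subseteq> (\<lambda>(xs, j). xs @ [j]) ` (tidx m k \<times> {..<m})"
  proof
    fix zs assume zs: "zs \<in> tidx m (Suc k)"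
    hence ne: "zs \<noteq> []" by (auto simp: tidx_def)
    hence "zs = (\<lambda>(xs, j). xs @ [j]) (butlast zs, last zs)" by simp
    moreover have "(butlast zs, last zs) \<in> tidx m k \<times> {..<m}"
      using zs ne by (auto simp: tidx_def dest: in_set_butlastD)
    ultimately show "zs \<in> (\<lambda>(xs, j). xs @ [j]) ` (tidx m k \<times> {..<m})" by (rule image_eqI)
  qed
qed (auto simp: tidx_def)

lemma sum_tidx_Suc: "(\<Sum>zs\<in>tidx m (Suc k). f zs) = (\<Sum>xs\<in>tidx m k. \<Sum>j<m. f (xs @ [j]))"
proof -
  have "inj_on (\<lambda>(xs, j). xs @ [j]) (tidx m k \<times> {..<m})" by (auto simp: inj_on_def)
  hence "(\<Sum>zs\<in>tidx m (Suc k). f zs) = (\<Sum>(xs, j)\<in>tidx m k \<times> {..<m}. f (xs @ [j]))"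
    unfolding tidx_Suc by (subst sum.reindex) (auto simp: case_prod_unfold)
  thus ?thesis by (simp add: sum.cartesian_product)
qed

lemma derivation_prod:
  fixes D :: "'r::comm_ring_1 \<Rightarrow> 'r" and k :: nat
  assumes D: "derivation_on UNIV D"
  shows "D (\<Prod>j<k. A j) = (\<Sum>t<k. \<Prod>j<k. if j = t then D (A j) else A j)"
proof (induction k)
  case 0
  have "D (1 * 1) = D 1 * 1 + 1 * D 1" using derivation_onD(2)[OF D is_subring_UNIV] by blast
  thus ?case by simp
next
  case (Suc k)
  have "D (\<Prod>j<Suc k. A j) = D (\<Prod>j<k. A j) * A k + (\<Prod>j<k. A j) * D (A k)"
    using derivation_onD(2)[OF D is_subring_UNIV] by simp
  also have "D (\<Prod>j<k. A j) * A k = (\<Sum>t<k. \<Prod>j<Suc k. if j = t then D (A j) else A j)"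
    unfolding Suc sum_distrib_right by (intro sum.cong) auto
  also have "(\<Prod>j<k. A j) * D (A k) = (\<Prod>j<Suc k. if j = k then D (A j) else A j)"
  proof -
    have "(\<Prod>j<k. A j) = (\<Prod>j<k. if j = k then D (A j) else A j)" by (intro prod.cong) auto
    thus ?thesis by simp
  qed
  finally show ?case by simp
qed

text \<open>Position \<open>i\<close> contributes one derivation, with indices \<open>i\<close> and
  \<open>c ! i\<close>. The set \<open>S\<close> of active positions is what the Leibniz rule
  distributes among the factors.\<close>

primrec iter_deriv :: "(nat \<Rightarrow> nat \<Rightarrow> 'r \<Rightarrow> 'r) \<Rightarrow> nat list \<Rightarrow> nat set \<Rightarrow> nat \<Rightarrow> 'r \<Rightarrow> 'r" where
  "iter_deriv D c S 0 x = x"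
| "iter_deriv D c S (Suc i) x = (if i \<in> S then D i (c ! i) (iter_deriv D c S i x) else iter_deriv D c S i x)"

lemma iter_deriv_cong:
  "(\<And>i. i < e \<Longrightarrow> i \<in> S \<longleftrightarrow> i \<in> S') \<Longrightarrow> (\<And>i. i < e \<Longrightarrow> i \<in> S \<Longrightarrow> c ! i = c' ! i) \<Longrightarrow>
    iter_deriv D c S e x = iter_deriv D c' S' e x"
  by (induction e) auto

lemma iter_deriv_sum:
  fixes D :: "nat \<Rightarrow> nat \<Rightarrow> 'r::comm_ring_1 \<Rightarrow> 'r"
  assumes "\<And>i u. derivation_on UNIV (D i u)"
  shows "iter_deriv D c S e (\<Sum>i\<in>I. f i) = (\<Sum>i\<in>I. iter_deriv D c S e (f i))"
  by (induction e) (simp_all add: derivation_onD(4)[OF assms is_subring_UNIV])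

text \<open>The list \<open>\<sigma>\<close> records which factor each derivation hits, so
  assignments are themselves indexed by \<open>tidx k e\<close>.\<close>

lemma iter_deriv_prod:
  fixes D :: "nat \<Rightarrow> nat \<Rightarrow> 'r::comm_ring_1 \<Rightarrow> 'r"
  assumes D: "\<And>i u. derivation_on UNIV (D i u)"
  shows "iter_deriv D c UNIV e (\<Prod>j<k. A j) =
    (\<Sum>\<sigma>\<in>tidx k e. \<Prod>j<k. iter_deriv D c {i. i < e \<and> \<sigma> ! i = j} e (A j))"
proof (induction e)
  case 0
  have "tidx k 0 = {[]}" by (auto simp: tidx_def)
  thus ?case by simp
next
  case (Suc e)
  have step: "iter_deriv D c {i. i < Suc e \<and> (\<sigma> @ [t]) ! i = j} (Suc e) x =
      (if j = t then D e (c ! e) (iter_deriv D c {i. i < e \<and> \<sigma> ! i = j} e x)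
       else iter_deriv D c {i. i < e \<and> \<sigma> ! i = j} e x)" if "\<sigma> \<in> tidx k e" for \<sigma> t j x
  proof -
    have l: "length \<sigma> = e" using that by (rule tidx_length)
    have eq: "iter_deriv D c {i. i < Suc e \<and> (\<sigma> @ [t]) ! i = j} e x = iter_deriv D c {i. i < e \<and> \<sigma> ! i = j} e x"
      using l by (intro iter_deriv_cong) (auto simp: nth_append)
    have mem: "e \<in> {i. i < Suc e \<and> (\<sigma> @ [t]) ! i = j} \<longleftrightarrow> j = t" using l by (auto simp: nth_append)
    show ?thesis by (simp only: iter_deriv.simps mem eq)
  qed
  have "iter_deriv D c UNIV (Suc e) (\<Prod>j<k. A j) =
    D e (c ! e) (\<Sum>\<sigma>\<in>tidx k e. \<Prod>j<k. iter_deriv D c {i. i < e \<and> \<sigma> ! i = j} e (A j))"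
    by (simp add: Suc)
  also have "\<dots> = (\<Sum>\<sigma>\<in>tidx k e. \<Sum>t<k. \<Prod>j<k.
      iter_deriv D c {i. i < Suc e \<and> (\<sigma> @ [t]) ! i = j} (Suc e) (A j))"
    unfolding derivation_onD(4)[OF D is_subring_UNIV UNIV_I] derivation_prod[OF D]
    by (intro sum.cong refl prod.cong) (simp_all only: step)
  finally show ?case unfolding sum_tidx_Suc .
qed

lemma card_zero_on:
  fixes S :: "nat set"
  shows "finite {c \<in> tidx n d. \<forall>i\<in>S. i < d \<longrightarrow> c ! i = 0} \<and>
    card {c \<in> tidx n d. \<forall>i\<in>S. i < d \<longrightarrow> c ! i = 0} \<le> n ^ card ({..<d} - S)"
proof -
  let ?I = "{c \<in> tidx n d. \<forall>i\<in>S. i < d \<longrightarrow> c ! i = 0}" and ?P = "({..<d} - S) \<rightarrow>\<^sub>E {..<n}"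
  let ?r = "\<lambda>c. restrict (\<lambda>i. c ! i) ({..<d} - S)"
  have "inj_on ?r ?I"
  proof (rule inj_onI)
    fix c c' assume c: "c \<in> ?I" "c' \<in> ?I" "?r c = ?r c'"
    show "c = c'"
    proof (rule nth_equalityI)
      show "length c = length c'" using c by (auto simp: tidx_def)
      fix i assume "i < length c"
      hence i: "i < d" using c by (auto simp: tidx_def)
      have "?r c i = ?r c' i" using c(3) by (rule fun_cong)
      thus "c ! i = c' ! i" using c(1,2) i by (cases "i \<in> S") simp_all
    qed
  qed
  moreover have "?r ` ?I \<subseteq> ?P"
  proof
    fix g assume "g \<in> ?r ` ?I"
    then obtain c where "c \<in> tidx n d" "g = ?r c" by blast
    thus "g \<in> ?P" using tidx_nth[of c n d] by (simp add: PiE_iff)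
  qed
  ultimately have "card ?I \<le> card ?P" by (intro card_inj_on_le) (auto intro: finite_PiE)
  thus ?thesis by (simp add: card_funcsetE)
qed

text \<open>Averaging the sizes of the \<open>k\<close> classes gives one with
  \<open>d \<le> k * card\<close>. Rewriting this for the complement as
  \<open>k * (d - card) \<le> (k - 1) * d\<close> produces the floor.\<close>

lemma large_class:
  assumes \<sigma>: "\<sigma> \<in> tidx k d" and k: "k \<ge> 1"
  shows "\<exists>j<k. card ({..<d} - {i. i < d \<and> \<sigma> ! i = j}) \<le> (k - 1) * d div k"
proof -
  let ?S = "\<lambda>j. {i. i < d \<and> \<sigma> ! i = j}"
  have "{..<d} = (\<Union>j<k. ?S j)" using tidx_nth[OF \<sigma>] by auto
  hence "d = card (\<Union>j<k. ?S j)" by (metis card_lessThan)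
  also have "\<dots> = (\<Sum>j<k. card (?S j))" by (rule card_UN_disjoint) auto
  finally have sum: "d = (\<Sum>j<k. card (?S j))" .
  have "\<exists>j<k. d \<le> k * card (?S j)"
  proof (rule ccontr)
    assume "\<not> ?thesis"
    hence "k * card (?S j) < d" if "j < k" for j using that by (meson not_le)
    moreover have "0 \<in> {..<k}" using k by simp
    hence "{..<k} \<noteq> {}" by blast
    ultimately have "(\<Sum>j<k. k * card (?S j)) < (\<Sum>j<k. d)" by (intro sum_strict_mono) simp_all
    moreover have "(\<Sum>j<k. k * card (?S j)) = k * d" by (subst (2) sum) (simp add: sum_distrib_left)
    ultimately show False by simp
  qed
  then obtain j where j: "j < k" "d \<le> k * card (?S j)" by blast
  have "card ({..<d} - ?S j) = d - card (?S j)" by (subst card_Diff_subset) auto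
  moreover have "k * (d - card (?S j)) \<le> (k - 1) * d"
    using j(2) by (simp add: diff_mult_distrib diff_mult_distrib2)
  hence "d - card (?S j) \<le> (k - 1) * d div k" using k by (simp add: less_eq_div_iff_mult_less_eq mult.commute)
  ultimately show ?thesis using j(1) by auto
qed

text \<open>By \<open>dep\<close>, factor \<open>j\<close> depends only on the positions of
  \<open>c\<close> assigned to it. Erasing the positions of a large class \<open>p\<close> groups
  the indices so that all factors but \<open>p\<close> are constant on a group; the weighted sum
  goes into factor \<open>p\<close>, and each group becomes one product.\<close>

lemma rank_decomposition:
  fixes G :: "nat \<Rightarrow> nat list \<Rightarrow> nat \<Rightarrow> 'r::comm_ring_1"
  assumes \<sigma>: "\<sigma> \<in> tidx k d" and k: "k \<ge> 1" and n: "n \<ge> 1"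
    and dep: "\<And>j c c' u. (\<And>i. i < d \<Longrightarrow> \<sigma> ! i = j \<Longrightarrow> c ! i = c' ! i) \<Longrightarrow> G j c u = G j c' u"
  shows "\<exists>(I :: nat list set) U. finite I \<and> card I \<le> n ^ ((k - 1) * d div k) \<and>
    (\<forall>xs. (\<Sum>c\<in>tidx n d. t c * (\<Prod>j<k. G j c (xs ! j))) = (\<Sum>\<iota>\<in>I. \<Prod>j<k. U \<iota> j (xs ! j)))"
proof -
  obtain p where p: "p < k" "card ({..<d} - {i. i < d \<and> \<sigma> ! i = p}) \<le> (k - 1) * d div k"
    using large_class[OF \<sigma> k] by blast
  \<comment> \<open>Erased entries become \<open>0\<close>, a legal index because
    \<open>n \<ge> 1\<close>.\<close>
  define msk where "msk c = map (\<lambda>i. if \<sigma> ! i = p then 0 else c ! i) [0..<d]" for c :: "nat list"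
  have mnth: "msk c ! i = (if \<sigma> ! i = p then 0 else c ! i)" if "i < d" for c i using that by (simp add: msk_def)
  define I where "I = msk ` tidx n d"
  have "msk c \<in> tidx n d" if "c \<in> tidx n d" for c
    unfolding tidx_def msk_def using n tidx_nth[OF that] by auto
  hence "I \<subseteq> {c \<in> tidx n d. \<forall>i\<in>{i. i < d \<and> \<sigma> ! i = p}. i < d \<longrightarrow> c ! i = 0}"
    unfolding I_def by (auto simp: mnth)
  hence "card I \<le> card {c \<in> tidx n d. \<forall>i\<in>{i. i < d \<and> \<sigma> ! i = p}. i < d \<longrightarrow> c ! i = 0}"
    by (rule card_mono[OF conjunct1[OF card_zero_on]])
  also have "\<dots> \<le> n ^ card ({..<d} - {i. i < d \<and> \<sigma> ! i = p})" by (rule conjunct2[OF card_zero_on])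
  also have "\<dots> \<le> n ^ ((k - 1) * d div k)" by (rule power_increasing[OF p(2) n])
  finally have cI: "card I \<le> n ^ ((k - 1) * d div k)" .
  define U where "U \<iota> j u = (if j = p then \<Sum>c\<in>{c \<in> tidx n d. msk c = \<iota>}. t c * G p c u else G j \<iota> u)" for \<iota> j u
  have "(\<Sum>c\<in>tidx n d. t c * (\<Prod>j<k. G j c (xs ! j))) = (\<Sum>\<iota>\<in>I. \<Prod>j<k. U \<iota> j (xs ! j))" for xs
  proof -
    have "(\<Sum>c\<in>tidx n d. t c * (\<Prod>j<k. G j c (xs ! j))) =
      (\<Sum>\<iota>\<in>I. \<Sum>c\<in>{c \<in> tidx n d. msk c = \<iota>}. t c * (\<Prod>j<k. G j c (xs ! j)))"
      unfolding I_def by (rule sum.image_gen) simp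
    also have "\<dots> = (\<Sum>\<iota>\<in>I. \<Prod>j<k. U \<iota> j (xs ! j))"
    proof (rule sum.cong[OF refl])
      fix \<iota>
      have split: "(\<Prod>j<k. f j) = f p * (\<Prod>j\<in>{..<k} - {p}. f j)" for f :: "nat \<Rightarrow> 'r"
        using p(1) by (intro prod.remove) auto
      have G: "(\<Prod>j\<in>{..<k} - {p}. G j c (xs ! j)) = (\<Prod>j\<in>{..<k} - {p}. G j \<iota> (xs ! j))" if "msk c = \<iota>" for c
        by (intro prod.cong refl dep) (auto simp: that[symmetric] mnth)
      have "(\<Prod>j\<in>{..<k} - {p}. U \<iota> j (xs ! j)) = (\<Prod>j\<in>{..<k} - {p}. G j \<iota> (xs ! j))"
        by (intro prod.cong) (auto simp: U_def)
      hence "(\<Prod>j<k. U \<iota> j (xs ! j)) =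
        (\<Sum>c\<in>{c \<in> tidx n d. msk c = \<iota>}. t c * G p c (xs ! p)) * (\<Prod>j\<in>{..<k} - {p}. G j \<iota> (xs ! j))"
        by (simp add: split U_def)
      also have "\<dots> = (\<Sum>c\<in>{c \<in> tidx n d. msk c = \<iota>}. t c * (\<Prod>j<k. G j c (xs ! j)))"
        unfolding sum_distrib_right by (intro sum.cong refl) (auto simp: split G mult.assoc)
      finally show "(\<Sum>c\<in>{c \<in> tidx n d. msk c = \<iota>}. t c * (\<Prod>j<k. G j c (xs ! j))) = (\<Prod>j<k. U \<iota> j (xs ! j))" ..
    qed
    finally show ?thesis .
  qed
  thus ?thesis using cI by (intro exI[of _ I] exI[of _ U]) (auto simp: I_def)
qed

text \<open>The sum is padded with zeros, and the scalar is absorbed by the first factor.\<close>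
lemma reindex_rank_sum:
  fixes U :: "'i \<Rightarrow> nat \<Rightarrow> nat \<Rightarrow> 'r::comm_ring_1"
  assumes I: "finite I" "card I \<le> r" and k: "k \<ge> 1"
  shows "\<exists>V. \<forall>xs. b * (\<Sum>\<iota>\<in>I. \<Prod>j<k. U \<iota> j (xs ! j)) = (\<Sum>l<r. \<Prod>j<k. V (l, j, xs ! j))"
proof -
  obtain f where f: "bij_betw f {..<card I} I" using ex_bij_betw_nat_finite[OF I(1)] by (auto simp: atLeast0LessThan)
  define V where "V = (\<lambda>(l, j, u). if l < card I then (if j = 0 then b else 1) * U (f l) j u else 0)"
  have "b * (\<Sum>\<iota>\<in>I. \<Prod>j<k. U \<iota> j (xs ! j)) = (\<Sum>l<r. \<Prod>j<k. V (l, j, xs ! j))" for xs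
  proof -
    have "b * (\<Sum>\<iota>\<in>I. \<Prod>j<k. U \<iota> j (xs ! j)) = (\<Sum>l<card I. b * (\<Prod>j<k. U (f l) j (xs ! j)))"
      unfolding sum_distrib_left[symmetric] using sum.reindex_bij_betw[OF f, of "\<lambda>\<iota>. \<Prod>j<k. U \<iota> j (xs ! j)"] by simp
    also have "\<dots> = (\<Sum>l<card I. \<Prod>j<k. V (l, j, xs ! j))"
    proof (rule sum.cong[OF refl])
      fix l assume l: "l \<in> {..<card I}"
      have "(\<Prod>j<k. V (l, j, xs ! j)) = (\<Prod>j<k. (if j = 0 then b else 1) * U (f l) j (xs ! j))"
        using l by (simp add: V_def)
      also have "\<dots> = (\<Prod>j<k. if j = 0 then b else 1) * (\<Prod>j<k. U (f l) j (xs ! j))"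
        by (rule prod.distrib)
      also have "(\<Prod>j<k. if j = 0 then b else 1) = b" using k by (subst prod.delta) auto
      finally show "b * (\<Prod>j<k. U (f l) j (xs ! j)) = (\<Prod>j<k. V (l, j, xs ! j))" ..
    qed
    also have "\<dots> = (\<Sum>l<r. \<Prod>j<k. V (l, j, xs ! j))"
    proof (rule sum.mono_neutral_left)
      show "\<forall>l\<in>{..<r} - {..<card I}. (\<Prod>j<k. V (l, j, xs ! j)) = 0"
        using k by (auto simp: V_def zero_power Suc_le_eq)
    qed (use I in auto)
    finally show ?thesis .
  qed
  thus ?thesis by blast
qed

text \<open>The uniformizer is a constant for this derivation, so the powers of it that clear poles
  pass through unchanged.\<close>

definition fps_deriv_coeffs :: "('k::comm_ring_1 \<Rightarrow> 'k) \<Rightarrow> 'k fps \<Rightarrow> 'k fps" where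
  "fps_deriv_coeffs D f = Abs_fps (\<lambda>n. D (fps_nth f n))"

lemma derivation_on_fps_deriv_coeffs:
  assumes "derivation_on UNIV D"
  shows "derivation_on UNIV (fps_deriv_coeffs D)"
proof -
  note d = derivation_onD[OF assms is_subring_UNIV]
  show ?thesis unfolding derivation_on_def
  proof (intro ballI conjI)
    fix f g :: "'a fps"
    show "fps_deriv_coeffs D (f + g) = fps_deriv_coeffs D f + fps_deriv_coeffs D g"
      by (rule fps_ext) (simp add: fps_deriv_coeffs_def d(1))
    show "fps_deriv_coeffs D (f * g) = fps_deriv_coeffs D f * g + f * fps_deriv_coeffs D g"
      by (rule fps_ext) (simp add: fps_deriv_coeffs_def fps_mult_nth d(2,4) sum.distrib)
  qed
qed

lemma iter_deriv_fps:
  assumes "\<And>i u. derivation_on UNIV (D i u)"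
  shows "fps_nth (iter_deriv (\<lambda>i u. fps_deriv_coeffs (D i u)) c S e f) j = iter_deriv D c S e (fps_nth f j)"
    "iter_deriv (\<lambda>i u. fps_deriv_coeffs (D i u)) c S e (fps_X ^ N * f) =
      fps_X ^ N * iter_deriv (\<lambda>i u. fps_deriv_coeffs (D i u)) c S e f"
proof -
  show 1: "fps_nth (iter_deriv (\<lambda>i u. fps_deriv_coeffs (D i u)) c S e f) j = iter_deriv D c S e (fps_nth f j)" for f j
    by (induction e) (simp_all add: fps_deriv_coeffs_def)
  have 0: "iter_deriv D c S e 0 = 0"
    by (induction e) (simp_all add: derivation_onD(3)[OF assms is_subring_UNIV])
  show "iter_deriv (\<lambda>i u. fps_deriv_coeffs (D i u)) c S e (fps_X ^ N * f) =
      fps_X ^ N * iter_deriv (\<lambda>i u. fps_deriv_coeffs (D i u)) c S e f"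
    by (rule fps_ext) (simp add: 1 0 fps_X_power_mult_nth)
qed

subsection \<open>Border rank and linear maps\<close>

lemma zero_simple_tensor: "k \<ge> 1 \<Longrightarrow> (\<lambda>_. 0) \<in> simple_tensors m k"
  unfolding simple_tensors_def by (auto intro!: exI[of _ "\<lambda>_ _. 0"] simp: zero_power Suc_le_eq fun_eq_iff)

text \<open>A family of simple tensors is flattened into one assignment on triples (summand, factor,
  index), the variables of \<open>rank_pexp\<close>.\<close>

lemma rank_leI:
  fixes V :: "nat \<times> nat \<times> nat \<Rightarrow> 'a::comm_ring_1"
  shows "(\<lambda>xs. if xs \<in> tidx m k then \<Sum>l<r. \<Prod>j<k. V (l, j, xs ! j) else 0) \<in> rank_le m k r"
proof -
  define S where "S l = (\<lambda>xs. if xs \<in> tidx m k then \<Prod>j<k. V (l, j, xs ! j) else 0)" for l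
  have "S l \<in> simple_tensors m k" for l
    unfolding simple_tensors_def S_def
    by (intro CollectI exI[of _ "\<lambda>j i. if i < m then V (l, j, i) else 0"])
       (auto simp: fun_eq_iff tidx_nth intro!: prod.cong)
  moreover have "(\<lambda>xs. if xs \<in> tidx m k then \<Sum>l<r. \<Prod>j<k. V (l, j, xs ! j) else 0) = (\<lambda>xs. \<Sum>l<r. S l xs)"
    by (auto simp: S_def fun_eq_iff)
  ultimately show ?thesis unfolding rank_le_def by blast
qed

lemma rank_leE:
  assumes "T \<in> rank_le m k r"
  obtains V :: "nat \<times> nat \<times> nat \<Rightarrow> 'a::comm_ring_1"
  where "\<And>xs. T xs = (if xs \<in> tidx m k then \<Sum>l<r. \<Prod>j<k. V (l, j, xs ! j) else 0)"
proof -
  obtain S where S: "\<And>l. l < r \<Longrightarrow> S l \<in> simple_tensors m k" "T = (\<lambda>xs. \<Sum>l<r. S l xs)"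
    using assms unfolding rank_le_def by blast
  have "\<exists>v :: nat \<Rightarrow> nat \<Rightarrow> 'a. S l = (\<lambda>xs. if xs \<in> tidx m k then \<Prod>j<k. v j (xs ! j) else 0)" if "l < r" for l
    using S(1)[OF that] unfolding simple_tensors_def by blast
  then obtain v where v: "\<And>l. l < r \<Longrightarrow> S l = (\<lambda>xs. if xs \<in> tidx m k then \<Prod>j<k. v l j (xs ! j) else 0)"
    by metis
  show ?thesis
    by (rule that[of "\<lambda>(l, j, i). v l j i"]) (simp add: S(2) v)
qed

lemma rank_le_subset_Ten: "rank_le m k r \<subseteq> Ten m k"
  unfolding Ten_def by (auto elim!: rank_leE)

lemma rank_le_mono:
  assumes "r \<le> r'" "k \<ge> 1"
  shows "rank_le m k r \<subseteq> rank_le m k r'"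
proof
  fix T :: "nat list \<Rightarrow> 'a" assume "T \<in> rank_le m k r"
  then obtain S where S: "\<And>l. l < r \<Longrightarrow> S l \<in> simple_tensors m k" "T = (\<lambda>xs. \<Sum>l<r. S l xs)"
    unfolding rank_le_def by blast
  let ?S = "\<lambda>l. if l < r then S l else (\<lambda>_. 0)"
  have "(\<Sum>l<r'. ?S l xs) = (\<Sum>l<r. S l xs)" for xs
    using assms(1) by (intro sum.mono_neutral_cong_right) auto
  moreover have "?S l \<in> simple_tensors m k" for l using S(1) zero_simple_tensor[OF assms(2)] by auto
  ultimately show "T \<in> rank_le m k r'" unfolding rank_le_def S(2)
    by (intro CollectI exI[of _ ?S]) (auto simp: fun_eq_iff)
qed

lemma zariski_closure_mono: "A \<subseteq> B \<Longrightarrow> zariski_closure m k A \<subseteq> zariski_closure m k B"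
  unfolding zariski_closure_def by blast

text \<open>Expansion in the standard basis; it guarantees that the least \<open>r\<close> in
  \<open>brk\<close> exists and is uniformly bounded.\<close>

lemma Ten_rank_le:
  assumes T: "T \<in> Ten m k" and k: "k \<ge> 1"
  shows "T \<in> rank_le m k (m ^ k)"
proof -
  let ?U = "\<lambda>\<iota> j u. (if j = 0 then T \<iota> else 1) * (if u = \<iota> ! j then 1 else 0 :: 'a)"
  have "card (tidx m k) \<le> m ^ k" by (simp add: card_tidx)
  from reindex_rank_sum[OF finite_tidx this k, of 1 ?U] obtain V where
    V: "\<And>xs. (\<Sum>\<iota>\<in>tidx m k. \<Prod>j<k. ?U \<iota> j (xs ! j)) = (\<Sum>l<m ^ k. \<Prod>j<k. V (l, j, xs ! j))" by auto
  have "(\<Sum>\<iota>\<in>tidx m k. \<Prod>j<k. ?U \<iota> j (xs ! j)) = T xs" if xs: "xs \<in> tidx m k" for xs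
  proof -
    have "(\<Prod>j<k. ?U \<iota> j (xs ! j)) = (if \<iota> = xs then T xs else 0)" if \<iota>: "\<iota> \<in> tidx m k" for \<iota>
    proof (cases "\<iota> = xs")
      case True
      have "(\<Prod>j<k. ?U \<iota> j (xs ! j)) = (\<Prod>j<k. if j = 0 then T \<iota> else 1)"
        using True by (intro prod.cong) auto
      also have "\<dots> = T \<iota>" using k by (subst prod.delta) auto
      finally show ?thesis using True by simp
    next
      case False
      then obtain j where "j < k" "xs ! j \<noteq> \<iota> ! j"
        using xs \<iota> by (metis nth_equalityI tidx_length)
      hence "(\<Prod>j<k. ?U \<iota> j (xs ! j)) = 0" by (intro prod_zero bexI[of _ j]) auto
      thus ?thesis using False by simp
    qed
    thus ?thesis using xs by simp
  qed
  hence "T = (\<lambda>xs. if xs \<in> tidx m k then \<Sum>l<m ^ k. \<Prod>j<k. V (l, j, xs ! j) else 0)"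
    using V T by (auto simp: fun_eq_iff Ten_def)
  thus ?thesis using rank_leI[where m = m and k = k and r = "m ^ k" and V = V] by simp
qed

lemma subset_zariski_closure: "A \<subseteq> Ten m k \<Longrightarrow> A \<subseteq> zariski_closure m k A"
  unfolding zariski_closure_def by blast

lemma brk_closure:
  assumes "T \<in> Ten m k" "k \<ge> 1"
  shows "T \<in> zariski_closure m k (rank_le m k (brk m k T))" "brk m k T \<le> m ^ k"
proof -
  have *: "T \<in> zariski_closure m k (rank_le m k (m ^ k))"
    using Ten_rank_le[OF assms] subset_zariski_closure[OF rank_le_subset_Ten] by blast
  show "T \<in> zariski_closure m k (rank_le m k (brk m k T))" unfolding brk_def by (rule LeastI[where P = "\<lambda>r. T \<in> zariski_closure m k (rank_le m k r)", OF *])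
  show "brk m k T \<le> m ^ k" unfolding brk_def by (rule Least_le[where P = "\<lambda>r. T \<in> zariski_closure m k (rank_le m k r)", OF *])
qed

lemma poly_fun_pexp:
  assumes "poly_fun I p"
  shows "\<exists>e. set2_pexp e \<subseteq> I \<and> (\<forall>T. p T = peval id T e)"
  using assms
proof (induction p rule: poly_fun.induct)
  case (const c)
  show ?case by (intro exI[of _ "Const c"]) simp
next
  case (coord xs)
  thus ?case by (intro exI[of _ "Var xs"]) simp
next
  case (add p q)
  then obtain e e' where "set2_pexp e \<subseteq> I \<and> (\<forall>T. p T = peval id T e)" "set2_pexp e' \<subseteq> I \<and> (\<forall>T. q T = peval id T e')" by blast
  thus ?case by (intro exI[of _ "Add e e'"]) (simp add: id_def)
next
  case (mult p q)
  then obtain e e' where "set2_pexp e \<subseteq> I \<and> (\<forall>T. p T = peval id T e)" "set2_pexp e' \<subseteq> I \<and> (\<forall>T. q T = peval id T e')" by blast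
  thus ?case by (intro exI[of _ "Mul e e'"]) (simp add: id_def)
qed

lemma pexp_poly_fun: "set2_pexp e \<subseteq> I \<Longrightarrow> poly_fun I (\<lambda>T. peval id T e)"
  by (induction e) (auto intro: poly_fun.intros)

lemma linear_ten_map_expansion:
  fixes \<phi> :: "(nat list \<Rightarrow> 'a::comm_ring_1) \<Rightarrow> (nat list \<Rightarrow> 'a)"
  assumes \<phi>: "linear_ten_map n d m k \<phi>" and T: "T \<in> Ten n d"
  shows "\<phi> T xs = (\<Sum>c\<in>tidx n d. T c * \<phi> (\<lambda>x. if x = c then 1 else 0) xs)"
proof -
  let ?e = "\<lambda>c x. if x = c then 1 else (0 :: 'a)"
  have add: "\<phi> (\<lambda>i. x i + y i) = (\<lambda>i. \<phi> x i + \<phi> y i)" if "x \<in> Ten n d" "y \<in> Ten n d" for x y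
    using \<phi> that unfolding linear_ten_map_def by blast
  have scale: "\<phi> (\<lambda>i. c * x i) = (\<lambda>i. c * \<phi> x i)" if "x \<in> Ten n d" for c x
    using \<phi> that unfolding linear_ten_map_def by blast
  have e: "?e c \<in> Ten n d" if "c \<in> tidx n d" for c using that by (auto simp: Ten_def)
  have "C \<subseteq> tidx n d \<Longrightarrow> (\<lambda>x. \<Sum>c\<in>C. T c * ?e c x) \<in> Ten n d \<and>
    \<phi> (\<lambda>x. \<Sum>c\<in>C. T c * ?e c x) = (\<lambda>xs. \<Sum>c\<in>C. T c * \<phi> (?e c) xs)" if "finite C" for C
    using that
  proof (induction C rule: finite_induct)
    case empty
    have "(\<lambda>x. 0 :: 'a) \<in> Ten n d" by (simp add: Ten_def)
    from scale[OF this, of 0] show ?case by (simp add: Ten_def)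
  next
    case (insert c C)
    have c: "c \<in> tidx n d" using insert by simp
    have t: "(\<lambda>x. T c * ?e c x) \<in> Ten n d" using c by (auto simp: Ten_def)
    have IH: "(\<lambda>x. \<Sum>c\<in>C. T c * ?e c x) \<in> Ten n d"
      "\<phi> (\<lambda>x. \<Sum>c\<in>C. T c * ?e c x) = (\<lambda>xs. \<Sum>c\<in>C. T c * \<phi> (?e c) xs)" using insert by auto
    have "(\<lambda>x. T c * ?e c x + (\<Sum>c\<in>C. T c * ?e c x)) \<in> Ten n d" using t IH(1) by (simp add: Ten_def)
    thus ?case using add[OF t IH(1)] scale[OF e[OF c], of "T c"] IH(2) insert(1,2) by simp
  qed
  from this[OF finite_tidx order_refl] have
    "\<phi> (\<lambda>x. \<Sum>c\<in>tidx n d. T c * ?e c x) = (\<lambda>xs. \<Sum>c\<in>tidx n d. T c * \<phi> (?e c) xs)" by blast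
  moreover have "(\<lambda>x. \<Sum>c\<in>tidx n d. T c * ?e c x) = T"
  proof
    fix x show "(\<Sum>c\<in>tidx n d. T c * ?e c x) = T x"
      using T by (cases "x \<in> tidx n d") (auto simp: Ten_def if_distrib cong: if_cong)
  qed
  ultimately show ?thesis by (simp add: fun_eq_iff)
qed

primrec psubst :: "('v \<Rightarrow> ('a, 'w) pexp) \<Rightarrow> ('a, 'v) pexp \<Rightarrow> ('a, 'w) pexp" where
  "psubst f (Const c) = Const c"
| "psubst f (Var v) = f v"
| "psubst f (Add p q) = Add (psubst f p) (psubst f q)"
| "psubst f (Mul p q) = Mul (psubst f p) (psubst f q)"

lemma peval_psubst: "peval h \<rho> (psubst f p) = peval h (\<lambda>v. peval h \<rho> (f v)) p"
  by (induction p) simp_all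

text \<open>\<open>w\<close> is a specialization of \<open>y\<close>. Only variables in
  \<open>W\<close> count, as the equations of a closure involve only coordinates from the index
  set.\<close>

lemma eval_hom_exists:
  fixes g :: "'c::comm_ring_1 \<Rightarrow> 'e::comm_ring_1" and h :: "'c \<Rightarrow> 'k::comm_ring_1"
  assumes g: "hom_on UNIV g" and h: "hom_on UNIV h"
    and ker: "\<And>p. set2_pexp p \<subseteq> W \<Longrightarrow> peval g y p = 0 \<Longrightarrow> peval h w p = 0"
  shows "\<exists>q. hom_on {peval g y p | p. set2_pexp p \<subseteq> W} q \<and> (\<forall>p. set2_pexp p \<subseteq> W \<longrightarrow> q (peval g y p) = peval h w p)"
proof -
  have eq: "peval h w p = peval h w p'" if "set2_pexp p \<subseteq> W" "set2_pexp p' \<subseteq> W" "peval g y p = peval g y p'" for p p'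
  proof -
    have "peval h w (Add p (Mul (Const (-1)) p')) = 0"
      using that by (intro ker) (auto simp: hom_on_more(1)[OF g is_subring_UNIV] hom_onD(2)[OF g])
    thus ?thesis by (simp add: hom_on_more(1)[OF h is_subring_UNIV] hom_onD(2)[OF h])
  qed
  define q where "q x = peval h w (SOME p. set2_pexp p \<subseteq> W \<and> peval g y p = x)" for x
  have q: "q (peval g y p) = peval h w p" if p: "set2_pexp p \<subseteq> W" for p
  proof -
    let ?P = "\<lambda>p'. set2_pexp p' \<subseteq> W \<and> peval g y p' = peval g y p"
    have "?P (SOME p'. ?P p')" by (rule someI[of ?P p]) (use p in simp)
    thus ?thesis unfolding q_def using eq[OF _ p] by blast
  qed
  have "hom_on {peval g y p | p. set2_pexp p \<subseteq> W} q"
    unfolding hom_on_def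
  proof (intro conjI ballI)
    show "q 0 = 0" using q[of "Const 0"] by (simp add: hom_onD(1)[OF g] hom_onD(1)[OF h])
    show "q 1 = 1" using q[of "Const 1"] by (simp add: hom_onD(2)[OF g] hom_onD(2)[OF h])
    fix a b assume "a \<in> {peval g y p | p. set2_pexp p \<subseteq> W}" "b \<in> {peval g y p | p. set2_pexp p \<subseteq> W}"
    then obtain p p' where p: "a = peval g y p" "set2_pexp p \<subseteq> W" "b = peval g y p'" "set2_pexp p' \<subseteq> W" by blast
    show "q (a + b) = q a + q b" using q[of "Add p p'"] q[OF p(2)] q[OF p(4)] p by simp
    show "q (a * b) = q a * q b" using q[of "Mul p p'"] q[OF p(2)] q[OF p(4)] p by simp
  qed
  thus ?thesis using q by blast
qed

subsection \<open>The bound\<close>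

definition rank_pexp :: "nat \<Rightarrow> nat \<Rightarrow> nat list \<Rightarrow> ('a::{zero, one}, nat \<times> nat \<times> nat) pexp" where
  "rank_pexp r k xs = psum (\<lambda>l. pprod (\<lambda>j. Var (l, j, xs ! j)) k) r"

lemma peval_rank_pexp:
  "h 0 = 0 \<Longrightarrow> h 1 = 1 \<Longrightarrow> peval h \<rho> (rank_pexp r k xs) = (\<Sum>l<r. \<Prod>j<k. \<rho> (l, j, xs ! j))"
  by (simp add: rank_pexp_def peval_psum peval_pprod)

text \<open>The parametrization of tensors of rank at most \<open>r\<close> is defined over the base field, so equations of
  the closure persist over every extension field.\<close>
lemma closure_equation_extend:
  fixes h :: "'a::field_char_0 \<Rightarrow> 'w::field"
  assumes h: "hom_on UNIV h" and e: "set2_pexp e \<subseteq> tidx m k"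
    and van: "\<And>T. T \<in> rank_le m k r \<Longrightarrow> peval id T e = 0"
  shows "peval h (\<lambda>xs. \<Sum>l<r. \<Prod>j<k. V (l, j, xs ! j)) e = 0"
proof -
  let ?p = "psubst (rank_pexp r k) e"
  have base: "peval id \<rho> ?p = 0" for \<rho>
  proof -
    have "peval id \<rho> ?p = peval id (\<lambda>xs. \<Sum>l<r. \<Prod>j<k. \<rho> (l, j, xs ! j)) e"
      by (simp add: peval_psubst peval_rank_pexp)
    also have "\<dots> = peval id (\<lambda>xs. if xs \<in> tidx m k then \<Sum>l<r. \<Prod>j<k. \<rho> (l, j, xs ! j) else 0) e"
      using e by (intro peval_cong) auto
    also have "\<dots> = 0" by (rule van[OF rank_leI])
    finally show ?thesis .
  qed
  have inj: "inj h"
  proof (rule injI)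
    fix a b assume "h a = h b"
    hence "h (a - b) = 0" using hom_on_more(2)[OF h is_subring_UNIV] by simp
    hence "h ((a - b) * inverse (a - b)) = 0" using hom_onD(4)[OF h] by simp
    thus "a = b" using hom_onD(2)[OF h] by (cases "a - b = 0") auto
  qed
  hence inf: "infinite (range h)" using finite_imageD infinite_UNIV_char_0 by blast
  \<comment> \<open>It suffices to test assignments with values in the infinite set
    \<open>range h\<close>, where the value is the \<open>h\<close>-image of one over the base
    field.\<close>
  have "peval h \<rho> ?p = 0" for \<rho> :: "nat \<times> nat \<times> nat \<Rightarrow> 'w"
  proof (rule peval_vanish[OF inf])
    fix \<rho> :: "nat \<times> nat \<times> nat \<Rightarrow> 'w" assume \<rho>: "\<And>v. \<rho> v \<in> range h"
    define \<sigma> where "\<sigma> v = inv_into UNIV h (\<rho> v)" for v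
    have \<sigma>: "\<rho> v = h (\<sigma> v)" for v unfolding \<sigma>_def by (rule f_inv_into_f[OF \<rho>, symmetric])
    have \<rho>\<sigma>: "(\<lambda>v. h (\<sigma> v)) = \<rho>" by (rule ext) (rule \<sigma>[symmetric])
    have "peval h \<rho> ?p = h (peval id \<sigma> ?p)" unfolding peval_hom[OF h] \<rho>\<sigma> by simp
    thus "peval h \<rho> ?p = 0" using base hom_onD(1)[OF h] by simp
  qed
  from this[of V] show ?thesis by (simp add: peval_psubst peval_rank_pexp hom_onD(1,2)[OF h])
qed

lemma gconst_inverse: "inverse (gconst c :: ('a::field_char_0, 'v) genfield) = gconst (inverse c)"
proof (cases "c = 0")
  case True
  thus ?thesis by (simp add: hom_onD(1)[OF hom_on_gconst])
next
  case False
  have "(gconst c * gconst (inverse c) :: ('a, 'v) genfield) = gconst (c * inverse c)"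
    by (simp only: hom_onD(4)[OF hom_on_gconst] UNIV_I)
  also have "\<dots> = 1" using False by (simp add: hom_onD(2)[OF hom_on_gconst])
  finally show ?thesis by (rule inverse_unique)
qed

lemma is_subring_range_gconst: "is_subring (range (gconst :: 'a::field_char_0 \<Rightarrow> ('a, 'v) genfield))"
  unfolding is_subring_def
proof (intro conjI ballI)
  let ?g = "gconst :: 'a \<Rightarrow> ('a, 'v) genfield"
  note h = hom_on_gconst[where 'a = 'a and 'v = 'v]
  show "1 \<in> range ?g" using hom_onD(2)[OF h] by (metis rangeI)
  fix a assume "a \<in> range ?g"
  then obtain x where x: "a = ?g x" by blast
  show "- a \<in> range ?g" unfolding x using hom_on_more(1)[OF h is_subring_UNIV, of x] by (metis UNIV_I rangeI)
  fix b assume "b \<in> range ?g"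
  then obtain y where y: "b = ?g y" by blast
  show "a + b \<in> range ?g" "a * b \<in> range ?g" unfolding x y
    using hom_onD(3,4)[OF h, of x y] by (metis UNIV_I rangeI)+
qed

lemma infinite_range_gconst: "infinite (range (gconst :: 'a::field_char_0 \<Rightarrow> ('a, 'v) genfield))"
proof -
  have "inj (gconst :: 'a \<Rightarrow> ('a, 'v) genfield)"
  proof (rule injI)
    fix a b :: 'a assume "(gconst a :: ('a, 'v) genfield) = gconst b"
    hence "(gconst (a - b) :: ('a, 'v) genfield) = 0" by (simp add: hom_on_more(2)[OF hom_on_gconst is_subring_UNIV])
    thus "a = b" by (simp add: gconst_eq_0_iff)
  qed
  thus ?thesis using finite_imageD infinite_UNIV_char_0 by blast
qed

text \<open>The hypothesis says that sending the entries of the generic tensor of rank \<open>a\<close> to those of the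
  generic multilinear value is a well-defined ring homomorphism; curve selection applies to it.\<close>
lemma generic_border_decomposition:
  fixes \<Phi> :: "nat list \<Rightarrow> nat list \<Rightarrow> 'a::{alg_closed_field, field_char_0}"
  assumes clo: "\<And>v :: nat \<times> nat \<Rightarrow> 'a. (\<lambda>xs. if xs \<in> tidx m k then \<Sum>c\<in>tidx n d. (\<Prod>i<d. v (i, c ! i)) * \<Phi> c xs else 0)
      \<in> zariski_closure m k (rank_le m k a)"
  shows "\<exists>(x :: nat \<times> nat \<times> nat \<Rightarrow> ('a, nat \<times> nat) genfield fls) y.
    (\<forall>xs\<in>tidx m k. fps_to_fls (y xs) = (\<Sum>l<a. \<Prod>j<k. x (l, j, xs ! j)) \<and>
      fps_nth (y xs) 0 = (\<Sum>c\<in>tidx n d. (\<Prod>i<d. gvar (i, c ! i)) * gconst (\<Phi> c xs)))"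
proof -
  \<comment> \<open>Two generic fields: the variables of \<open>?g\<close> are the entries of an
    undetermined decomposition, those of \<open>?h\<close> the entries of the undetermined vectors
    \<open>v\<close>.\<close>
  let ?g = "gconst :: 'a \<Rightarrow> ('a, nat \<times> nat \<times> nat) genfield"
  let ?h = "gconst :: 'a \<Rightarrow> ('a, nat \<times> nat) genfield"
  define Y where "Y xs = (\<Sum>l<a. \<Prod>j<k. gvar (l, j, xs ! j) :: ('a, nat \<times> nat \<times> nat) genfield)" for xs
  define w where "w xs = (\<Sum>c\<in>tidx n d. (\<Prod>i<d. gvar (i, c ! i)) * ?h (\<Phi> c xs))" for xs
  note gD = hom_onD(1,2)[OF hom_on_gconst]
  obtain cs where cs: "set cs = tidx n d" "distinct cs" using finite_distinct_list[OF finite_tidx] by blast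
  have sumc: "(\<Sum>c\<in>tidx n d. f c) = (\<Sum>t<length cs. f (cs ! t))" for f :: "nat list \<Rightarrow> 'r::comm_monoid_add"
    using sum.reindex_bij_betw[OF bij_betw_nth[OF cs(2) refl cs(1)[symmetric]], of f] by simp
  define W where "W xs = psum (\<lambda>t. Mul (pprod (\<lambda>i. Var (i, cs ! t ! i)) d) (Const (\<Phi> (cs ! t) xs))) (length cs)" for xs
  have Wh: "peval ?h gvar (W xs) = w xs" for xs
    by (simp add: W_def w_def peval_psum peval_pprod gD sumc)
  have Wid: "peval id v (W xs) = (\<Sum>c\<in>tidx n d. (\<Prod>i<d. v (i, c ! i)) * \<Phi> c xs)" for v xs
    by (simp add: W_def peval_psum peval_pprod sumc)
  \<comment> \<open>A relation of the generic tensor of rank \<open>a\<close> holds on all tensors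
    of rank at most \<open>a\<close>, hence on the closure, hence at the multilinear value for every
    \<open>v\<close>, hence for generic \<open>v\<close>.\<close>
  have ker: "peval ?h w p = 0" if p: "set2_pexp p \<subseteq> tidx m k" "peval ?g Y p = 0" for p
  proof -
    have "peval ?g gvar (psubst (rank_pexp a k) p) = 0"
      using p(2) by (simp add: peval_psubst peval_rank_pexp gD Y_def[abs_def])
    note 0 = peval_generic_eq_0[OF this]
    have van: "peval id T p = 0" if T: "T \<in> rank_le m k a" for T
    proof -
      obtain V where V: "\<And>xs. T xs = (if xs \<in> tidx m k then \<Sum>l<a. \<Prod>j<k. V (l, j, xs ! j) else 0)"
        by (rule rank_leE[OF T], rule that)
      have "peval id T p = peval id (\<lambda>xs. \<Sum>l<a. \<Prod>j<k. V (l, j, xs ! j)) p"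
        using p(1) by (intro peval_cong) (auto simp: V)
      also have "\<dots> = 0" using 0[of V] by (simp add: peval_psubst peval_rank_pexp)
      finally show ?thesis .
    qed
    have "peval id v (psubst W p) = 0" for v
    proof -
      have "peval id v (psubst W p) =
        peval id (\<lambda>xs. if xs \<in> tidx m k then \<Sum>c\<in>tidx n d. (\<Prod>i<d. v (i, c ! i)) * \<Phi> c xs else 0) p"
        unfolding peval_psubst using p(1) by (intro peval_cong) (auto simp: Wid)
      also have "\<dots> = 0"
        using clo[of v] pexp_poly_fun[OF p(1)] van unfolding zariski_closure_def by blast
      finally show ?thesis .
    qed
    hence "peval ?h gvar (psubst W p) = 0" by (simp add: peval_generic gembed_hom pfun_eq_0_iff)
    thus ?thesis by (simp add: peval_psubst Wh)
  qed
  from eval_hom_exists[OF hom_on_gconst hom_on_gconst, of "tidx m k" Y w, OF ker] obtain q where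
    q: "hom_on {peval ?g Y p | p. set2_pexp p \<subseteq> tidx m k} q"
      "\<And>p. set2_pexp p \<subseteq> tidx m k \<Longrightarrow> q (peval ?g Y p) = peval ?h w p" by blast
  let ?R = "range ?g"
  note R = is_subring_range_gconst[where 'a = 'a and 'v = "nat \<times> nat \<times> nat"]
  obtain il where il: "set il = tidx m k" using finite_list[OF finite_tidx] by blast
  define ys where "ys = map Y il"
  have "adjoins ?R ys \<subseteq> {peval ?g Y p | p. set2_pexp p \<subseteq> tidx m k}" (is "_ \<subseteq> ?P")
  proof (rule adjoins_least)
    have mem: "peval ?g Y p \<in> ?P" if "set2_pexp p \<subseteq> tidx m k" for p using that by blast
    show "is_subring ?P" unfolding is_subring_def
    proof (intro conjI ballI)
      show "1 \<in> ?P" using mem[of "Const 1"] by (simp add: gD)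
      fix x assume "x \<in> ?P"
      then obtain p where p: "x = peval ?g Y p" "set2_pexp p \<subseteq> tidx m k" by blast
      show "- x \<in> ?P" using mem[of "Mul (Const (- 1)) p"] p
        by (simp add: hom_on_more(1)[OF hom_on_gconst is_subring_UNIV] gD)
      fix y assume "y \<in> ?P"
      then obtain p' where p': "y = peval ?g Y p'" "set2_pexp p' \<subseteq> tidx m k" by blast
      show "x + y \<in> ?P" using mem[of "Add p p'"] p p' by simp
      show "x * y \<in> ?P" using mem[of "Mul p p'"] p p' by simp
    qed
    show "?R \<subseteq> ?P"
    proof
      fix x assume "x \<in> ?R"
      then obtain c where "x = ?g c" by blast
      thus "x \<in> ?P" using mem[of "Const c"] by simp
    qed
    show "set ys \<subseteq> ?P"
    proof
      fix x assume "x \<in> set ys"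
      then obtain xs where "x = Y xs" "xs \<in> tidx m k" by (auto simp: ys_def il)
      thus "x \<in> ?P" using mem[of "Var xs"] by simp
    qed
  qed
  hence qA: "hom_on (adjoins ?R ys) q" by (rule hom_on_subset[OF q(1)])
  \<comment> \<open>The variables of the decomposition serve as the extra elements of curve
    selection; their images, poles allowed, are the vectors over Laurent series.\<close>
  define gs where "gs = [gvar (l, j, u) :: ('a, nat \<times> nat \<times> nat) genfield. l \<leftarrow> [0..<a], j \<leftarrow> [0..<k], u \<leftarrow> [0..<m]]"
  have gs: "gvar (l, j, u) \<in> set gs" if "l < a" "j < k" "u < m" for l j u
    using that unfolding gs_def by force
  obtain J where J: "hom_on (adjoins ?R (ys @ gs)) J"
    "\<And>x. x \<in> adjoins ?R ys \<Longrightarrow> J x \<in> fls_int \<and> fls_nth (J x) 0 = q x"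
  proof -
    have inv: "y \<in> ?R \<Longrightarrow> inverse y \<in> ?R" for y by (auto simp: gconst_inverse)
    show ?thesis using curve_selection[OF R inv infinite_range_gconst qA, of gs] that by blast
  qed
  note T = is_subring_adjoins[OF R, of "ys @ gs"]
  define x where "x v = J (gvar v)" for v
  have "fps_to_fls (fls_regpart (J (Y xs))) = (\<Sum>l<a. \<Prod>j<k. x (l, j, xs ! j)) \<and>
      fps_nth (fls_regpart (J (Y xs))) 0 = w xs" if xs: "xs \<in> tidx m k" for xs
  proof -
    have "Y xs \<in> set ys" using xs by (simp add: ys_def il)
    hence Yxs: "Y xs \<in> adjoins ?R ys" by (rule adjoins_gen[OF R])
    have g: "gvar (l, j, xs ! j) \<in> adjoins ?R (ys @ gs)" if "l < a" "j < k" for l j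
      using gs[OF that tidx_nth[OF xs that(2)]] by (intro adjoins_gen[OF R]) simp
    have "J (Y xs) = (\<Sum>l<a. J (\<Prod>j<k. gvar (l, j, xs ! j)))"
      unfolding Y_def by (rule hom_on_sum[OF J(1) T]) (intro subring_prod[OF T] g; simp)
    also have "\<dots> = (\<Sum>l<a. \<Prod>j<k. J (gvar (l, j, xs ! j)))"
      by (intro sum.cong refl hom_on_prod[OF J(1) T] g) simp_all
    finally have "J (Y xs) = (\<Sum>l<a. \<Prod>j<k. x (l, j, xs ! j))" by (simp add: x_def)
    moreover have "fps_to_fls (fls_regpart (J (Y xs))) = J (Y xs)"
      using J(2)[OF Yxs] by (intro fls_regpart_to_fls_trivial) (simp add: fls_int_iff)
    moreover have "q (Y xs) = w xs" using q(2)[of "Var xs"] xs by simp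
    hence "fps_nth (fls_regpart (J (Y xs))) 0 = w xs" using J(2)[OF Yxs] by simp
    ultimately show ?thesis by simp
  qed
  thus ?thesis unfolding w_def by (intro exI[of _ x] exI[of _ "\<lambda>xs. fls_regpart (J (Y xs))"]) blast
qed

text \<open>The monomial contains exactly one variable per position, so the derivation at position
  \<open>e\<close> either strips that variable or kills the whole term.\<close>

lemma iter_deriv_generic_monomial:
  fixes D :: "nat \<Rightarrow> nat \<Rightarrow> ('a::field_char_0, nat \<times> nat) genfield \<Rightarrow> ('a, nat \<times> nat) genfield"
  assumes D: "\<And>i u. derivation_on UNIV (D i u)"
    and var: "\<And>i u i' u'. D i u (gvar (i', u')) = (if i' = i \<and> u' = u then 1 else 0)"
    and const: "\<And>i u c. D i u (gconst c) = 0"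
  shows "e \<le> d \<Longrightarrow> iter_deriv D c UNIV e ((\<Prod>i<d. gvar (i, b ! i)) * gconst t) =
    (if \<forall>i<e. b ! i = c ! i then (\<Prod>i\<in>{e..<d}. gvar (i, b ! i)) * gconst t else 0)"
proof (induction e)
  case 0
  show ?case by (simp add: lessThan_atLeast0)
next
  case (Suc e)
  note d = derivation_onD[OF D is_subring_UNIV]
  let ?D = "D e (c ! e)"
  let ?r = "(\<Prod>i\<in>{Suc e..<d}. gvar (i, b ! i)) * gconst t"
  have p0: "?D (\<Prod>i\<in>I. gvar (i, b ! i)) = 0" if "finite I" "e \<notin> I" for I
    using that
  proof (induction I rule: finite_induct)
    case empty
    have "?D (gconst 1) = 0" by (rule const)
    thus ?case by (simp add: hom_onD(2)[OF hom_on_gconst])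
  next
    case (insert i I)
    thus ?case by (simp add: d(2) var)
  qed
  have r0: "?D ?r = 0" by (simp add: d(2) p0 const)
  have "{e..<d} = insert e {Suc e..<d}" using Suc.prems by auto
  hence split: "(\<Prod>i\<in>{e..<d}. gvar (i, b ! i)) * gconst t = gvar (e, b ! e) * ?r" by (simp add: mult.assoc)
  have "?D (gvar (e, b ! e) * ?r) = (if b ! e = c ! e then ?r else 0)"
  proof -
    have "?D (gvar (e, b ! e) * ?r) = ?D (gvar (e, b ! e)) * ?r + gvar (e, b ! e) * ?D ?r" by (rule d(2)) simp_all
    thus ?thesis unfolding r0 by (simp add: var)
  qed
  thus ?case using Suc by (auto simp: split d(3) less_Suc_eq)
qed

text \<open>The original map enters only through its coordinates, \<open>\<Phi> c\<close> being the
  image of the basis tensor with index \<open>c\<close>; the hypothesis concerns decomposable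
  tensors, the conclusion an arbitrary \<open>t\<close>.\<close>

theorem multilinear_border_bound:
  fixes \<Phi> :: "nat list \<Rightarrow> nat list \<Rightarrow> 'a::{alg_closed_field, field_char_0}"
  assumes n: "n \<ge> 1" and k: "k \<ge> 1"
    and clo: "\<And>v :: nat \<times> nat \<Rightarrow> 'a. (\<lambda>xs. if xs \<in> tidx m k then \<Sum>c\<in>tidx n d. (\<Prod>i<d. v (i, c ! i)) * \<Phi> c xs else 0)
      \<in> zariski_closure m k (rank_le m k a)"
  shows "(\<lambda>xs. if xs \<in> tidx m k then \<Sum>c\<in>tidx n d. t c * \<Phi> c xs else 0)
      \<in> zariski_closure m k (rank_le m k (a * k ^ d * n ^ ((k - 1) * d div k)))"
proof -
  let ?r = "a * k ^ d * n ^ ((k - 1) * d div k)"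
  obtain x :: "nat \<times> nat \<times> nat \<Rightarrow> ('a, nat \<times> nat) genfield fls" and y where
    xy: "\<And>xs. xs \<in> tidx m k \<Longrightarrow> fps_to_fls (y xs) = (\<Sum>l<a. \<Prod>j<k. x (l, j, xs ! j))"
    and y0: "\<And>xs. xs \<in> tidx m k \<Longrightarrow> fps_nth (y xs) 0 = (\<Sum>c\<in>tidx n d. (\<Prod>i<d. gvar (i, c ! i)) * gconst (\<Phi> c xs))"
    using generic_border_decomposition[OF clo] by blast
  define B where "B = {..<a} \<times> {..<k} \<times> {..<m}"
  \<comment> \<open>A common bound for the pole orders that occur. After multiplication by
    \<open>X^N\<close> the Leibniz rule can be applied to power series, at the cost of
    \<open>X^(N * k)\<close> per product of \<open>k\<close> factors.\<close>
  define N where "N = Max (insert 0 ((\<lambda>v. nat (- fls_subdegree (x v))) ` B))"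
  have N: "- fls_subdegree (x v) \<le> int N" if "v \<in> B" for v
  proof -
    have "nat (- fls_subdegree (x v)) \<le> N" unfolding N_def using that by (intro Max_ge) (auto simp: B_def)
    thus ?thesis by linarith
  qed
  define x' where "x' v = fls_regpart (fls_X ^ N * x v)" for v
  have x': "fps_to_fls (x' v) = fls_X ^ N * x v" if "v \<in> B" for v
  proof (cases "x v = 0")
    case False
    thus ?thesis unfolding x'_def using N[OF that] by (intro fls_regpart_to_fls_trivial) simp
  qed (simp add: x'_def)
  have rel: "fps_X ^ (N * k) * y xs = (\<Sum>l<a. \<Prod>j<k. x' (l, j, xs ! j))" if xs: "xs \<in> tidx m k" for xs
  proof -
    have h: "hom_on UNIV (fps_to_fls :: ('a, nat \<times> nat) genfield fps \<Rightarrow> _)"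
      by (simp add: hom_on_def fls_times_fps_to_fls)
    have "fps_to_fls (\<Sum>l<a. \<Prod>j<k. x' (l, j, xs ! j)) = (\<Sum>l<a. \<Prod>j<k. fps_to_fls (x' (l, j, xs ! j)))"
      by (simp add: hom_on_sum[OF h is_subring_UNIV] hom_on_prod[OF h is_subring_UNIV])
    also have "\<dots> = (\<Sum>l<a. \<Prod>j<k. fls_X ^ N * x (l, j, xs ! j))"
      using tidx_nth[OF xs] by (intro sum.cong prod.cong refl x') (auto simp: B_def)
    also have "\<dots> = fls_X ^ (N * k) * fps_to_fls (y xs)"
      by (simp add: xy[OF xs] prod.distrib power_mult sum_distrib_left)
    also have "\<dots> = fps_to_fls (fps_X ^ (N * k) * y xs)"
      by (simp add: fls_times_fps_to_fls fps_to_fls_power)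
    finally show ?thesis by simp
  qed
  define isD where "isD v D \<longleftrightarrow> derivation_on UNIV D \<and>
    (\<forall>p. D (peval gconst gvar p) = (peval gconst gvar (dpexp v p) :: ('a, nat \<times> nat) genfield))" for v D
  define D where "D i u = (SOME D. isD (i, u) D)" for i u
  have "isD (i, u) (D i u)" for i u
  proof -
    have "\<exists>D. isD (i, u) D" unfolding isD_def by (rule partial_derivation)
    thus ?thesis unfolding D_def by (rule someI_ex)
  qed
  hence D: "\<And>i u. derivation_on UNIV (D i u)" "\<And>i u p. D i u (peval gconst gvar p) = peval gconst gvar (dpexp (i, u) p)"
    by (simp_all add: isD_def)
  have gD: "gconst 0 = (0 :: ('a, nat \<times> nat) genfield)" "gconst 1 = (1 :: ('a, nat \<times> nat) genfield)"
    by (simp_all add: hom_onD(1,2)[OF hom_on_gconst])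
  have Dvar: "D i u (gvar (i', u')) = (if i' = i \<and> u' = u then 1 else 0)" for i u i' u'
    using D(2)[of i u "Var (i', u')"] by (simp add: gD)
  have Dconst: "D i u (gconst s) = 0" for i u s using D(2)[of i u "Const s"] by (simp add: gD)
  let ?F = "\<lambda>i u. fps_deriv_coeffs (D i u)"
  note DF = derivation_on_fps_deriv_coeffs[OF D(1)]
  \<comment> \<open>Derivatives of the curve weighted by \<open>t\<close>: the constant term is the
    tensor to be bounded, while the product rule decomposes the whole series.\<close>
  define Z where "Z xs = (\<Sum>c\<in>tidx n d. fps_const (gconst (t c)) * iter_deriv ?F c UNIV d (y xs))" for xs
  have Z0: "fps_nth (Z xs) 0 = gconst (\<Sum>c\<in>tidx n d. t c * \<Phi> c xs)" if xs: "xs \<in> tidx m k" for xs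
  proof -
    have "iter_deriv D c UNIV d (fps_nth (y xs) 0) = gconst (\<Phi> c xs)" if c: "c \<in> tidx n d" for c
    proof -
      have "iter_deriv D c UNIV d (fps_nth (y xs) 0) =
        (\<Sum>b\<in>tidx n d. if \<forall>i<d. b ! i = c ! i then gconst (\<Phi> b xs) else 0)"
        unfolding y0[OF xs] iter_deriv_sum[of D, OF D(1)]
        by (intro sum.cong refl, subst iter_deriv_generic_monomial[of D, OF D(1) Dvar Dconst order_refl]) auto
      also have "\<dots> = (\<Sum>b\<in>tidx n d. if b = c then gconst (\<Phi> b xs) else 0)"
      proof (rule sum.cong[OF refl])
        fix b assume b: "b \<in> tidx n d"
        have "(\<forall>i<d. b ! i = c ! i) \<longleftrightarrow> b = c"
          using tidx_length[OF b] tidx_length[OF c] by (auto intro: nth_equalityI)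
        thus "(if \<forall>i<d. b ! i = c ! i then gconst (\<Phi> b xs) else 0) = (if b = c then gconst (\<Phi> b xs) else 0)" by simp
      qed
      finally show ?thesis using c by simp
    qed
    hence "fps_nth (Z xs) 0 = (\<Sum>c\<in>tidx n d. gconst (t c) * gconst (\<Phi> c xs))"
      by (simp add: Z_def fps_sum_nth iter_deriv_fps(1)[of D, OF D(1)])
    thus ?thesis by (simp add: hom_on_sum[OF hom_on_gconst is_subring_UNIV] hom_onD(4)[OF hom_on_gconst])
  qed
  define G where "G l \<sigma> j c u = iter_deriv ?F c {i. i < d \<and> \<sigma> ! i = j} d (x' (l, j, u))" for l \<sigma> j c u
  have Zsum: "fps_X ^ (N * k) * Z xs = (\<Sum>l<a. \<Sum>\<sigma>\<in>tidx k d. \<Sum>c\<in>tidx n d. fps_const (gconst (t c)) * (\<Prod>j<k. G l \<sigma> j c (xs ! j)))"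
    if xs: "xs \<in> tidx m k" for xs
  proof -
    have "fps_X ^ (N * k) * Z xs =
      (\<Sum>c\<in>tidx n d. fps_const (gconst (t c)) * iter_deriv ?F c UNIV d (fps_X ^ (N * k) * y xs))"
      unfolding Z_def iter_deriv_fps(2)[of D, OF D(1)] sum_distrib_left by (simp add: mult_ac)
    also have "\<dots> = (\<Sum>c\<in>tidx n d. \<Sum>l<a. \<Sum>\<sigma>\<in>tidx k d. fps_const (gconst (t c)) * (\<Prod>j<k. G l \<sigma> j c (xs ! j)))"
      unfolding rel[OF xs] iter_deriv_sum[of ?F, OF DF] iter_deriv_prod[of ?F, OF DF] G_def sum_distrib_left ..
    also have "\<dots> = (\<Sum>l<a. \<Sum>c\<in>tidx n d. \<Sum>\<sigma>\<in>tidx k d. fps_const (gconst (t c)) * (\<Prod>j<k. G l \<sigma> j c (xs ! j)))"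
      by (rule sum.swap)
    also have "\<dots> = (\<Sum>l<a. \<Sum>\<sigma>\<in>tidx k d. \<Sum>c\<in>tidx n d. fps_const (gconst (t c)) * (\<Prod>j<k. G l \<sigma> j c (xs ! j)))"
      by (intro sum.cong refl sum.swap)
    finally show ?thesis .
  qed
  define dec where "dec l \<sigma> P \<longleftrightarrow> finite (fst P) \<and> card (fst P) \<le> n ^ ((k - 1) * d div k) \<and>
    (\<forall>xs. (\<Sum>c\<in>tidx n d. fps_const (gconst (t c)) * (\<Prod>j<k. G l \<sigma> j c (xs ! j))) =
      (\<Sum>\<iota>\<in>fst P. \<Prod>j<k. snd P \<iota> j (xs ! j)))"
    for l \<sigma> and P :: "nat list set \<times> (nat list \<Rightarrow> nat \<Rightarrow> nat \<Rightarrow> ('a, nat \<times> nat) genfield fps)"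
  define P where "P l \<sigma> = (SOME P. dec l \<sigma> P)" for l \<sigma>
  have "dec l \<sigma> (P l \<sigma>)" if \<sigma>: "\<sigma> \<in> tidx k d" for l \<sigma>
  proof -
    have dep: "G l \<sigma> j c u = G l \<sigma> j c' u" if "\<And>i. i < d \<Longrightarrow> \<sigma> ! i = j \<Longrightarrow> c ! i = c' ! i" for j c c' u
      unfolding G_def using that by (intro iter_deriv_cong) auto
    have "\<exists>I U. dec l \<sigma> (I, U)"
      unfolding dec_def fst_conv snd_conv
      by (rule rank_decomposition[OF \<sigma> k n, of "G l \<sigma>" "\<lambda>c. fps_const (gconst (t c))", OF dep])
    then obtain I U where "dec l \<sigma> (I, U)" by (elim exE)
    thus ?thesis unfolding P_def by (rule someI)
  qed
  note P = this[unfolded dec_def]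
  define I where "I l \<sigma> = fst (P l \<sigma>)" for l \<sigma>
  define U where "U l \<sigma> = snd (P l \<sigma>)" for l \<sigma>
  have I: "finite (I l \<sigma>)" "card (I l \<sigma>) \<le> n ^ ((k - 1) * d div k)" if "\<sigma> \<in> tidx k d" for l \<sigma>
    using P[OF that] by (simp_all add: I_def)
  have U: "(\<Sum>c\<in>tidx n d. fps_const (gconst (t c)) * (\<Prod>j<k. G l \<sigma> j c (xs ! j))) =
      (\<Sum>\<iota>\<in>I l \<sigma>. \<Prod>j<k. U l \<sigma> \<iota> j (xs ! j))" if "\<sigma> \<in> tidx k d" for l \<sigma> xs
    using P[OF that] by (simp add: I_def U_def)
  define II where "II = Sigma ({..<a} \<times> tidx k d) (\<lambda>(l, \<sigma>). I l \<sigma>)"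
  have fII: "finite II" unfolding II_def using I(1) by (intro finite_SigmaI) auto
  have "card II = (\<Sum>(l, \<sigma>)\<in>{..<a} \<times> tidx k d. card (I l \<sigma>))"
    unfolding II_def using I(1) by (subst card_SigmaI) (auto intro!: sum.cong)
  also have "\<dots> \<le> (\<Sum>_\<in>{..<a} \<times> tidx k d. n ^ ((k - 1) * d div k))"
    using I(2) by (intro sum_mono) auto
  also have "\<dots> = ?r" by (simp add: card_cartesian_product card_tidx)
  finally have cII: "card II \<le> ?r" .
  define UU where "UU = (\<lambda>((l, \<sigma>), \<iota>) j u. fps_to_fls (U l \<sigma> \<iota> j u))"
  \<comment> \<open>Over Laurent series the negative power of the uniformizer is absorbed into one
    factor of each product, so clearing poles does not raise the number of summands.\<close>
  obtain V where V: "\<And>xs. inverse (fls_X ^ (N * k)) * (\<Sum>\<iota>\<in>II. \<Prod>j<k. UU \<iota> j (xs ! j)) = (\<Sum>l<?r. \<Prod>j<k. V (l, j, xs ! j))"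
    using reindex_rank_sum[OF fII cII k] by blast
  have ZV: "fps_to_fls (Z xs) = (\<Sum>l<?r. \<Prod>j<k. V (l, j, xs ! j))" if xs: "xs \<in> tidx m k" for xs
  proof -
    have h: "hom_on UNIV (fps_to_fls :: ('a, nat \<times> nat) genfield fps \<Rightarrow> _)"
      by (simp add: hom_on_def fls_times_fps_to_fls)
    have "fls_X ^ (N * k) * fps_to_fls (Z xs) = fps_to_fls (fps_X ^ (N * k) * Z xs)"
      by (simp add: fls_times_fps_to_fls fps_to_fls_power)
    also have "fps_X ^ (N * k) * Z xs = (\<Sum>l<a. \<Sum>\<sigma>\<in>tidx k d. \<Sum>\<iota>\<in>I l \<sigma>. \<Prod>j<k. U l \<sigma> \<iota> j (xs ! j))"
      unfolding Zsum[OF xs] by (intro sum.cong refl U)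
    also have "\<dots> = (\<Sum>(l, \<sigma>)\<in>{..<a} \<times> tidx k d. \<Sum>\<iota>\<in>I l \<sigma>. \<Prod>j<k. U l \<sigma> \<iota> j (xs ! j))"
      by (rule sum.cartesian_product)
    also have "\<dots> = (\<Sum>((l, \<sigma>), \<iota>)\<in>II. \<Prod>j<k. U l \<sigma> \<iota> j (xs ! j))"
      unfolding II_def using I(1) by (subst sum.Sigma[symmetric]) (auto intro!: sum.cong)
    also have "fps_to_fls \<dots> = (\<Sum>\<iota>\<in>II. \<Prod>j<k. UU \<iota> j (xs ! j))"
      by (simp add: hom_on_sum[OF h is_subring_UNIV] hom_on_prod[OF h is_subring_UNIV] UU_def case_prod_unfold)
    finally have "fls_X ^ (N * k) * fps_to_fls (Z xs) = (\<Sum>\<iota>\<in>II. \<Prod>j<k. UU \<iota> j (xs ! j))" .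
    hence "(\<Sum>l<?r. \<Prod>j<k. V (l, j, xs ! j)) = inverse (fls_X ^ (N * k)) * (fls_X ^ (N * k) * fps_to_fls (Z xs))"
      using V by simp
    thus ?thesis by simp
  qed
  let ?T = "\<lambda>xs. if xs \<in> tidx m k then \<Sum>c\<in>tidx n d. t c * \<Phi> c xs else 0"
  have "p ?T = 0" if p: "poly_fun (tidx m k) p" and van: "\<forall>s\<in>rank_le m k ?r. p s = 0" for p
  proof -
    obtain e where e: "set2_pexp e \<subseteq> tidx m k" "\<And>T. p T = peval id T e" using poly_fun_pexp[OF p] by blast
    \<comment> \<open>The equation is evaluated over Laurent series, where the decomposition lives,
      and then at constant terms; this replaces passing to a limit.\<close>
    define h where "h s = fls_const (gconst s :: ('a, nat \<times> nat) genfield)" for s :: 'a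
    have h: "hom_on UNIV h"
      unfolding hom_on_def h_def
      by (simp add: gD hom_onD(3,4)[OF hom_on_gconst] fls_plus_const)
    have "peval h (\<lambda>xs. \<Sum>l<?r. \<Prod>j<k. V (l, j, xs ! j)) e = 0"
      using van e by (intro closure_equation_extend[OF h e(1)]) auto
    moreover have "peval h (\<lambda>xs. \<Sum>l<?r. \<Prod>j<k. V (l, j, xs ! j)) e = peval h (\<lambda>xs. fps_to_fls (Z xs)) e"
      using e(1) ZV by (intro peval_cong) auto
    ultimately have "peval h (\<lambda>xs. fps_to_fls (Z xs)) e = 0" by simp
    moreover have "fls_nth (peval h (\<lambda>xs. fps_to_fls (Z xs)) e) 0 =
        peval (\<lambda>c. fls_nth (h c) 0) (\<lambda>xs. fls_nth (fps_to_fls (Z xs)) 0) e"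
    proof (rule conjunct1[OF peval_hom_on[OF hom_on_residue is_subring_fls_int]])
      show "h c \<in> fls_int" for c unfolding h_def fls_int_def by (metis fps_const_to_fls rangeI)
      show "fps_to_fls (Z v) \<in> fls_int" for v by (simp add: fls_int_def)
    qed
    ultimately have "peval gconst (\<lambda>xs. fps_nth (Z xs) 0) e = 0" by (simp add: h_def)
    moreover have "peval gconst (\<lambda>xs. fps_nth (Z xs) 0) e = peval (\<lambda>c. gconst (id c)) (\<lambda>xs. gconst (?T xs)) e"
      using e(1) Z0 by (intro peval_cong) auto
    moreover have "\<dots> = gconst (peval id ?T e)"
      by (rule peval_hom[OF hom_on_gconst, symmetric])
    ultimately have "(gconst (p ?T) :: ('a, nat \<times> nat) genfield) = 0" unfolding e(2) by simp
    thus ?thesis by (simp add: gconst_eq_0_iff)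
  qed
  thus ?thesis unfolding zariski_closure_def by (auto simp: Ten_def)
qed

theorem theorem7p8:
  fixes \<phi> :: "(nat list \<Rightarrow> 'a::{alg_closed_field, field_char_0}) \<Rightarrow> (nat list \<Rightarrow> 'a)"
    and n m d k a :: nat
  assumes "n \<ge> 1" "m \<ge> 1" "d \<ge> 1" "k \<ge> 1"
    and "linear_ten_map n d m k \<phi>"
    and "a = Max ((\<lambda>s. brk m k (\<phi> s)) ` rank_one_tensors n d)"
    and "a \<ge> 1"
  shows "Bpot n d m k a \<phi> \<le> real (k ^ d) * real n ^ ((k - 1) * d div k)"
proof -
  note k = \<open>k \<ge> 1\<close> and \<phi> = \<open>linear_ten_map n d m k \<phi>\<close>
  define \<Phi> where "\<Phi> c = \<phi> (\<lambda>x. if x = c then 1 else 0)" for c :: "nat list"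
  have \<phi>Ten: "\<phi> T \<in> Ten m k" if "T \<in> Ten n d" for T using \<phi> that unfolding linear_ten_map_def by blast
  have \<phi>eq: "\<phi> T = (\<lambda>xs. if xs \<in> tidx m k then \<Sum>c\<in>tidx n d. T c * \<Phi> c xs else 0)" if T: "T \<in> Ten n d" for T
    using linear_ten_map_expansion[OF \<phi> T] \<phi>Ten[OF T] by (auto simp: fun_eq_iff \<Phi>_def Ten_def)
  have S_Ten: "s \<in> Ten n d" if "s \<in> simple_tensors n d" for s
    using that unfolding simple_tensors_def Ten_def by auto
  \<comment> \<open>A uniform bound on the border rank makes these images finite, so that
    \<open>Max\<close> has its intended meaning.\<close>
  have bounded: "finite ((\<lambda>T. brk m k (\<phi> T)) ` A)" if "A \<subseteq> Ten n d" for A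
  proof (rule finite_subset)
    show "(\<lambda>T. brk m k (\<phi> T)) ` A \<subseteq> {..m ^ k}" using brk_closure(2)[OF \<phi>Ten k] that by auto
  qed simp
  \<comment> \<open>The zero tensor is excluded from the tensors that define \<open>a\<close>, but
    it occurs among the products parametrized by \<open>v\<close>.\<close>
  have simple: "\<phi> s \<in> zariski_closure m k (rank_le m k a)" if s: "s \<in> simple_tensors n d" for s
  proof (cases "s = (\<lambda>_. 0)")
    case True
    have "\<phi> s = (\<lambda>_. 0)" using \<phi>eq[OF S_Ten[OF s]] unfolding True by (simp add: fun_eq_iff)
    moreover have "(\<lambda>_. 0) \<in> rank_le m k a"
      unfolding rank_le_def by (intro CollectI exI[of _ "\<lambda>_ _. 0"]) (simp add: zero_simple_tensor[OF k])
    ultimately show ?thesis using subset_zariski_closure[OF rank_le_subset_Ten] by auto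
  next
    case False
    hence r1: "s \<in> rank_one_tensors n d" using s by (simp add: rank_one_tensors_def)
    have "brk m k (\<phi> s) \<le> a"
      unfolding assms(6) using r1 S_Ten by (intro Max_ge bounded) (auto simp: rank_one_tensors_def)
    thus ?thesis
      using brk_closure(1)[OF \<phi>Ten[OF S_Ten[OF s]] k] zariski_closure_mono[OF rank_le_mono[OF _ k]] by blast
  qed
  have clo: "(\<lambda>xs. if xs \<in> tidx m k then \<Sum>c\<in>tidx n d. (\<Prod>i<d. v (i, c ! i)) * \<Phi> c xs else 0)
      \<in> zariski_closure m k (rank_le m k a)" for v :: "nat \<times> nat \<Rightarrow> 'a"
  proof -
    define s where "s = (\<lambda>c. if c \<in> tidx n d then \<Prod>i<d. v (i, c ! i) else 0)"
    have s: "s \<in> simple_tensors n d"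
      unfolding simple_tensors_def s_def
      by (intro CollectI exI[of _ "\<lambda>j i. if i < n then v (j, i) else 0"])
         (auto simp: fun_eq_iff tidx_nth intro!: prod.cong)
    have "\<phi> s = (\<lambda>xs. if xs \<in> tidx m k then \<Sum>c\<in>tidx n d. (\<Prod>i<d. v (i, c ! i)) * \<Phi> c xs else 0)"
      unfolding \<phi>eq[OF S_Ten[OF s]] by (auto simp: s_def fun_eq_iff)
    thus ?thesis using simple[OF s] by simp
  qed
  let ?r = "a * k ^ d * n ^ ((k - 1) * d div k)"
  have "brk m k (\<phi> T) \<le> ?r" if T: "T \<in> Ten n d" for T
    unfolding brk_def
  proof (rule Least_le)
    show "\<phi> T \<in> zariski_closure m k (rank_le m k ?r)"
      unfolding \<phi>eq[OF T] by (rule multilinear_border_bound[OF \<open>n \<ge> 1\<close> k clo])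
  qed
  moreover have "(\<lambda>_. 0 :: 'a) \<in> Ten n d" by (simp add: Ten_def)
  ultimately have "Max ((\<lambda>T. brk m k (\<phi> T)) ` Ten n d) \<le> ?r" by (intro Max.boundedI bounded) auto
  hence "real (Max ((\<lambda>T. brk m k (\<phi> T)) ` Ten n d)) \<le> real ?r" by (rule of_nat_mono)
  also have "real ?r = real a * (real (k ^ d) * real n ^ ((k - 1) * d div k))" by simp
  finally show ?thesis
    unfolding Bpot_def using \<open>a \<ge> 1\<close> by (simp add: divide_le_eq mult.commute)
qed

end
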